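(* Suppose $\gamma\in\mathbb N$. Then there exists a polynomial $P\in\mathbb R[X]$ of degree $\gamma$ and a constant $c$ such that the Laplace transform $\phi_1$ of the lateral invariant measure $\boldsymbol\nu_1$ satisfies $$\phi_1(y)=c\,\frac{P(y)}{\cos\bigl(\pi\sqrt{2y+\mu_1^2}\bigr)-\cos(\pi\gamma_1)}\qquad(\mathfrak{Re}(y)\le0),$$ removable singularities being filled in. Here, $P$ is given by $$P(y)=\prod_{k=1}^{\gamma}\bigl(y-\mathrm y(s_1+k)\bigr).$$
   Context: $\mathbb N=\{1,2,3,\dots\}$. The function $z\mapsto\cos(\sqrt z)$ is entire (independent of the choice of square root). Parameters: $r_1,r_2\in\mathbb R$ and $\mu_1,\mu_2>0$ with $\mu_1+\mu_2=1$, such that ($1-r_1r_2>0$, or $r_1>0$ and $r_2>0$), $\mu_1-r_2\mu_2>0$, $\mu_2-r_1\mu_1>0$, $r_1\neq -1$ and $r_2\neq -1$. Process: $\mathbf G=(G_1,G_2)$ is the degenerate obliquely reflected Brownian motion in $\mathbb R_+^2$, i.e. the continuous semimartingale with values in $\mathbb R_+^2$ satisfying $$G_1(t)=G_1(0)-\mu_1t+\widetilde W_1(t)+L_1(t)+r_2L_2(t),\qquad G_2(t)=G_2(0)-\mu_2t+\widetilde W_2(t)+r_1L_1(t)+L_2(t),$$ where $(\widetilde W_1,\widetilde W_2)$ is a centered Brownian motion with (singular) covariance matrix $\begin{pmatrix}1&-1\\-1&1\end{pmatrix}$ and $L_i$ (the local time of $G_i$ at $0$) is continuous, nondecreasing,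 $L_i(0)=0$, and increases only when $G_i=0$. Under the assumptions above this process is positive recurrent with a unique invariant probability measure $\boldsymbol\pi$. For Borel $A\subset(0,\infty)$, $\boldsymbol\nu_1(A)=\mathbb E_{\boldsymbol\pi}\int_0^2\mathbf 1_A(G_2(t))\,\mathrm dL_1(t)$, and $\phi_1(y)=\int_{(0,\infty)}e^{yv}\,\boldsymbol\nu_1(\mathrm dv)$ for $\mathfrak{Re}(y)\le0$. Further notation: $\mathrm y(s)=2s(s-\mu_1)$, $s_1=\dfrac{r_1\mu_1-\mu_2}{1+r_1}$, $s_2=\dfrac{\mu_1-r_2\mu_2}{1+r_2}$, $\gamma=s_2-s_1=\dfrac{1-r_1r_2}{(1+r_1)(1+r_2)}$, $\gamma_1=\mu_1-2s_1$. *)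

theory Defs
  imports "HOL-Probability.Probability"
begin

text \<open>
  Time is \<^typ>\<open>real\<close>; only the instants \<open>t \<ge> 0\<close> matter. A filtration on \<open>[0,\<infinity>)\<close> is regarded as
  indexed by \<^typ>\<open>real\<close>, being constant on the negative half-line, say.
\<close>

locale filtered_prob_space = prob_space M + filtration "space M" F
  for M :: "'a measure" and F :: "real \<Rightarrow> 'a measure" +
  assumes subalgebra_filtration: "subalgebra M (F t)"

definition adapted :: "(real \<Rightarrow> 'a measure) \<Rightarrow> (real \<Rightarrow> 'a \<Rightarrow> 'b::topological_space) \<Rightarrow> bool" where
  "adapted F X \<longleftrightarrow> (\<forall>t\<ge>0. X t \<in> borel_measurable (F t))"

text \<open>
  The increments of a centered Brownian motion with covariance matrix \<open>\<Sigma>\<close> are Gaussian vectors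
  with covariance \<open>(t - s) \<Sigma>\<close>. Since \<open>\<Sigma>\<close> may be singular, there need not be a density, and the
  Gaussian law is specified by its characteristic function.
\<close>

definition brownian_motion ::
  "'a measure \<Rightarrow> (real \<Rightarrow> 'a measure) \<Rightarrow> real^'n^'n \<Rightarrow> (real \<Rightarrow> 'a \<Rightarrow> real^'n) \<Rightarrow> bool" where
  "brownian_motion M F \<Sigma> W \<longleftrightarrow>
     adapted F W \<and>
     (AE \<omega> in M. W 0 \<omega> = 0 \<and> continuous_on {0..} (\<lambda>t. W t \<omega>)) \<and>
     (\<forall>s t. 0 \<le> s \<and> s \<le> t \<longrightarrow>
        prob_space.indep_set M (sets (F s))
          {(\<lambda>\<omega>. W t \<omega> - W s \<omega>) -` B \<inter> space M | B. B \<in> sets borel} \<and>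
        (\<forall>\<theta>. (LINT \<omega>|M. iexp (\<theta> \<bullet> (W t \<omega> - W s \<omega>))) =
              complex_of_real (exp (- (t - s) * (\<theta> \<bullet> (\<Sigma> *v \<theta>)) / 2))))"

text \<open>
  The obliquely reflected Brownian motion \<open>G\<close> in the quadrant, driven by \<open>W\<close> with singular
  covariance. The last condition in the definition says that \<open>L\<^sub>i\<close> increases only when
  \<open>G\<^sub>i = 0\<close>: it is constant on every time interval on which \<open>G\<^sub>i\<close> does not vanish.
\<close>

definition degenerate_reflected_bm ::
  "'a measure \<Rightarrow> (real \<Rightarrow> 'a measure) \<Rightarrow> real \<Rightarrow> real \<Rightarrow> real \<Rightarrow> real \<Rightarrow>
   (real \<Rightarrow> 'a \<Rightarrow> real^2) \<Rightarrow> (real \<Rightarrow> 'a \<Rightarrow> real^2) \<Rightarrow> (real \<Rightarrow> 'a \<Rightarrow> real^2) \<Rightarrow> bool" where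
  "degenerate_reflected_bm M F r\<^sub>1 r\<^sub>2 \<mu>\<^sub>1 \<mu>\<^sub>2 G W L \<longleftrightarrow>
     filtered_prob_space M F \<and>
     brownian_motion M F (vector [vector [1, -1], vector [-1, 1]]) W \<and>
     adapted F G \<and> adapted F L \<and>
     (AE \<omega> in M.
        continuous_on {0..} (\<lambda>t. G t \<omega>) \<and>
        continuous_on {0..} (\<lambda>t. L t \<omega>) \<and>
        (\<forall>t\<ge>0.
           G t \<omega> $ 1 = G 0 \<omega> $ 1 - \<mu>\<^sub>1 * t + W t \<omega> $ 1 + L t \<omega> $ 1 + r\<^sub>2 * L t \<omega> $ 2 \<and>
           G t \<omega> $ 2 = G 0 \<omega> $ 2 - \<mu>\<^sub>2 * t + W t \<omega> $ 2 + r\<^sub>1 * L t \<omega> $ 1 + L t \<omega> $ 2) \<and>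
        (\<forall>i.
           (\<forall>t\<ge>0. G t \<omega> $ i \<ge> 0) \<and>
           L 0 \<omega> $ i = 0 \<and>
           mono_on {0..} (\<lambda>t. L t \<omega> $ i) \<and>
           (\<forall>s t. 0 \<le> s \<and> s \<le> t \<and> (\<forall>u\<in>{s..t}. G u \<omega> $ i \<noteq> 0) \<longrightarrow> L t \<omega> $ i = L s \<omega> $ i)))"

text \<open>
  \<open>\<pi>\<close> is invariant for the process \<open>G\<close> when \<open>G\<close>, started with law \<open>\<pi>\<close> (the case \<open>t = 0\<close>), has
  law \<open>\<pi>\<close> at all times. Expectations with respect to \<open>M\<close> are then the expectations
  under which the initial law is \<open>\<pi>\<close>.
\<close>

definition invariant_law :: "'a measure \<Rightarrow> (real \<Rightarrow> 'a \<Rightarrow> real^2) \<Rightarrow> (real^2) measure \<Rightarrow> bool" where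
  "invariant_law M G \<pi> \<longleftrightarrow> (\<forall>t\<ge>0. distr M borel (G t) = \<pi>)"

text \<open>
  The Lebesgue--Stieltjes measure of a path on \<open>[0,\<infinity>)\<close>, extended by its initial value to
  negative times.
\<close>

definition path_measure :: "(real \<Rightarrow> real) \<Rightarrow> real measure" where
  "path_measure l = interval_measure (\<lambda>t. l (max 0 t))"

definition nu1 ::
  "'a measure \<Rightarrow> (real \<Rightarrow> 'a \<Rightarrow> real^2) \<Rightarrow> (real \<Rightarrow> 'a \<Rightarrow> real^2) \<Rightarrow> real measure" where
  "nu1 M G L = measure_of {0<..} (sets (restrict_space borel {0<..}))
     (\<lambda>A. \<integral>\<^sup>+\<omega>. (\<integral>\<^sup>+t\<in>{0..2}. indicator A (G t \<omega> $ 2) \<partial>path_measure (\<lambda>t. L t \<omega> $ 1)) \<partial>M)"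

definition phi1 ::
  "'a measure \<Rightarrow> (real \<Rightarrow> 'a \<Rightarrow> real^2) \<Rightarrow> (real \<Rightarrow> 'a \<Rightarrow> real^2) \<Rightarrow> complex \<Rightarrow> complex" where
  "phi1 M G L y = (LINT v|nu1 M G L. exp (y * complex_of_real v))"

definition y_fun :: "real \<Rightarrow> real \<Rightarrow> real" where
  "y_fun \<mu>\<^sub>1 s = 2 * s * (s - \<mu>\<^sub>1)"

definition s1 :: "real \<Rightarrow> real \<Rightarrow> real \<Rightarrow> real" where
  "s1 r\<^sub>1 \<mu>\<^sub>1 \<mu>\<^sub>2 = (r\<^sub>1 * \<mu>\<^sub>1 - \<mu>\<^sub>2) / (1 + r\<^sub>1)"

definition s2 :: "real \<Rightarrow> real \<Rightarrow> real \<Rightarrow> real" where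
  "s2 r\<^sub>2 \<mu>\<^sub>1 \<mu>\<^sub>2 = (\<mu>\<^sub>1 - r\<^sub>2 * \<mu>\<^sub>2) / (1 + r\<^sub>2)"

definition gam :: "real \<Rightarrow> real \<Rightarrow> real \<Rightarrow> real \<Rightarrow> real" where
  "gam r\<^sub>1 r\<^sub>2 \<mu>\<^sub>1 \<mu>\<^sub>2 = s2 r\<^sub>2 \<mu>\<^sub>1 \<mu>\<^sub>2 - s1 r\<^sub>1 \<mu>\<^sub>1 \<mu>\<^sub>2"

definition gam1 :: "real \<Rightarrow> real \<Rightarrow> real \<Rightarrow> real" where
  "gam1 r\<^sub>1 \<mu>\<^sub>1 \<mu>\<^sub>2 = \<mu>\<^sub>1 - 2 * s1 r\<^sub>1 \<mu>\<^sub>1 \<mu>\<^sub>2"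

definition denom :: "real \<Rightarrow> real \<Rightarrow> real \<Rightarrow> complex \<Rightarrow> complex" where
  "denom r\<^sub>1 \<mu>\<^sub>1 \<mu>\<^sub>2 y =
     cos (of_real pi * csqrt (2 * y + of_real (\<mu>\<^sub>1\<^sup>2))) - of_real (cos (pi * gam1 r\<^sub>1 \<mu>\<^sub>1 \<mu>\<^sub>2))"

end

theory Submission
  imports Defs "HOL-Complex_Analysis.Complex_Analysis" "HOL-Real_Asymp.Real_Asymp"
begin

text \<open>
  Along the parabola \<open>x(s) = 2 s (s + \<mu>\<^sub>2)\<close>, \<open>y(s) = 2 s (s - \<mu>\<^sub>1)\<close> the interior generator
  annihilates \<open>exp (x G\<^sub>1 + y G\<^sub>2)\<close>. In the stationary regime the expectation of this exponential
  is constant, so only the pushes at the two edges remain, and they balance: \<open>(1 + r\<^sub>1) (s - s\<^sub>1)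
  \<phi>\<^sub>1(y(s)) + (1 + r\<^sub>2) (s - s\<^sub>2) \<phi>\<^sub>2(x(s)) = 0\<close> for the Laplace transforms \<open>\<phi>\<^sub>1\<close>, \<open>\<phi>\<^sub>2\<close> of the
  two lateral measures. Now \<open>y\<close> is invariant under \<open>s \<mapsto> \<mu>\<^sub>1 - s\<close> and \<open>x\<close> under \<open>s \<mapsto> - \<mu>\<^sub>2 - s\<close>.
  Because \<open>\<mu>\<^sub>1 + \<mu>\<^sub>2 = 1\<close>, the composition of the two reflections is the shift \<open>s \<mapsto> s + 1\<close>, and
  the balance becomes a first-order difference equation for \<open>s \<mapsto> \<phi>\<^sub>1(y(s))\<close>. When \<open>s\<^sub>2 - s\<^sub>1 = n\<close>
  is a positive integer, \<open>P(y(s))\<close>, with \<open>P\<close> the announced polynomial, solves the same difference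
  equation: the factors telescope. Hence \<open>H(s) = \<phi>\<^sub>1(y(s)) D(s) / P(y(s))\<close> has period \<open>1\<close>, where
  \<open>D(s)\<close> is the difference of cosines at \<open>y(s)\<close>. The zeros of \<open>D\<close> cancel all zeros of \<open>P(y(s))\<close>
  and the pole that the continuation of \<open>\<phi>\<^sub>1(y(s))\<close> may have at \<open>s\<^sub>1\<close>, so \<open>H\<close> is entire. As \<open>\<phi>\<^sub>1\<close>
  is bounded and \<open>n \<ge> 1\<close>, \<open>H\<close> grows more slowly than \<open>exp (2 \<pi> |Im s|)\<close>, and Liouville's theorem
  in the variable \<open>exp (2 \<pi> i s)\<close> makes it constant. The identity theorem carries \<open>\<phi>\<^sub>1 D = c P\<close>
  from the strip to the half plane. The balance is needed only for imaginary \<open>s\<close>. There \<open>Re x = Re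
  y\<close>, and since the two noises are opposite, the Brownian motion enters the exponential through a
  factor of modulus one. Hence the increments of the exponential over a fine partition are
  controlled by the characteristic function of the Brownian increments and by dominated
  convergence (\<open>basic_adjoint_relation\<close>). Two other exponents in the same relation show that the
  local times do not grow at the corner: \<open>(i k, 0)\<close> gives decay of the characteristic function of
  \<open>G\<^sub>1\<close>, so \<open>G\<close> spends no time at the corner, and \<open>(- p, - p)\<close> with \<open>p \<rightarrow> \<infinity>\<close> compares this time
  with the pushes received there (\<open>AE_doleans_not_corner\<close>). The local times are integrable because
  \<open>G\<^sub>1 + G\<^sub>2\<close> is stationary and has no martingale part (\<open>integrable_total_push\<close>). The analytic
  half is \<open>strip_solution\<close>, with \<open>H_periodic\<close>, \<open>H_growth\<close> and \<open>punctured_plane_constant\<close> as its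
  steps, followed by \<open>half_plane_solution\<close> and \<open>removable_quotient\<close>.
\<close>

(* The dollar sign is reserved for the components of a vector. *)
no_notation fps_nth (infixl \<open>$\<close> 75)

section \<open>The measure of a random increasing path\<close>

text \<open>
  A random continuous nondecreasing path \<open>l\<close>, frozen outside \<open>[0, T]\<close>. Freezing makes each
  Lebesgue--Stieltjes measure finite with total mass \<open>l T\<close>, and asking for the path properties at
  every \<open>\<omega>\<close> keeps exceptional sets out of the measurability arguments.
\<close>

locale increasing_process = prob_space M for M :: "'a measure" +
  fixes T :: real and l :: "real \<Rightarrow> 'a \<Rightarrow> real"
  assumes horizon_pos: "T > 0"
    and meas [measurable]: "\<And>t. l t \<in> borel_measurable M"
    and cont: "\<And>\<omega>. continuous_on UNIV (\<lambda>t. l t \<omega>)"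
    and incr: "\<And>\<omega> s t. s \<le> t \<Longrightarrow> l s \<omega> \<le> l t \<omega>"
    and before: "\<And>\<omega> t. t \<le> 0 \<Longrightarrow> l t \<omega> = 0"
    and after: "\<And>\<omega> t. T \<le> t \<Longrightarrow> l t \<omega> = l T \<omega>"
    and integrable_horizon: "integrable M (l T)"
begin

lemma nonneg: "0 \<le> l t \<omega>"
  using incr[of 0 t \<omega>] before[of t \<omega>] before[of 0 \<omega>] by (cases "t \<le> 0") auto

definition stieltjes :: "'a \<Rightarrow> real measure" where
  "stieltjes \<omega> = interval_measure (\<lambda>t. l t \<omega>)"

lemma sets_stieltjes [simp, measurable_cong]: "sets (stieltjes \<omega>) = sets borel"
  and space_stieltjes [simp]: "space (stieltjes \<omega>) = UNIV"
  by (auto simp: stieltjes_def)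

lemma emeasure_stieltjes_Ioc:
  "emeasure (stieltjes \<omega>) {a<..b} = (if a \<le> b then ennreal (l b \<omega> - l a \<omega>) else 0)"
proof (cases "a \<le> b")
  case True
  have "continuous (at_right c) (\<lambda>t. l t \<omega>)" for c
    using cont[of \<omega>] by (simp add: continuous_on_eq_continuous_at continuous_at_imp_continuous_at_within)
  with True show ?thesis
    unfolding stieltjes_def by (simp add: emeasure_interval_measure_Ioc incr)
qed simp

lemma emeasure_stieltjes_UNIV: "emeasure (stieltjes \<omega>) UNIV = ennreal (l T \<omega>)"
proof -
  have lim: "(\<lambda>n. emeasure (stieltjes \<omega>) {- real n<..real n}) \<longlonglongrightarrow> emeasure (stieltjes \<omega>) (\<Union>n. {- real n<..real n})"
    by (rule Lim_emeasure_incseq) (auto simp: incseq_def)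
  have union: "(\<Union>n. {- real n<..real n}) = UNIV"
  proof -
    have "x \<in> (\<Union>n. {- real n<..real n})" for x :: real
    proof -
      obtain n :: nat where "\<bar>x\<bar> < n" using reals_Archimedean2 by blast
      then show ?thesis by (intro UN_I[of n]) auto
    qed
    then show ?thesis by blast
  qed
  have "(\<lambda>n. emeasure (stieltjes \<omega>) {- real n<..real n}) \<longlonglongrightarrow> ennreal (l T \<omega>)"
  proof (rule tendsto_eventually)
    obtain N :: nat where "T < N" using reals_Archimedean2 by blast
    show "\<forall>\<^sub>F n in sequentially. emeasure (stieltjes \<omega>) {- real n<..real n} = ennreal (l T \<omega>)"
    proof (rule eventually_sequentiallyI[of N])
      fix n assume "N \<le> n"
      with \<open>T < N\<close> have "l (real n) \<omega> = l T \<omega>" by (intro after) linarith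
      then show "emeasure (stieltjes \<omega>) {- real n<..real n} = ennreal (l T \<omega>)"
        by (simp add: emeasure_stieltjes_Ioc before)
    qed
  qed
  from LIMSEQ_unique[OF lim this] show ?thesis unfolding union .
qed

text \<open>
  Division by \<open>1 + l T\<close> turns the path measures into subprobability measures, so that they form a
  kernel for the Giry monad; \<open>doleans\<close> below multiplies the factor back.
\<close>

definition kernel :: "'a \<Rightarrow> real measure" where
  "kernel \<omega> = scale_measure (ennreal (1 / (1 + l T \<omega>))) (stieltjes \<omega>)"

lemma sets_kernel_eq [simp, measurable_cong]: "sets (kernel \<omega>) = sets borel"
  and space_kernel_eq [simp]: "space (kernel \<omega>) = UNIV"
  by (auto simp: kernel_def space_scale_measure)

lemma measurable_kernel [measurable]: "kernel \<in> measurable M (subprob_algebra borel)"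
proof (rule measurable_subprob_algebra_generated[where \<Omega>=UNIV and G="range (\<lambda>(a, b). {a<..b})"])
  show "sets borel = sigma_sets UNIV (range (\<lambda>(a, b). {a<..b :: real}))"
    by (simp add: borel_sigma_sets_Ioc)
  show "Int_stable (range (\<lambda>(a, b). {a<..b :: real}))"
    by (auto simp: Int_stable_def)
  fix \<omega> assume "\<omega> \<in> space M"
  show "subprob_space (kernel \<omega>)"
  proof
    show "emeasure (kernel \<omega>) (space (kernel \<omega>)) \<le> 1"
      using nonneg[of T \<omega>]
      by (simp add: kernel_def space_scale_measure emeasure_stieltjes_UNIV flip: ennreal_mult')
  qed simp
next
  fix A assume "A \<in> range (\<lambda>(a, b). {a<..b :: real})"
  then obtain a b where A: "A = {a<..b}" by auto
  show "(\<lambda>\<omega>. emeasure (kernel \<omega>) A) \<in> borel_measurable M"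
    unfolding A kernel_def emeasure_scale_measure emeasure_stieltjes_Ioc by measurable
next
  show "(\<lambda>\<omega>. emeasure (kernel \<omega>) UNIV) \<in> borel_measurable M"
    unfolding kernel_def emeasure_scale_measure emeasure_stieltjes_UNIV by measurable
qed (simp_all add: kernel_def)

text \<open>
  The Doleans measure on \<open>\<Omega> \<times> [0, T]\<close>: it integrates a random function of time against the
  path and then takes the expectation, see \<open>nn_integral_doleans\<close>.
\<close>

definition doleans :: "('a \<times> real) measure" where
  "doleans = density (M \<bind> (\<lambda>\<omega>. distr (kernel \<omega>) (M \<Otimes>\<^sub>M borel) (Pair \<omega>)))
     (\<lambda>z. ennreal (1 + l T (fst z)))"

lemma measurable_graph_kernel [measurable]:
  "(\<lambda>\<omega>. distr (kernel \<omega>) (M \<Otimes>\<^sub>M borel) (Pair \<omega>)) \<in> measurable M (subprob_algebra (M \<Otimes>\<^sub>M borel))"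
  by (rule measurable_distr2[OF _ measurable_kernel]) simp

lemma sets_doleans [simp, measurable_cong]: "sets doleans = sets (M \<Otimes>\<^sub>M borel)"
  unfolding doleans_def sets_density
  by (rule sets_bind_measurable[OF measurable_graph_kernel not_empty])

lemma space_doleans [simp]: "space doleans = space M \<times> UNIV"
  using sets_eq_imp_space_eq[OF sets_doleans] by (simp add: space_pair_measure)

lemma nn_integral_doleans:
  assumes [measurable]: "f \<in> borel_measurable (M \<Otimes>\<^sub>M borel)"
  shows "(\<integral>\<^sup>+z. f z \<partial>doleans) = (\<integral>\<^sup>+\<omega>. \<integral>\<^sup>+t. f (\<omega>, t) \<partial>stieltjes \<omega> \<partial>M)"
proof -
  let ?B = "M \<bind> (\<lambda>\<omega>. distr (kernel \<omega>) (M \<Otimes>\<^sub>M borel) (Pair \<omega>))"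
  have [measurable_cong]: "sets ?B = sets (M \<Otimes>\<^sub>M borel)"
    by (rule sets_bind_measurable[OF measurable_graph_kernel not_empty])
  have "(\<integral>\<^sup>+z. f z \<partial>doleans) = (\<integral>\<^sup>+z. ennreal (1 + l T (fst z)) * f z \<partial>?B)"
    unfolding doleans_def by (rule nn_integral_density) simp_all
  also have "\<dots> = (\<integral>\<^sup>+\<omega>. \<integral>\<^sup>+z. ennreal (1 + l T (fst z)) * f z \<partial>distr (kernel \<omega>) (M \<Otimes>\<^sub>M borel) (Pair \<omega>) \<partial>M)"
    by (rule nn_integral_bind[OF _ measurable_graph_kernel]) measurable
  also have "\<dots> = (\<integral>\<^sup>+\<omega>. \<integral>\<^sup>+t. f (\<omega>, t) \<partial>stieltjes \<omega> \<partial>M)"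
  proof (rule nn_integral_cong)
    fix \<omega> assume \<omega> [simp]: "\<omega> \<in> space M"
    have [measurable]: "(\<lambda>t. f (\<omega>, t)) \<in> borel_measurable borel" by measurable
    have "(\<integral>\<^sup>+z. ennreal (1 + l T (fst z)) * f z \<partial>distr (kernel \<omega>) (M \<Otimes>\<^sub>M borel) (Pair \<omega>))
        = (\<integral>\<^sup>+t. ennreal (1 + l T \<omega>) * f (\<omega>, t) \<partial>kernel \<omega>)"
      by (subst nn_integral_distr) simp_all
    also have "\<dots> = ennreal (1 + l T \<omega>) * (\<integral>\<^sup>+t. f (\<omega>, t) \<partial>kernel \<omega>)"
      by (rule nn_integral_cmult) simp
    also have "\<dots> = ennreal (1 + l T \<omega>) * (ennreal (1 / (1 + l T \<omega>)) * (\<integral>\<^sup>+t. f (\<omega>, t) \<partial>stieltjes \<omega>))"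
      unfolding kernel_def by (subst nn_integral_scale_measure) simp_all
    also have "\<dots> = (\<integral>\<^sup>+t. f (\<omega>, t) \<partial>stieltjes \<omega>)"
    proof -
      have "ennreal (1 + l T \<omega>) * ennreal (1 / (1 + l T \<omega>)) = 1"
        using nonneg[of T \<omega>] by (subst ennreal_mult[symmetric]) simp_all
      then show ?thesis by (simp only: mult.assoc[symmetric] mult_1_left)
    qed
    finally show "(\<integral>\<^sup>+z. ennreal (1 + l T (fst z)) * f z \<partial>distr (kernel \<omega>) (M \<Otimes>\<^sub>M borel) (Pair \<omega>))
        = (\<integral>\<^sup>+t. f (\<omega>, t) \<partial>stieltjes \<omega>)" .
  qed
  finally show ?thesis .
qed

lemma finite_measure_doleans: "finite_measure doleans"
proof
  have "emeasure doleans (space doleans) = (\<integral>\<^sup>+z. 1 \<partial>doleans)" by simp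
  also have "\<dots> = (\<integral>\<^sup>+\<omega>. ennreal (l T \<omega>) \<partial>M)"
    by (subst nn_integral_doleans) (simp_all add: emeasure_stieltjes_UNIV)
  also have "\<dots> < \<infinity>"
    using integrable_horizon nonneg
    by (simp add: nn_integral_eq_integral)
  finally show "emeasure doleans (space doleans) \<noteq> \<infinity>" by simp
qed

text \<open>
  Cut to a time strip, the Doleans measure projects onto \<open>\<Omega>\<close> with density the increment of
  the path. This transfers the formula from nonnegative to complex integrands without splitting
  them.
\<close>

lemma integral_doleans_strip:
  fixes H :: "'a \<Rightarrow> complex"
  assumes ab: "a \<le> b" and [measurable]: "H \<in> borel_measurable M"
  shows "(LINT z|doleans. indicator {a<..b} (snd z) *\<^sub>R H (fst z)) =
         (LINT \<omega>|M. (l b \<omega> - l a \<omega>) *\<^sub>R H \<omega>)"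
proof -
  have eq: "distr (density doleans (\<lambda>z. indicator {a<..b} (snd z))) M fst =
            density M (\<lambda>\<omega>. ennreal (l b \<omega> - l a \<omega>))"
  proof (rule measure_eqI)
    fix A assume "A \<in> sets (distr (density doleans (\<lambda>z. indicator {a<..b} (snd z))) M fst)"
    then have [measurable]: "A \<in> sets M" by simp
    have "emeasure (distr (density doleans (\<lambda>z. indicator {a<..b} (snd z))) M fst) A
        = (\<integral>\<^sup>+z. indicator {a<..b} (snd z) * indicator (fst -` A \<inter> space doleans) z \<partial>doleans)"
    proof -
      have "fst -` A \<inter> space doleans \<in> sets doleans" by measurable
      then show ?thesis by (subst emeasure_distr) (simp_all add: emeasure_density del: space_doleans)
    qed
    also have "\<dots> = (\<integral>\<^sup>+z. indicator {a<..b} (snd z) * indicator A (fst z) \<partial>doleans)"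
      by (intro nn_integral_cong) (auto simp: indicator_def)
    also have "\<dots> = (\<integral>\<^sup>+\<omega>. \<integral>\<^sup>+t. indicator A \<omega> * indicator {a<..b} t \<partial>stieltjes \<omega> \<partial>M)"
      by (subst nn_integral_doleans) (simp_all add: mult.commute)
    also have "\<dots> = (\<integral>\<^sup>+\<omega>. ennreal (l b \<omega> - l a \<omega>) * indicator A \<omega> \<partial>M)"
      using ab by (intro nn_integral_cong) (simp add: nn_integral_cmult emeasure_stieltjes_Ioc mult.commute)
    finally show "emeasure (distr (density doleans (\<lambda>z. indicator {a<..b} (snd z))) M fst) A =
        emeasure (density M (\<lambda>\<omega>. ennreal (l b \<omega> - l a \<omega>))) A"
      by (simp add: emeasure_density)
  qed simp
  have "(LINT z|doleans. indicator {a<..b} (snd z) *\<^sub>R H (fst z)) =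
        (LINT z|density doleans (\<lambda>z. ennreal (indicator {a<..b} (snd z))). H (fst z))"
    by (rule integral_density[symmetric]) simp_all
  also have "\<dots> = (LINT \<omega>|distr (density doleans (\<lambda>z. indicator {a<..b} (snd z))) M fst. H \<omega>)"
    by (subst integral_distr) (simp_all add: ennreal_indicator)
  also have "\<dots> = (LINT \<omega>|M. (l b \<omega> - l a \<omega>) *\<^sub>R H \<omega>)"
    unfolding eq using incr[OF ab] by (subst integral_density) simp_all
  finally show ?thesis .
qed

lemma integrable_increment:
  fixes H :: "'a \<Rightarrow> complex"
  assumes ab: "a \<le> b" and [measurable]: "H \<in> borel_measurable M"
    and bound: "\<And>\<omega>. \<omega> \<in> space M \<Longrightarrow> cmod (H \<omega>) \<le> C"
  shows "integrable M (\<lambda>\<omega>. (l b \<omega> - l a \<omega>) *\<^sub>R H \<omega>)"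
proof (rule Bochner_Integration.integrable_bound[where f="\<lambda>\<omega>. C * l T \<omega>"])
  show "AE \<omega> in M. norm ((l b \<omega> - l a \<omega>) *\<^sub>R H \<omega>) \<le> norm (C * l T \<omega>)"
  proof (rule AE_I2)
    fix \<omega> assume "\<omega> \<in> space M"
    then have C: "cmod (H \<omega>) \<le> C" "0 \<le> C"
      using bound[of \<omega>] by (auto intro: order_trans[OF norm_ge_zero])
    have "l b \<omega> \<le> l T \<omega>"
      using incr[of b T \<omega>] after[of b \<omega>] by (cases "b \<le> T") auto
    then have "\<bar>l b \<omega> - l a \<omega>\<bar> \<le> l T \<omega>"
      using incr[OF ab, of \<omega>] nonneg[of a \<omega>] by simp
    with C have "\<bar>l b \<omega> - l a \<omega>\<bar> * cmod (H \<omega>) \<le> l T \<omega> * C"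
      by (intro mult_mono) auto
    then show "norm ((l b \<omega> - l a \<omega>) *\<^sub>R H \<omega>) \<le> norm (C * l T \<omega>)"
      using C nonneg[of T \<omega>] by (simp add: abs_mult mult.commute)
  qed
qed (use integrable_horizon in auto)

lemma AE_doleans_time: "AE z in doleans. snd z \<in> {0<..T}"
proof -
  have "(\<integral>\<^sup>+z. indicator (- {0<..T}) (snd z) \<partial>doleans) =
        (\<integral>\<^sup>+\<omega>. \<integral>\<^sup>+t. indicator (- {0<..T}) t \<partial>stieltjes \<omega> \<partial>M)"
    by (subst nn_integral_doleans) simp_all
  also have "\<dots> = (\<integral>\<^sup>+\<omega>. 0 \<partial>M)"
  proof (rule nn_integral_cong)
    fix \<omega>
    have "emeasure (stieltjes \<omega>) (UNIV - {0<..T}) = emeasure (stieltjes \<omega>) UNIV - emeasure (stieltjes \<omega>) {0<..T}"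
      using horizon_pos
      by (subst emeasure_Diff) (auto simp: emeasure_stieltjes_Ioc)
    also have "\<dots> = 0"
      using horizon_pos by (simp add: emeasure_stieltjes_UNIV emeasure_stieltjes_Ioc before)
    finally show "(\<integral>\<^sup>+t. indicator (- {0<..T}) t \<partial>stieltjes \<omega>) = 0"
      by (simp add: Compl_eq_Diff_UNIV)
  qed
  finally have "AE z in doleans. (indicator (- {0<..T}) (snd z) :: ennreal) = 0"
    by (subst nn_integral_0_iff_AE[symmetric]) simp_all
  then show ?thesis
    by (rule AE_mp) (auto simp: indicator_def split: if_splits)
qed

text \<open>
  Convergence of Riemann--Stieltjes sums in expectation. The sum is the Doleans integral of the
  function that on the \<open>i\<close>-th time step equals \<open>H n i\<close>. At a fixed time the active steps shrink to
  that time, and the integrands are bounded on a finite measure space, so dominated convergence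
  applies.
\<close>

lemma step_integral_tendsto:
  fixes H :: "nat \<Rightarrow> nat \<Rightarrow> 'a \<Rightarrow> complex" and h :: "'a \<times> real \<Rightarrow> complex"
  assumes H [measurable]: "\<And>n i. i < n \<Longrightarrow> H n i \<in> borel_measurable M"
    and bound: "\<And>n i \<omega>. i < n \<Longrightarrow> \<omega> \<in> space M \<Longrightarrow> cmod (H n i \<omega>) \<le> C"
    and h [measurable]: "h \<in> borel_measurable (M \<Otimes>\<^sub>M borel)"
    and lim: "\<And>\<omega> t i. \<omega> \<in> space M \<Longrightarrow> 0 < t \<Longrightarrow> t \<le> T \<Longrightarrow> (\<And>n. 0 < n \<Longrightarrow> i n < n) \<Longrightarrow>
        (\<lambda>n. T * real (i n) / real n) \<longlonglongrightarrow> t \<Longrightarrow> (\<lambda>n. T * (real (i n) + 1) / real n) \<longlonglongrightarrow> t \<Longrightarrow>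
        (\<lambda>n. H n (i n) \<omega>) \<longlonglongrightarrow> h (\<omega>, t)"
  shows "(\<lambda>n. LINT \<omega>|M. (\<Sum>i<n. (l (T * (real i + 1) / real n) \<omega> - l (T * real i / real n) \<omega>) *\<^sub>R H n i \<omega>))
           \<longlonglongrightarrow> (LINT z|doleans. h z)"
proof -
  interpret D: finite_measure doleans by (rule finite_measure_doleans)
  note T = horizon_pos
  define I where "I n i = {T * real i / real n <.. T * (real i + 1) / real n}" for n i :: nat
  define S where "S n z = (\<Sum>i<n. indicator (I n i) (snd z) *\<^sub>R H n i (fst z))" for n z
  \<comment> \<open>the time step of the partition that contains t\<close>
  define idx where "idx t n = nat (\<lceil>real n * t / T\<rceil> - 1)" for t :: real and n :: nat
  have mem_I: "t \<in> I n i \<longleftrightarrow> i = idx t n" if "0 < t" "0 < n" for t :: real and i n :: nat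
  proof -
    have "t \<in> I n i \<longleftrightarrow> real i < real n * t / T \<and> real n * t / T \<le> real i + 1"
      using T that by (simp add: I_def field_simps)
    also have "\<dots> \<longleftrightarrow> \<lceil>real n * t / T\<rceil> = int i + 1"
      by (simp add: ceiling_eq_iff)
    also have "\<dots> \<longleftrightarrow> i = idx t n"
    proof -
      have "0 < \<lceil>real n * t / T\<rceil>" using T that by simp
      then show ?thesis unfolding idx_def by linarith
    qed
    finally show ?thesis .
  qed
  have idx_less: "idx t n < n" if "0 < t" "t \<le> T" "0 < n" for t n
  proof -
    have "real n * t / T \<le> real n" using T that by (simp add: field_simps mult_left_mono)
    then have "\<lceil>real n * t / T\<rceil> \<le> int n" by (simp add: ceiling_le_iff)
    then show ?thesis using that unfolding idx_def by linarith
  qed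
  have S_eq: "S n z = H n (idx (snd z) n) (fst z)" if "0 < snd z" "snd z \<le> T" "0 < n" for n z
  proof -
    have "S n z = (\<Sum>i<n. if i = idx (snd z) n then H n i (fst z) else 0)"
      unfolding S_def using mem_I[OF that(1,3)] by (intro sum.cong) auto
    then show ?thesis using idx_less[OF that] by simp
  qed
  have int_term: "integrable doleans (\<lambda>z. indicator (I n i) (snd z) *\<^sub>R H n i (fst z))" if "i < n" for n i
  proof (rule D.integrable_const_bound[where B=C])
    show "AE z in doleans. cmod (indicator (I n i) (snd z) *\<^sub>R H n i (fst z)) \<le> C"
      using bound[OF that] order_trans[OF norm_ge_zero bound[OF that]]
      by (intro AE_I2) (auto simp: indicator_def)
  qed (use that in \<open>simp add: I_def\<close>)
  have int_S: "(LINT z|doleans. S n z) =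
      (LINT \<omega>|M. (\<Sum>i<n. (l (T * (real i + 1) / real n) \<omega> - l (T * real i / real n) \<omega>) *\<^sub>R H n i \<omega>))" for n
  proof -
    have le: "T * real i / real n \<le> T * (real i + 1) / real n" for i
      using T by (simp add: divide_right_mono)
    have int: "integrable M (\<lambda>\<omega>. (l (T * (real i + 1) / real n) \<omega> - l (T * real i / real n) \<omega>) *\<^sub>R H n i \<omega>)" if "i < n" for i
      by (rule integrable_increment[OF le H[OF that] bound[OF that]])
    have "(LINT z|doleans. S n z) = (\<Sum>i<n. LINT z|doleans. indicator (I n i) (snd z) *\<^sub>R H n i (fst z))"
      unfolding S_def using int_term by (intro Bochner_Integration.integral_sum) auto
    also have "\<dots> = (\<Sum>i<n. LINT \<omega>|M. (l (T * (real i + 1) / real n) \<omega> - l (T * real i / real n) \<omega>) *\<^sub>R H n i \<omega>)"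
      unfolding I_def by (intro sum.cong integral_doleans_strip le) auto
    also have "\<dots> = (LINT \<omega>|M. (\<Sum>i<n. (l (T * (real i + 1) / real n) \<omega> - l (T * real i / real n) \<omega>) *\<^sub>R H n i \<omega>))"
      using int by (intro Bochner_Integration.integral_sum[symmetric]) auto
    finally show ?thesis .
  qed
  have S_meas: "S n \<in> borel_measurable doleans" for n
    unfolding S_def using int_term by (intro borel_measurable_sum borel_measurable_integrable) simp
  have S_lim: "AE z in doleans. (\<lambda>n. S n z) \<longlonglongrightarrow> h z"
    using AE_doleans_time AE_space[of doleans]
  proof eventually_elim
    case (elim z)
    let ?t = "snd z"
    from elim have t: "0 < ?t" "?t \<le> T" and \<omega>: "fst z \<in> space M" by auto
    have I: "T * real (idx ?t n) / real n < ?t \<and> ?t \<le> T * (real (idx ?t n) + 1) / real n" if "0 < n" for n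
      using mem_I[OF t(1) that, of "idx ?t n"] by (simp add: I_def)
    have d: "T * (real (idx ?t n) + 1) / real n = T * real (idx ?t n) / real n + T / real n" for n
      by (simp add: distrib_left add_divide_distrib)
    have T0: "(\<lambda>n. T / real n) \<longlonglongrightarrow> 0" by (rule lim_const_over_n)
    have l1: "(\<lambda>n. T * real (idx ?t n) / real n) \<longlonglongrightarrow> ?t"
    proof (rule tendsto_sandwich)
      show "\<forall>\<^sub>F n in sequentially. ?t - T / real n \<le> T * real (idx ?t n) / real n"
        using eventually_gt_at_top[of 0] by eventually_elim (use I d in \<open>smt (verit)\<close>)
      show "\<forall>\<^sub>F n in sequentially. T * real (idx ?t n) / real n \<le> ?t"
        using eventually_gt_at_top[of 0] by eventually_elim (use I d in \<open>smt (verit)\<close>)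
      show "(\<lambda>n. ?t - T / real n) \<longlonglongrightarrow> ?t" using tendsto_diff[OF tendsto_const T0, of ?t] by simp
    qed simp
    have l2: "(\<lambda>n. T * (real (idx ?t n) + 1) / real n) \<longlonglongrightarrow> ?t"
      unfolding d using tendsto_add[OF l1 T0] by simp
    have A: "(\<lambda>n. H n (idx ?t n) (fst z)) \<longlonglongrightarrow> h (fst z, ?t)"
      by (rule lim[of "fst z" ?t "idx ?t", OF \<omega> t idx_less[OF t] l1 l2])
    have B: "\<forall>\<^sub>F n in sequentially. H n (idx ?t n) (fst z) = S n z"
      using S_eq[of z, OF t] by (intro eventually_sequentiallyI[of 1]) simp
    have C: "h (fst z, ?t) = h z" by simp
    from Lim_transform_eventually[OF A B] show ?case unfolding C .
  qed
  have S_bound: "AE z in doleans. cmod (S n z) \<le> \<bar>C\<bar>" for n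
    using AE_doleans_time AE_space[of doleans]
  proof eventually_elim
    case (elim z)
    then show ?case
    proof (cases "0 < n")
      case True
      then have "cmod (S n z) \<le> C"
        using elim by (auto simp: S_eq[OF _ _ True] intro!: bound[OF idx_less[OF _ _ True]])
      then show ?thesis by simp
    qed (simp add: S_def)
  qed
  have h_meas: "h \<in> borel_measurable doleans" by measurable
  have "integrable doleans (\<lambda>_. \<bar>C\<bar>)" by simp
  from integral_dominated_convergence[OF h_meas S_meas this S_lim S_bound]
  have "(\<lambda>n. LINT z|doleans. S n z) \<longlonglongrightarrow> (LINT z|doleans. h z)" .
  then show ?thesis unfolding int_S .
qed

end

text \<open>
  The mass that a path on \<open>[0,\<infinity>)\<close> puts on \<open>[0, T]\<close> is the measure of the path frozen after \<open>T\<close>; there is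
  no atom at \<open>0\<close> because the path, extended by a constant, is continuous there.
\<close>

lemma nn_integral_path_measure_upto:
  assumes T: "T > 0" and cont: "continuous_on {0..} l" and mono: "mono_on {0..} l"
    and [measurable]: "h \<in> borel_measurable borel"
  shows "(\<integral>\<^sup>+t\<in>{0..T}. h t \<partial>path_measure l) = (\<integral>\<^sup>+t. h t \<partial>interval_measure (\<lambda>t. l (max 0 (min T t))))"
proof -
  let ?P = "path_measure l" and ?I = "interval_measure (\<lambda>t. l (max 0 (min T t)))"
  have cP: "continuous_on UNIV (\<lambda>t. l (max 0 t))"
    by (rule continuous_on_compose2[OF cont]) (auto intro!: continuous_intros)
  have cI: "continuous_on UNIV (\<lambda>t. l (max 0 (min T t)))"
    by (rule continuous_on_compose2[OF cont]) (auto intro!: continuous_intros)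
  have mP: "l (max 0 s) \<le> l (max 0 t)" if "s \<le> t" for s t
    using that by (intro mono_onD[OF mono]) auto
  have mI: "l (max 0 (min T s)) \<le> l (max 0 (min T t))" if "s \<le> t" for s t
    using that by (intro mono_onD[OF mono]) auto
  have P: "emeasure ?P {a..b} = ennreal (l (max 0 b) - l (max 0 a))" if "a \<le> b" for a b
    unfolding path_measure_def by (rule emeasure_interval_measure_Icc[OF that mP cP])
  have I: "emeasure ?I {a..b} = ennreal (l (max 0 (min T b)) - l (max 0 (min T a)))" if "a \<le> b" for a b
    by (rule emeasure_interval_measure_Icc[OF that mI cI])
  have sets_Icc: "sets borel = sigma_sets UNIV (range (\<lambda>(a, b). {a..b :: real}))"
    by (subst borel_eq_atLeastAtMost) simp
  have sP [simp, measurable_cong]: "sets ?P = sets borel" "space ?P = UNIV" by (auto simp: path_measure_def)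
  have "density ?P (indicator {0..T}) = ?I"
  proof (rule measure_eqI_generator_eq[where \<Omega>=UNIV and E="range (\<lambda>(a, b). {a..b :: real})" and A="\<lambda>n. {- real n..real n}"])
    show "Int_stable (range (\<lambda>(a, b). {a..b :: real}))"
      by (auto simp: Int_stable_def)
    show "sets (density ?P (indicator {0..T})) = sigma_sets UNIV (range (\<lambda>(a, b). {a..b :: real}))"
      by (simp add: sets_Icc)
    show "sets ?I = sigma_sets UNIV (range (\<lambda>(a, b). {a..b :: real}))"
      by (simp add: sets_Icc)
    show "(\<Union>i. {- real i..real i}) = UNIV"
    proof -
      have "x \<in> (\<Union>n. {- real n..real n})" for x :: real
      proof -
        obtain n :: nat where "\<bar>x\<bar> < n" using reals_Archimedean2 by blast
        then show ?thesis by (intro UN_I[of n]) auto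
      qed
      then show ?thesis by blast
    qed
    show E: "emeasure (density ?P (indicator {0..T})) X = emeasure ?I X" if "X \<in> range (\<lambda>(a, b). {a..b :: real})" for X
    proof -
      from that obtain a b where X: "X = {a..b}" by auto
      show ?thesis
      proof (cases "a \<le> b")
        case True
        have "emeasure (density ?P (indicator {0..T})) X = emeasure ?P ({0..T} \<inter> {a..b})"
          by (simp add: X emeasure_density flip: indicator_inter_arith)
        also have "\<dots> = emeasure ?I {a..b}"
        proof (cases "max 0 a \<le> min T b")
          case True
          then have "max 0 (max 0 a) = max 0 (min T a)" "max 0 (min T b) = max 0 (min T b)" using \<open>a \<le> b\<close> by auto
          moreover have "{0..T} \<inter> {a..b} = {max 0 a..min T b}" by auto
          ultimately show ?thesis using P[OF True] I[OF \<open>a \<le> b\<close>] by simp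
        next
          case False
          then have "max 0 (min T a) = max 0 (min T b)" using T \<open>a \<le> b\<close> by auto
          moreover have "{0..T} \<inter> {a..b} = {}" using False by auto
          ultimately show ?thesis using I[OF \<open>a \<le> b\<close>] by simp
        qed
        finally show ?thesis by (simp add: X)
      qed (simp add: X)
    qed
    have Icc_mem: "{- real n..real n} \<in> range (\<lambda>(a, b). {a..b :: real})" for n
      by (rule range_eqI[where x="(- real n, real n)"]) simp
    then show "range (\<lambda>n. {- real n..real n}) \<subseteq> range (\<lambda>(a, b). {a..b :: real})"
      by blast
    show "emeasure (density ?P (indicator {0..T})) {- real i..real i} \<noteq> \<infinity>" for i
      unfolding E[OF Icc_mem] by (simp add: I)
  qed auto
  then have "(\<integral>\<^sup>+t. h t \<partial>?I) = (\<integral>\<^sup>+t. h t \<partial>density ?P (indicator {0..T}))" by simp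
  also have "\<dots> = (\<integral>\<^sup>+t. indicator {0..T} t * h t \<partial>?P)"
    by (rule nn_integral_density) simp_all
  finally show ?thesis by (simp add: mult.commute)
qed

section \<open>Increments of the driving noise\<close>

lemma borel_measurable_vec_nth_comp [measurable (raw)]:
  fixes f :: "'a \<Rightarrow> real^'n"
  assumes [measurable]: "f \<in> borel_measurable M"
  shows "(\<lambda>x. f x $ i) \<in> borel_measurable M"
proof -
  have "(\<lambda>v :: real^'n. v $ i) \<in> borel_measurable borel"
    by (intro borel_measurable_continuous_onI continuous_intros)
  with assms show ?thesis by (rule measurable_compose)
qed

text \<open>
  A continuous process is the pointwise limit of its discretizations along \<open>floor (n t) / n\<close>.
\<close>

lemma borel_measurable_continuous_process:
  fixes f :: "real \<Rightarrow> 'a \<Rightarrow> real"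
  assumes [measurable]: "\<And>t. f t \<in> borel_measurable M"
    and cont: "\<And>\<omega>. \<omega> \<in> space M \<Longrightarrow> continuous_on UNIV (\<lambda>t. f t \<omega>)"
  shows "(\<lambda>z :: 'a \<times> real. f (snd z) (fst z)) \<in> borel_measurable (M \<Otimes>\<^sub>M borel)"
proof (rule borel_measurable_LIMSEQ_real)
  fix n :: nat
  have "(\<lambda>z :: 'a \<times> real. f (real_of_int \<lfloor>real n * snd z\<rfloor> / real n) (fst z)) \<in> borel_measurable (M \<Otimes>\<^sub>M borel)"
    by (rule measurable_compose_countable[where f="\<lambda>i z. f (real_of_int i / real n) (fst z)"]) measurable
  then show "(\<lambda>z :: 'a \<times> real. f (real_of_int \<lfloor>real n * snd z\<rfloor> / real n) (fst z)) \<in> borel_measurable (M \<Otimes>\<^sub>M borel)" .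
next
  fix z :: "'a \<times> real" assume z: "z \<in> space (M \<Otimes>\<^sub>M borel)"
  let ?t = "snd z"
  have "(\<lambda>n. real_of_int \<lfloor>real n * ?t\<rfloor> / real n) \<longlonglongrightarrow> ?t"
  proof (rule tendsto_sandwich)
    have bounds: "?t - 1 / real n \<le> real_of_int \<lfloor>real n * ?t\<rfloor> / real n
        \<and> real_of_int \<lfloor>real n * ?t\<rfloor> / real n \<le> ?t" if "0 < n" for n
    proof -
      have "real n * ?t - 1 \<le> real_of_int \<lfloor>real n * ?t\<rfloor>" "real_of_int \<lfloor>real n * ?t\<rfloor> \<le> real n * ?t"
        by linarith+
      then have "(real n * ?t - 1) / real n \<le> real_of_int \<lfloor>real n * ?t\<rfloor> / real n"
        "real_of_int \<lfloor>real n * ?t\<rfloor> / real n \<le> (real n * ?t) / real n"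
        by (intro divide_right_mono; simp)+
      then show ?thesis using that by (simp add: diff_divide_distrib)
    qed
    show "\<forall>\<^sub>F n in sequentially. ?t - 1 / real n \<le> real_of_int \<lfloor>real n * ?t\<rfloor> / real n"
      using bounds by (intro eventually_sequentiallyI[of 1]) simp
    show "\<forall>\<^sub>F n in sequentially. real_of_int \<lfloor>real n * ?t\<rfloor> / real n \<le> ?t"
      using bounds by (intro eventually_sequentiallyI[of 1]) simp
    show "(\<lambda>n. ?t - 1 / real n) \<longlonglongrightarrow> ?t"
      using tendsto_diff[OF tendsto_const lim_const_over_n[of 1], of ?t] by simp
  qed simp
  moreover have "isCont (\<lambda>t. f t (fst z)) ?t"
    using cont[of "fst z"] z by (auto simp: continuous_on_eq_continuous_at space_pair_measure)
  ultimately show "(\<lambda>n. f (real_of_int \<lfloor>real n * ?t\<rfloor> / real n) (fst z)) \<longlonglongrightarrow> f ?t (fst z)"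
    using isCont_tendsto_compose by fast
qed

text \<open>
  The entire function \<open>(exp z - 1) / z\<close>. It replaces first-order Taylor expansion with remainder:
  the factor \<open>z\<close> is an exact increment, and the quotient is bounded on left half planes and tends
  to \<open>1\<close> at \<open>0\<close>.
\<close>

definition exp_quotient :: "complex \<Rightarrow> complex" where
  "exp_quotient z = (if z = 0 then 1 else (exp z - 1) / z)"

lemma exp_minus_one_eq: "exp z - 1 = z * exp_quotient z"
  by (simp add: exp_quotient_def)

lemma isCont_exp_quotient: "isCont exp_quotient z"
proof (cases "z = 0")
  case True
  have "((\<lambda>h. (exp (0 + h) - exp 0) / h) \<longlongrightarrow> exp (0 :: complex)) (at 0)"
    using DERIV_exp[of "0 :: complex"] by (simp only: DERIV_def)
  then have "((\<lambda>h. (exp h - 1) / h) \<longlongrightarrow> (1 :: complex)) (at 0)" by simp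
  moreover have "\<forall>\<^sub>F h in at 0. (exp h - 1) / h = exp_quotient h"
    by (simp add: eventually_at_filter exp_quotient_def)
  ultimately have "(exp_quotient \<longlongrightarrow> 1) (at 0)" by (rule Lim_transform_eventually)
  with True show ?thesis by (simp add: isCont_def exp_quotient_def)
next
  case False
  then have "\<forall>\<^sub>F w in nhds z. w \<in> - {0}"
    by (intro eventually_nhds_in_open) auto
  then have "\<forall>\<^sub>F w in nhds z. exp_quotient w = (exp w - 1) / w"
    by eventually_elim (simp add: exp_quotient_def)
  moreover have "isCont (\<lambda>w. (exp w - 1) / w) z"
    using False by (intro continuous_intros) auto
  ultimately show ?thesis by (simp add: isCont_cong)
qed

lemma borel_measurable_exp_quotient [measurable]: "exp_quotient \<in> borel_measurable borel"
  using isCont_exp_quotient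
  by (intro borel_measurable_continuous_onI) (simp add: continuous_on_eq_continuous_at)

lemma norm_exp_quotient_le:
  assumes "Re z \<le> c" "0 \<le> c"
  shows "cmod (exp_quotient z) \<le> exp c"
proof (cases "z = 0")
  case False
  have "cmod (exp z - exp 0) \<le> exp c * cmod (z - 0)"
  proof (rule field_differentiable_bound[where S="{w. Re w \<le> c}"])
    show "convex {w. Re w \<le> c}" by (rule convex_halfspace_Re_le)
    show "(exp has_field_derivative exp w) (at w within {w. Re w \<le> c})" for w :: complex
      by (rule DERIV_exp[THEN DERIV_subset]) simp
  qed (use assms in auto)
  with False show ?thesis by (simp add: exp_quotient_def norm_divide divide_le_eq)
qed (use assms in \<open>simp add: exp_quotient_def\<close>)

text \<open>
  The positivity of \<open>1 + r\<^sub>1\<close> and \<open>1 + r\<^sub>2\<close> means that both reflections push \<open>G\<^sub>1 + G\<^sub>2\<close> upwards.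
  In the final theorem it follows from the positivity of \<open>\<gamma>\<close>, see \<open>reflection_bounds\<close>.
\<close>

locale stationary_reflected_bm =
  fixes M :: "'a measure" and F :: "real \<Rightarrow> 'a measure" and r1 r2 \<mu>1 \<mu>2 :: real
    and G W L :: "real \<Rightarrow> 'a \<Rightarrow> real^2" and \<pi> :: "(real^2) measure" and T :: real
  assumes reflected: "degenerate_reflected_bm M F r1 r2 \<mu>1 \<mu>2 G W L"
    and invariant: "invariant_law M G \<pi>"
    and r1: "1 + r1 > 0" and r2: "1 + r2 > 0" and drift: "\<mu>1 + \<mu>2 = 1"
    and horizon: "T > 0"
begin

sublocale filtered_prob_space M F
  using reflected by (simp add: degenerate_reflected_bm_def)

lemma borel_measurable_past: "f \<in> borel_measurable (F t) \<Longrightarrow> f \<in> borel_measurable M"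
  by (rule measurable_from_subalg[OF subalgebra_filtration])

lemma adapted_processes: "adapted F G" "adapted F L" "adapted F W"
  using reflected by (simp_all only: degenerate_reflected_bm_def brownian_motion_def)

lemma adapted_G: "0 \<le> t \<Longrightarrow> G t \<in> borel_measurable (F t)"
  using adapted_processes(1) by (simp add: adapted_def)

lemma measurable_G: "0 \<le> t \<Longrightarrow> G t \<in> borel_measurable M"
  and measurable_L: "0 \<le> t \<Longrightarrow> L t \<in> borel_measurable M"
  and measurable_W: "0 \<le> t \<Longrightarrow> W t \<in> borel_measurable M"
  using adapted_processes by (auto simp: adapted_def intro: borel_measurable_past)

lemma integral_stationary:
  fixes g :: "real^2 \<Rightarrow> 'b :: {banach, second_countable_topology}"
  assumes [measurable]: "g \<in> borel_measurable borel" and "0 \<le> t"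
  shows "(LINT \<omega>|M. g (G t \<omega>)) = (LINT \<omega>|M. g (G 0 \<omega>))"
proof -
  have "(LINT \<omega>|M. g (G s \<omega>)) = (LINT v|\<pi>. g v)" if "0 \<le> s" for s
    using invariant that measurable_G[OF that]
    by (subst integral_distr[symmetric, where N=borel]) (auto simp: invariant_law_def)
  from this[of t] this[of 0] assms show ?thesis by simp
qed

lemma characteristic_increment:
  assumes "0 \<le> s" "s \<le> t"
  shows "(LINT \<omega>|M. iexp (a * (W t \<omega> $ 1 - W s \<omega> $ 1) + b * (W t \<omega> $ 2 - W s \<omega> $ 2))) =
    complex_of_real (exp (- (t - s) * (a - b)\<^sup>2 / 2))"
proof -
  let ?v = "vector [a, b] :: real^2"
  let ?S = "vector [vector [1, -1], vector [-1, 1]] :: real^2^2"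
  have "(LINT \<omega>|M. iexp (?v \<bullet> (W t \<omega> - W s \<omega>))) = complex_of_real (exp (- (t - s) * (?v \<bullet> (?S *v ?v)) / 2))"
    using reflected assms unfolding degenerate_reflected_bm_def brownian_motion_def by blast
  moreover have "?v \<bullet> (?S *v ?v) = (a - b)\<^sup>2"
    by (simp add: inner_vec_def matrix_vector_mult_def sum_2 power2_eq_square algebra_simps)
  moreover have "?v \<bullet> (W t \<omega> - W s \<omega>) = a * (W t \<omega> $ 1 - W s \<omega> $ 1) + b * (W t \<omega> $ 2 - W s \<omega> $ 2)" for \<omega>
    by (simp add: inner_vec_def sum_2)
  ultimately show ?thesis by simp
qed

text \<open>
  The covariance matrix annihilates \<open>(1, 1)\<close>, so the characteristic function of the sum \<open>U\<close> of the
  two increments is \<open>1\<close>. Hence \<open>cos (U / m) = 1\<close> almost surely for all positive integers \<open>m\<close> at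
  once, and a nonzero \<open>U\<close> is excluded by taking \<open>m\<close> larger than \<open>|U|\<close>.
\<close>

lemma AE_noise_cancels:
  assumes st: "0 \<le> s" "s \<le> t"
  shows "AE \<omega> in M. W t \<omega> $ 2 - W s \<omega> $ 2 = - (W t \<omega> $ 1 - W s \<omega> $ 1)"
proof -
  note [measurable] = measurable_W[OF st(1)] measurable_W[OF order_trans[OF st]]
  define U where "U \<omega> = (W t \<omega> $ 1 - W s \<omega> $ 1) + (W t \<omega> $ 2 - W s \<omega> $ 2)" for \<omega>
  have [measurable]: "U \<in> borel_measurable M" unfolding U_def by measurable
  have "AE \<omega> in M. \<forall>n::nat. cos (U \<omega> / real (Suc n)) = 1"
  proof (subst AE_all_countable, rule allI)
    fix n :: nat
    let ?c = "1 / real (Suc n)"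
    have int: "integrable M (\<lambda>\<omega>. iexp (?c * U \<omega>))"
      by (rule integrable_const_bound[where B=1]) auto
    have "(LINT \<omega>|M. iexp (?c * U \<omega>)) = 1"
      using characteristic_increment[OF st, of ?c ?c] by (simp add: U_def distrib_left del: of_nat_Suc)
    then have "(LINT \<omega>|M. Re (iexp (?c * U \<omega>))) = 1"
      using int by (subst integral_Re) simp_all
    then have "(LINT \<omega>|M. cos (?c * U \<omega>)) = 1" by (simp add: Re_exp)
    moreover have "integrable M (\<lambda>\<omega>. cos (?c * U \<omega>))"
      by (rule integrable_const_bound[where B=1]) auto
    ultimately have "(LINT \<omega>|M. 1 - cos (?c * U \<omega>)) = 0"
      by (simp add: prob_space)
    moreover have "integrable M (\<lambda>\<omega>. 1 - cos (?c * U \<omega>))"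
      using \<open>integrable M (\<lambda>\<omega>. cos (?c * U \<omega>))\<close> by simp
    ultimately have "AE \<omega> in M. 1 - cos (?c * U \<omega>) = 0"
      by (subst (asm) integral_nonneg_eq_0_iff_AE) simp_all
    then show "AE \<omega> in M. cos (U \<omega> / real (Suc n)) = 1"
      by eventually_elim simp
  qed
  then show ?thesis
  proof eventually_elim
    case (elim \<omega>)
    have "U \<omega> = 0"
    proof (rule ccontr)
      assume U: "U \<omega> \<noteq> 0"
      obtain n :: nat where n: "\<bar>U \<omega>\<bar> < real n" using reals_Archimedean2 by blast
      let ?u = "\<bar>U \<omega> / real (Suc n)\<bar>"
      have "?u < 1" using n by (simp add: abs_divide divide_less_eq)
      moreover have "0 < ?u" using U by (simp del: of_nat_Suc)
      ultimately have "cos ?u < cos 0"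
        using pi_gt3 by (intro cos_monotone_0_pi) linarith+
      moreover have "cos ?u = cos (U \<omega> / real (Suc n))" by (rule cos_abs_real)
      moreover have "cos (U \<omega> / real (Suc n)) = 1" using elim by blast
      ultimately show False by simp
    qed
    then show ?case by (simp add: U_def)
  qed
qed

lemma expectation_past_times_increment:
  assumes st: "0 \<le> s" "s \<le> t" and [measurable]: "g \<in> borel_measurable borel"
    and bound: "AE \<omega> in M. cmod (g (G s \<omega>)) \<le> B"
  shows "(LINT \<omega>|M. g (G s \<omega>) * iexp (\<theta> * (W t \<omega> $ 1 - W s \<omega> $ 1))) =
    (LINT \<omega>|M. g (G 0 \<omega>)) * complex_of_real (exp (- (t - s) * \<theta>\<^sup>2 / 2))"
proof -
  note [measurable] = measurable_W[OF st(1)] measurable_W[OF order_trans[OF st]] measurable_G[OF st(1)]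
  let ?D = "\<lambda>\<omega>. W t \<omega> - W s \<omega>" and ?e = "\<lambda>v :: real^2. iexp (\<theta> * v $ 1)"
  have e [measurable]: "?e \<in> borel_measurable borel" by measurable
  have "indep_set (sets (F s)) {?D -` B \<inter> space M | B. B \<in> sets borel}"
    using reflected st unfolding degenerate_reflected_bm_def brownian_motion_def by blast
  moreover have "sigma_sets (space M) {G s -` A \<inter> space M |A. A \<in> sets borel} \<subseteq> sets (F s)"
  proof -
    have "{G s -` A \<inter> space M |A. A \<in> sets borel} \<subseteq> sets (F s)"
      using measurable_sets[OF adapted_G[OF st(1)]] by (auto simp: space_F)
    from sets.sigma_sets_subset[OF this] show ?thesis by (simp add: space_F)
  qed
  moreover have "sigma_sets (space M) {?D -` B \<inter> space M | B. B \<in> sets borel} = {?D -` B \<inter> space M | B. B \<in> sets borel}"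
    using sets_vimage_algebra[of "space M" ?D borel] sets_vimage_algebra2[of ?D "space M" borel] by simp
  ultimately have "indep_set (sigma_sets (space M) {G s -` A \<inter> space M |A. A \<in> sets borel})
      (sigma_sets (space M) {?D -` B \<inter> space M | B. B \<in> sets borel})"
    unfolding indep_set_def by (elim indep_sets_mono_sets) (simp split: bool.split)
  then have "indep_var borel (G s) borel ?D"
    unfolding indep_var_eq by simp
  then have ind: "indep_var borel (g \<circ> G s) borel (?e \<circ> ?D)"
    by (rule indep_var_compose) simp_all
  have int_g: "integrable M (g \<circ> G s)"
  proof (rule integrable_const_bound)
    show "AE \<omega> in M. cmod ((g \<circ> G s) \<omega>) \<le> B" using bound by simp
    show "g \<circ> G s \<in> borel_measurable M" unfolding comp_def by measurable
  qed
  have int_e: "integrable M (?e \<circ> ?D)"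
  proof (rule integrable_const_bound)
    show "AE \<omega> in M. cmod ((?e \<circ> ?D) \<omega>) \<le> 1"
      unfolding comp_def norm_exp_i_times by simp
    have "?D \<in> borel_measurable M" by measurable
    then show "?e \<circ> ?D \<in> borel_measurable M" using e by (rule measurable_comp)
  qed
  note indep_var_lebesgue_integral[OF ind int_g int_e]
  moreover have "(LINT \<omega>|M. (?e \<circ> ?D) \<omega>) = complex_of_real (exp (- (t - s) * \<theta>\<^sup>2 / 2))"
    using characteristic_increment[OF st, of \<theta> 0] by (simp add: comp_def)
  ultimately show ?thesis
    using integral_stationary[of g, OF _ st(1)] by (simp add: comp_def)
qed

section \<open>Regular paths and integrability of the local times\<close>

definition regular :: "'a \<Rightarrow> bool" where
  "regular \<omega> \<longleftrightarrow>
     continuous_on {0..} (\<lambda>t. G t \<omega>) \<and> continuous_on {0..} (\<lambda>t. L t \<omega>) \<and> continuous_on {0..} (\<lambda>t. W t \<omega>) \<and>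
     (\<forall>t\<ge>0.
       G t \<omega> $ 1 = G 0 \<omega> $ 1 - \<mu>1 * t + W t \<omega> $ 1 + L t \<omega> $ 1 + r2 * L t \<omega> $ 2 \<and>
       G t \<omega> $ 2 = G 0 \<omega> $ 2 - \<mu>2 * t + W t \<omega> $ 2 + r1 * L t \<omega> $ 1 + L t \<omega> $ 2) \<and>
     (\<forall>i. (\<forall>t\<ge>0. G t \<omega> $ i \<ge> 0) \<and> L 0 \<omega> $ i = 0 \<and> mono_on {0..} (\<lambda>t. L t \<omega> $ i) \<and>
       (\<forall>s t. 0 \<le> s \<and> s \<le> t \<and> (\<forall>u\<in>{s..t}. G u \<omega> $ i \<noteq> 0) \<longrightarrow> L t \<omega> $ i = L s \<omega> $ i))"

lemma AE_regular: "AE \<omega> in M. regular \<omega>"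
proof -
  have "AE \<omega> in M. W 0 \<omega> = 0 \<and> continuous_on {0..} (\<lambda>t. W t \<omega>)"
    using reflected unfolding degenerate_reflected_bm_def brownian_motion_def by (elim conjE) assumption
  moreover have "AE \<omega> in M.
        continuous_on {0..} (\<lambda>t. G t \<omega>) \<and>
        continuous_on {0..} (\<lambda>t. L t \<omega>) \<and>
        (\<forall>t\<ge>0.
           G t \<omega> $ 1 = G 0 \<omega> $ 1 - \<mu>1 * t + W t \<omega> $ 1 + L t \<omega> $ 1 + r2 * L t \<omega> $ 2 \<and>
           G t \<omega> $ 2 = G 0 \<omega> $ 2 - \<mu>2 * t + W t \<omega> $ 2 + r1 * L t \<omega> $ 1 + L t \<omega> $ 2) \<and>
        (\<forall>i.
           (\<forall>t\<ge>0. G t \<omega> $ i \<ge> 0) \<and>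
           L 0 \<omega> $ i = 0 \<and>
           mono_on {0..} (\<lambda>t. L t \<omega> $ i) \<and>
           (\<forall>s t. 0 \<le> s \<and> s \<le> t \<and> (\<forall>u\<in>{s..t}. G u \<omega> $ i \<noteq> 0) \<longrightarrow> L t \<omega> $ i = L s \<omega> $ i))"
    using reflected unfolding degenerate_reflected_bm_def by (elim conjE) assumption
  ultimately show ?thesis
    by eventually_elim (unfold regular_def, elim conjE, intro conjI)
qed

lemma regularD:
  assumes "regular \<omega>"
  shows "continuous_on {0..} (\<lambda>t. G t \<omega>)" "continuous_on {0..} (\<lambda>t. L t \<omega>)" "continuous_on {0..} (\<lambda>t. W t \<omega>)"
    "\<And>t. 0 \<le> t \<Longrightarrow> G t \<omega> $ 1 = G 0 \<omega> $ 1 - \<mu>1 * t + W t \<omega> $ 1 + L t \<omega> $ 1 + r2 * L t \<omega> $ 2"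
    "\<And>t. 0 \<le> t \<Longrightarrow> G t \<omega> $ 2 = G 0 \<omega> $ 2 - \<mu>2 * t + W t \<omega> $ 2 + r1 * L t \<omega> $ 1 + L t \<omega> $ 2"
    "\<And>i t. 0 \<le> t \<Longrightarrow> 0 \<le> G t \<omega> $ i"
    "\<And>i. L 0 \<omega> $ i = 0"
    "\<And>i. mono_on {0..} (\<lambda>t. L t \<omega> $ i)"
    "\<And>i s t. 0 \<le> s \<Longrightarrow> s \<le> t \<Longrightarrow> (\<And>u. s \<le> u \<Longrightarrow> u \<le> t \<Longrightarrow> G u \<omega> $ i \<noteq> 0) \<Longrightarrow> L t \<omega> $ i = L s \<omega> $ i"
proof -
  note cont = assms[unfolded regular_def, THEN conjunct1]
    assms[unfolded regular_def, THEN conjunct2, THEN conjunct1]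
    assms[unfolded regular_def, THEN conjunct2, THEN conjunct2, THEN conjunct1]
  note rest = assms[unfolded regular_def, THEN conjunct2, THEN conjunct2, THEN conjunct2]
  note balance = rest[THEN conjunct1, rule_format]
  note boundary = rest[THEN conjunct2, THEN spec]
  show "continuous_on {0..} (\<lambda>t. G t \<omega>)" "continuous_on {0..} (\<lambda>t. L t \<omega>)" "continuous_on {0..} (\<lambda>t. W t \<omega>)"
    by (rule cont)+
  show "G t \<omega> $ 1 = G 0 \<omega> $ 1 - \<mu>1 * t + W t \<omega> $ 1 + L t \<omega> $ 1 + r2 * L t \<omega> $ 2"
    and "G t \<omega> $ 2 = G 0 \<omega> $ 2 - \<mu>2 * t + W t \<omega> $ 2 + r1 * L t \<omega> $ 1 + L t \<omega> $ 2" if "0 \<le> t" for t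
    using balance[OF that] by (rule conjunct1 conjunct2)+
  fix i
  show "0 \<le> t \<Longrightarrow> 0 \<le> G t \<omega> $ i" for t
    by (rule boundary[THEN conjunct1, rule_format])
  show "L 0 \<omega> $ i = 0"
    by (rule boundary[THEN conjunct2, THEN conjunct1])
  show "mono_on {0..} (\<lambda>t. L t \<omega> $ i)"
    by (rule boundary[THEN conjunct2, THEN conjunct2, THEN conjunct1])
  show "L t \<omega> $ i = L s \<omega> $ i"
    if "0 \<le> s" "s \<le> t" "\<And>u. s \<le> u \<Longrightarrow> u \<le> t \<Longrightarrow> G u \<omega> $ i \<noteq> 0" for s t
    by (rule boundary[THEN conjunct2, THEN conjunct2, THEN conjunct2, rule_format]) (use that in auto)
qed

text \<open>
  The regular paths need not form a measurable set; a null set is fixed outside of which all paths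
  are regular.
\<close>

definition exceptional :: "'a set" where
  "exceptional = (SOME N. N \<in> null_sets M \<and> {\<omega> \<in> space M. \<not> regular \<omega>} \<subseteq> N)"

definition good :: "'a \<Rightarrow> bool" where
  "good \<omega> \<longleftrightarrow> \<omega> \<in> space M - exceptional"

lemma exceptional: "exceptional \<in> null_sets M" "{\<omega> \<in> space M. \<not> regular \<omega>} \<subseteq> exceptional"
proof -
  from AE_regular have "\<exists>N. N \<in> null_sets M \<and> {\<omega> \<in> space M. \<not> regular \<omega>} \<subseteq> N"
    unfolding eventually_ae_filter by blast
  from someI_ex[OF this] show "exceptional \<in> null_sets M" "{\<omega> \<in> space M. \<not> regular \<omega>} \<subseteq> exceptional"
    unfolding exceptional_def by blast+
qed

lemma good_regular: "good \<omega> \<Longrightarrow> regular \<omega>"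
  using exceptional(2) by (auto simp: good_def)

lemma AE_good: "AE \<omega> in M. good \<omega>"
  using AE_not_in[OF exceptional(1)] AE_space by eventually_elim (simp add: good_def)

lemma measurable_good [measurable]: "Measurable.pred M good"
proof -
  have "{\<omega> \<in> space M. good \<omega>} = space M - exceptional" by (auto simp: good_def)
  then show ?thesis
    unfolding pred_def using null_setsD2[OF exceptional(1)] sets.Diff[OF sets.top] by (simp only:)
qed

definition clip :: "real \<Rightarrow> real" where
  "clip t = max 0 (min T t)"

text \<open>
  Versions of \<open>G\<close>, of the first noise and of \<open>L\<close> that are frozen outside \<open>[0, T]\<close> and vanish on
  the exceptional set, so that their path properties hold for every \<open>\<omega>\<close>. They need not be adapted;
  independence is always used for the original processes.
\<close>

definition Gc :: "2 \<Rightarrow> real \<Rightarrow> 'a \<Rightarrow> real" where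
  "Gc i t \<omega> = (if good \<omega> then G (clip t) \<omega> $ i else 0)"

definition Wc :: "real \<Rightarrow> 'a \<Rightarrow> real" where
  "Wc t \<omega> = (if good \<omega> then W (clip t) \<omega> $ 1 else 0)"

definition Lc :: "2 \<Rightarrow> real \<Rightarrow> 'a \<Rightarrow> real" where
  "Lc i t \<omega> = (if good \<omega> then L (clip t) \<omega> $ i else 0)"

lemma clip_nonneg [simp]: "0 \<le> clip t"
  and clip_mono: "s \<le> t \<Longrightarrow> clip s \<le> clip t"
  and clip_id: "0 \<le> t \<Longrightarrow> t \<le> T \<Longrightarrow> clip t = t"
  and continuous_clip: "continuous_on S clip"
  by (auto simp: clip_def[abs_def] intro!: continuous_intros)

lemma measurable_clipped [measurable]:
  "Gc i t \<in> borel_measurable M" "Wc t \<in> borel_measurable M" "Lc i t \<in> borel_measurable M"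
proof -
  note [measurable] = measurable_G[of "clip t", OF clip_nonneg]
    measurable_W[of "clip t", OF clip_nonneg] measurable_L[of "clip t", OF clip_nonneg]
  show "Gc i t \<in> borel_measurable M" "Wc t \<in> borel_measurable M" "Lc i t \<in> borel_measurable M"
    unfolding Gc_def[abs_def] Wc_def[abs_def] Lc_def[abs_def] by measurable
qed

lemma continuous_Gc: "continuous_on UNIV (\<lambda>t. Gc i t \<omega>)"
  and continuous_Wc: "continuous_on UNIV (\<lambda>t. Wc t \<omega>)"
  and continuous_Lc: "continuous_on UNIV (\<lambda>t. Lc i t \<omega>)"
proof -
  have *: "continuous_on UNIV (\<lambda>t. X (clip t) $ j)" if "continuous_on {0..} X" for X :: "real \<Rightarrow> real^2" and j
  proof -
    have "continuous_on UNIV (\<lambda>t. X (clip t))"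
      by (rule continuous_on_compose2[OF that continuous_clip]) auto
    then show ?thesis by (intro continuous_intros)
  qed
  show "continuous_on UNIV (\<lambda>t. Gc i t \<omega>)" "continuous_on UNIV (\<lambda>t. Wc t \<omega>)" "continuous_on UNIV (\<lambda>t. Lc i t \<omega>)"
    using *[OF regularD(1)] *[OF regularD(2)] *[OF regularD(3)] good_regular[of \<omega>]
    unfolding Gc_def Wc_def Lc_def by (cases "good \<omega>"; simp)+
qed

lemma Gc_nonneg: "0 \<le> Gc i t \<omega>"
  using regularD(6)[OF good_regular] by (simp add: Gc_def)

lemma Lc_mono: "s \<le> t \<Longrightarrow> Lc i s \<omega> \<le> Lc i t \<omega>"
  using mono_onD[OF regularD(8)[OF good_regular], of \<omega> "clip s" "clip t" i] clip_mono[of s t]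
  by (simp add: Lc_def)

lemma Lc_before: "t \<le> 0 \<Longrightarrow> Lc i t \<omega> = 0"
  using regularD(7)[OF good_regular] horizon by (simp add: Lc_def clip_def)

lemma Lc_after: "T \<le> t \<Longrightarrow> Lc i t \<omega> = Lc i T \<omega>"
  by (simp add: Lc_def clip_def)

lemma Lc_nonneg: "0 \<le> Lc i t \<omega>"
  using Lc_mono[of 0 t i \<omega>] Lc_before[of 0 i \<omega>] Lc_before[of t i \<omega>] by (cases "0 \<le> t") auto

lemma measurable_joint [measurable]:
  "(\<lambda>z. Gc i (snd z) (fst z)) \<in> borel_measurable (M \<Otimes>\<^sub>M borel)"
  by (rule borel_measurable_continuous_process) (use continuous_Gc in auto)

text \<open>
  The increase of \<open>G\<^sub>1 + G\<^sub>2\<close> over \<open>[0, T]\<close> that is due to reflection.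
\<close>

definition total_push :: "'a \<Rightarrow> real" where
  "total_push \<omega> = (1 + r1) * Lc 1 T \<omega> + (1 + r2) * Lc 2 T \<omega>"

text \<open>
  The noises cancel in \<open>X = G\<^sub>1 + G\<^sub>2\<close>, so the total push equals \<open>X T - X 0 + T\<close>. If \<open>X\<close> were
  integrable, stationarity would give expectation \<open>T\<close>. In general \<open>X\<close> is truncated at level \<open>m\<close>:
  the truncated expression is still nonnegative and has expectation exactly \<open>T\<close>, and Fatou's lemma
  lets \<open>m\<close> tend to infinity.
\<close>

lemma integrable_total_push: "integrable M total_push"
proof -
  define X where "X t \<omega> = G t \<omega> $ 1 + G t \<omega> $ 2" for t \<omega>
  define Y where "Y m \<omega> = min (X T \<omega>) (real m) - min (X 0 \<omega>) (real m) + T" for m \<omega>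
  have T: "0 \<le> T" using horizon by simp
  note [measurable] = measurable_G[OF T] measurable_G[of 0, OF order_refl]
  have [measurable]: "Y m \<in> borel_measurable M" for m unfolding Y_def[abs_def] X_def by measurable
  have [measurable]: "total_push \<in> borel_measurable M" unfolding total_push_def[abs_def] by measurable
  have bal: "AE \<omega> in M. total_push \<omega> = X T \<omega> - X 0 \<omega> + T \<and> 0 \<le> X T \<omega> \<and> 0 \<le> X 0 \<omega> \<and> 0 \<le> total_push \<omega>"
    using AE_good AE_noise_cancels[OF order_refl T]
  proof eventually_elim
    case (elim \<omega>)
    then have reg: "regular \<omega>" by (simp add: good_regular)
    note G = regularD(4,5)[OF reg T] regularD(4,5)[OF reg order_refl]
    note L0 = regularD(7)[OF reg]
    have "\<mu>1 * T + \<mu>2 * T = T" using drift by (metis distrib_right mult_1)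
    moreover have "Lc i T \<omega> = L T \<omega> $ i" for i using elim T by (simp add: Lc_def clip_id)
    ultimately have "total_push \<omega> = X T \<omega> - X 0 \<omega> + T"
      using G L0 elim unfolding total_push_def X_def by (simp add: algebra_simps)
    moreover have "0 \<le> X T \<omega>" "0 \<le> X 0 \<omega>"
      using regularD(6)[OF reg] T unfolding X_def by (simp_all add: add_nonneg_nonneg)
    moreover have "0 \<le> total_push \<omega>" unfolding total_push_def using r1 r2 Lc_nonneg by simp
    ultimately show ?case by simp
  qed
  have EY: "(\<integral>\<^sup>+\<omega>. ennreal (Y m \<omega>) \<partial>M) = ennreal T" for m
  proof -
    have int: "integrable M (\<lambda>\<omega>. min (X t \<omega>) (real m))" if "t \<in> {0, T}" for t
    proof (rule integrable_const_bound)
      show "AE \<omega> in M. norm (min (X t \<omega>) (real m)) \<le> real m"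
        using bal by eventually_elim (use that in auto)
      show "(\<lambda>\<omega>. min (X t \<omega>) (real m)) \<in> borel_measurable M"
        using that by (auto simp: X_def)
    qed
    have nonneg: "AE \<omega> in M. 0 \<le> Y m \<omega>"
      using bal by eventually_elim (use T in \<open>auto simp: Y_def min_def\<close>)
    have "(LINT \<omega>|M. min (X T \<omega>) (real m)) = (LINT \<omega>|M. min (X 0 \<omega>) (real m))"
      unfolding X_def using integral_stationary[of "\<lambda>v. min (v $ 1 + v $ 2) (real m)" T] T by simp
    then have "(LINT \<omega>|M. Y m \<omega>) = T"
      unfolding Y_def using int by (simp add: prob_space)
    moreover have "integrable M (Y m)" unfolding Y_def[abs_def] using int by simp
    ultimately show ?thesis using nonneg by (simp add: nn_integral_eq_integral)
  qed
  have "(\<integral>\<^sup>+\<omega>. ennreal (total_push \<omega>) \<partial>M) = (\<integral>\<^sup>+\<omega>. liminf (\<lambda>m. ennreal (Y m \<omega>)) \<partial>M)"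
  proof (rule nn_integral_cong_AE, use bal in eventually_elim)
    case (elim \<omega>)
    obtain N :: nat where N: "max (X T \<omega>) (X 0 \<omega>) < real N" using reals_Archimedean2 by blast
    have "(\<lambda>m. ennreal (Y m \<omega>)) \<longlonglongrightarrow> ennreal (total_push \<omega>)"
    proof (intro tendsto_eventually eventually_sequentiallyI[of N])
      fix m assume "N \<le> m"
      then have "max (X T \<omega>) (X 0 \<omega>) < real m" using N by linarith
      then show "ennreal (Y m \<omega>) = ennreal (total_push \<omega>)" using elim by (simp add: Y_def min_def)
    qed
    then show ?case by (simp add: lim_imp_Liminf)
  qed
  also have "\<dots> \<le> liminf (\<lambda>m. \<integral>\<^sup>+\<omega>. ennreal (Y m \<omega>) \<partial>M)"
    by (rule nn_integral_liminf) simp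
  also have "\<dots> < \<infinity>" unfolding EY by (simp add: Liminf_const)
  finally show ?thesis
    using bal by (intro integrableI_nonneg) (auto elim: eventually_mono)
qed

lemma integrable_Lc: "integrable M (Lc i T)"
proof -
  have "1 + (if i = 1 then r1 else r2) > 0" (is "?c > 0") using r1 r2 by simp
  have "?c * Lc i T \<omega> \<le> total_push \<omega>" for \<omega>
    using r1 r2 Lc_nonneg[of 1 T \<omega>] Lc_nonneg[of 2 T \<omega>] exhaust_2[of i]
    by (auto simp: total_push_def)
  then have *: "Lc i T \<omega> \<le> total_push \<omega> / ?c" for \<omega>
    using \<open>?c > 0\<close> by (simp add: pos_le_divide_eq mult.commute)
  show ?thesis
    by (rule Bochner_Integration.integrable_bound[where f="\<lambda>\<omega>. total_push \<omega> / ?c"])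
       (use integrable_total_push * Lc_nonneg order_trans[OF * abs_ge_self] in auto)
qed

end

sublocale stationary_reflected_bm \<subseteq> LT: increasing_process M T "Lc i" for i
  by unfold_locales
     (rule horizon measurable_clipped continuous_Lc Lc_mono Lc_before Lc_after integrable_Lc; assumption?)+

sublocale stationary_reflected_bm \<subseteq> CT: increasing_process M T "\<lambda>t \<omega>. clip t"
proof unfold_locales
  show "clip t = clip T" if "T \<le> t" for t using that by (simp add: clip_def)
qed (use horizon continuous_clip clip_mono in \<open>auto simp: clip_def\<close>)

section \<open>The basic adjoint relation\<close>

context stationary_reflected_bm
begin

lemma AE_clipped:
  "AE \<omega> in M. (\<forall>t i. 0 \<le> t \<longrightarrow> t \<le> T \<longrightarrow> G t \<omega> $ i = Gc i t \<omega> \<and> L t \<omega> $ i = Lc i t \<omega> \<and> W t \<omega> $ 1 = Wc t \<omega>)"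
  using AE_good by eventually_elim (simp add: Gc_def Lc_def Wc_def clip_id)

definition exp_state :: "complex \<Rightarrow> complex \<Rightarrow> real^2 \<Rightarrow> complex" where
  "exp_state x y v = exp (x * of_real (v $ 1) + y * of_real (v $ 2))"

definition exp_path :: "complex \<Rightarrow> complex \<Rightarrow> 'a \<times> real \<Rightarrow> complex" where
  "exp_path x y z = exp (x * of_real (Gc 1 (snd z) (fst z)) + y * of_real (Gc 2 (snd z) (fst z)))"

lemma measurable_exp_state [measurable]: "exp_state x y \<in> borel_measurable borel"
  unfolding exp_state_def[abs_def] by measurable

lemma measurable_exp_path [measurable]: "exp_path x y \<in> borel_measurable (M \<Otimes>\<^sub>M borel)"
  unfolding exp_path_def[abs_def] by measurable

lemma norm_exp_path_le: 
  assumes "Re x \<le> 0" "Re y \<le> 0"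
  shows "cmod (exp_path x y z) \<le> 1"
  using assms Gc_nonneg[of 1 "snd z" "fst z"] Gc_nonneg[of 2 "snd z" "fst z"]
  by (auto simp: exp_path_def intro!: add_nonpos_nonpos mult_nonpos_nonneg)

lemma AE_norm_exp_state_le:
  assumes "Re x \<le> 0" "Re y \<le> 0" "0 \<le> t"
  shows "AE \<omega> in M. cmod (exp_state x y (G t \<omega>)) \<le> 1"
  using AE_good
proof eventually_elim
  case (elim \<omega>)
  then show ?case
    using assms regularD(6)[OF good_regular, of \<omega> t 1] regularD(6)[OF good_regular, of \<omega> t 2]
    by (auto simp: exp_state_def intro!: add_nonpos_nonpos mult_nonpos_nonneg)
qed

text \<open>
  The part of the increment of \<open>x G\<^sub>1 + y G\<^sub>2\<close> that has bounded variation; what remains is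
  \<open>(x - y)\<close> times the increment of the first noise.
\<close>

definition drift_increment :: "complex \<Rightarrow> complex \<Rightarrow> real \<Rightarrow> real \<Rightarrow> 'a \<Rightarrow> complex" where
  "drift_increment x y s t \<omega> =
     - (complex_of_real \<mu>1 * x + complex_of_real \<mu>2 * y) * of_real (clip t - clip s)
     + (x + complex_of_real r1 * y) * of_real (Lc 1 t \<omega> - Lc 1 s \<omega>)
     + (complex_of_real r2 * x + y) * of_real (Lc 2 t \<omega> - Lc 2 s \<omega>)"

lemma measurable_drift_increment [measurable]: "drift_increment x y s t \<in> borel_measurable M"
  unfolding drift_increment_def[abs_def] by measurable

text \<open>
  Chosen so that \<open>drift_increment * step_factor\<close> is the exact change of \<open>exp (x G\<^sub>1 + y G\<^sub>2)\<close>
  caused by the drift increment, after the noise has acted.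
\<close>

definition step_factor :: "complex \<Rightarrow> complex \<Rightarrow> real \<Rightarrow> real \<Rightarrow> 'a \<Rightarrow> complex" where
  "step_factor x y s t \<omega> =
     exp_path x y (\<omega>, s) * iexp (Im (x - y) * (Wc t \<omega> - Wc s \<omega>)) * exp_quotient (drift_increment x y s t \<omega>)"

lemma measurable_step_factor [measurable]: "step_factor x y s t \<in> borel_measurable M"
proof -
  have "(\<lambda>\<omega>. exp_path x y (\<omega>, s)) \<in> borel_measurable M" by measurable
  then show ?thesis unfolding step_factor_def[abs_def] by measurable
qed

lemma norm_step_factor_le:
  assumes x: "Re x = - p" and y: "Re y = - p" and p: "0 \<le> p" and st: "s \<le> t"
  shows "cmod (step_factor x y s t \<omega>) \<le> exp (p * T)"
proof -
  have "clip t - clip s \<le> T" using horizon by (simp add: clip_def)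
  then have "Re (drift_increment x y s t \<omega>) \<le> p * T"
  proof -
    have "Re (drift_increment x y s t \<omega>) =
        p * (\<mu>1 + \<mu>2) * (clip t - clip s) - p * ((1 + r1) * (Lc 1 t \<omega> - Lc 1 s \<omega>)) - p * ((1 + r2) * (Lc 2 t \<omega> - Lc 2 s \<omega>))"
      by (simp add: drift_increment_def x y algebra_simps)
    also have "\<dots> \<le> p * (\<mu>1 + \<mu>2) * (clip t - clip s)"
      using p r1 r2 Lc_mono[OF st, of 1 \<omega>] Lc_mono[OF st, of 2 \<omega>]
      by (smt (verit) mult_nonneg_nonneg)
    also have "\<dots> \<le> p * T"
      using \<open>clip t - clip s \<le> T\<close> p drift by (simp add: mult_left_mono)
    finally show ?thesis .
  qed
  then have 1: "cmod (exp_quotient (drift_increment x y s t \<omega>)) \<le> exp (p * T)"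
    using p horizon by (intro norm_exp_quotient_le) auto
  have 2: "cmod (exp_path x y (\<omega>, s)) \<le> 1" using x y p by (intro norm_exp_path_le) auto
  show ?thesis
    unfolding step_factor_def norm_mult norm_exp_i_times
    using mult_mono[OF 2 1] by simp
qed

text \<open>
  Over one step the exponential is first rotated by the noise and then multiplied by the
  exponential of the drift increment. Stationarity makes the expectation equal at both ends, and
  independence evaluates the rotated term, so the drift contribution compensates the loss from the
  rotation.
\<close>

lemma expectation_step:
  assumes x: "Re x = - p" and y: "Re y = - p" and p: "0 \<le> p" and s: "0 \<le> s" and st: "s \<le> t" and t: "t \<le> T"
  shows "(LINT \<omega>|M. drift_increment x y s t \<omega> * step_factor x y s t \<omega>) =
    (LINT \<omega>|M. exp_state x y (G 0 \<omega>)) * (1 - complex_of_real (exp (- (t - s) * (Im (x - y))\<^sup>2 / 2)))"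
proof -
  define \<theta> where "\<theta> = Im (x - y)"
  have t0: "0 \<le> t" using s st by simp
  note [measurable] = measurable_G[OF s] measurable_G[OF t0] measurable_W[OF s] measurable_W[OF t0]
  let ?E = "\<lambda>\<omega>. exp_state x y (G s \<omega>) * iexp (\<theta> * (W t \<omega> $ 1 - W s \<omega> $ 1))"
  have xy: "Re x \<le> 0" "Re y \<le> 0" using x y p by auto
  have "x = y + \<i> * complex_of_real \<theta>" by (simp add: complex_eq_iff x y \<theta>_def)
  have "AE \<omega> in M. drift_increment x y s t \<omega> * step_factor x y s t \<omega> = exp_state x y (G t \<omega>) - ?E \<omega>"
    using AE_good AE_clipped AE_noise_cancels[OF s st]
  proof eventually_elim
    case (elim \<omega>)
    have reg: "regular \<omega>" using elim by (simp add: good_regular)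
    have clp: "clip s = s" "clip t = t" using s st t by (auto intro: clip_id)
    have eqs: "Gc i s \<omega> = G s \<omega> $ i" "Gc i t \<omega> = G t \<omega> $ i" "Lc i s \<omega> = L s \<omega> $ i" "Lc i t \<omega> = L t \<omega> $ i"
      "Wc s \<omega> = W s \<omega> $ 1" "Wc t \<omega> = W t \<omega> $ 1" for i
      using elim(2) s st t t0 by auto
    define dW where "dW = W t \<omega> $ 1 - W s \<omega> $ 1"
    define l1 where "l1 = L t \<omega> $ 1 - L s \<omega> $ 1"
    define l2 where "l2 = L t \<omega> $ 2 - L s \<omega> $ 2"
    have G1: "G t \<omega> $ 1 = G s \<omega> $ 1 - \<mu>1 * (t - s) + dW + l1 + r2 * l2"
      using regularD(4)[OF reg t0] regularD(4)[OF reg s]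
      by (simp add: dW_def l1_def l2_def algebra_simps)
    have G2: "G t \<omega> $ 2 = G s \<omega> $ 2 - \<mu>2 * (t - s) - dW + r1 * l1 + l2"
      using regularD(5)[OF reg t0] regularD(5)[OF reg s] elim(3)
      by (simp add: dW_def l1_def l2_def algebra_simps)
    have D: "drift_increment x y s t \<omega> =
        - (complex_of_real \<mu>1 * x + complex_of_real \<mu>2 * y) * of_real (t - s) + (x + complex_of_real r1 * y) * of_real l1 + (complex_of_real r2 * x + y) * of_real l2"
      unfolding drift_increment_def eqs clp l1_def l2_def ..
    have "x * of_real (G t \<omega> $ 1) + y * of_real (G t \<omega> $ 2) =
        (x * of_real (G s \<omega> $ 1) + y * of_real (G s \<omega> $ 2)) + (x - y) * of_real dW + drift_increment x y s t \<omega>"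
      unfolding G1 G2 D by (simp add: algebra_simps)
    moreover have "(x - y) * of_real dW = \<i> * complex_of_real (\<theta> * dW)"
      by (simp add: \<open>x = y + \<i> * complex_of_real \<theta>\<close>)
    ultimately have 1: "exp_state x y (G t \<omega>) = ?E \<omega> * exp (drift_increment x y s t \<omega>)"
      unfolding exp_state_def dW_def[symmetric] by (simp only: exp_add)
    have 2: "step_factor x y s t \<omega> = ?E \<omega> * exp_quotient (drift_increment x y s t \<omega>)"
      unfolding step_factor_def exp_path_def exp_state_def fst_conv snd_conv eqs \<theta>_def ..
    have "drift_increment x y s t \<omega> * step_factor x y s t \<omega> =
        ?E \<omega> * (drift_increment x y s t \<omega> * exp_quotient (drift_increment x y s t \<omega>))"
      unfolding 2 by (simp only: mult_ac)
    also have "\<dots> = exp_state x y (G t \<omega>) - ?E \<omega>"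
      unfolding exp_minus_one_eq[symmetric] 1 by (simp only: right_diff_distrib mult_1_right)
    finally show ?case .
  qed
  then have "(LINT \<omega>|M. drift_increment x y s t \<omega> * step_factor x y s t \<omega>) = (LINT \<omega>|M. exp_state x y (G t \<omega>) - ?E \<omega>)"
    by (intro integral_cong_AE) simp_all
  also have "\<dots> = (LINT \<omega>|M. exp_state x y (G t \<omega>)) - (LINT \<omega>|M. ?E \<omega>)"
  proof (rule Bochner_Integration.integral_diff)
    show "integrable M (\<lambda>\<omega>. exp_state x y (G t \<omega>))"
      by (rule integrable_const_bound[OF AE_norm_exp_state_le[OF xy t0]]) simp
    show "integrable M ?E"
    proof (rule integrable_const_bound)
      show "AE \<omega> in M. cmod (?E \<omega>) \<le> 1"
        using AE_norm_exp_state_le[OF xy s] unfolding norm_mult norm_exp_i_times by simp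
    qed simp
  qed
  also have "(LINT \<omega>|M. exp_state x y (G t \<omega>)) = (LINT \<omega>|M. exp_state x y (G 0 \<omega>))"
    by (rule integral_stationary[OF measurable_exp_state t0])
  also have "(LINT \<omega>|M. ?E \<omega>) = (LINT \<omega>|M. exp_state x y (G 0 \<omega>)) * complex_of_real (exp (- (t - s) * \<theta>\<^sup>2 / 2))"
    by (rule expectation_past_times_increment[OF s st measurable_exp_state AE_norm_exp_state_le[OF xy s]])
  finally show ?thesis by (simp add: \<theta>_def right_diff_distrib)
qed

lemma tendsto_exp_path:
  assumes "(f \<longlongrightarrow> t) sequentially"
  shows "(\<lambda>n. exp_path x y (\<omega>, f n)) \<longlonglongrightarrow> exp_path x y (\<omega>, t)"
proof -
  have "(\<lambda>n. Gc i (f n) \<omega>) \<longlonglongrightarrow> Gc i t \<omega>" for i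
    using continuous_Gc[of i \<omega>] assms
    by (auto simp: continuous_on_eq_continuous_at intro: isCont_tendsto_compose)
  then show ?thesis unfolding exp_path_def by (auto intro!: tendsto_intros)
qed

lemma tendsto_step_factor:
  assumes f: "f \<longlonglongrightarrow> t" and g: "g \<longlonglongrightarrow> t"
  shows "(\<lambda>n. step_factor x y (f n) (g n) \<omega>) \<longlonglongrightarrow> exp_path x y (\<omega>, t)"
proof -
  have tend: "(\<lambda>n. X (h n)) \<longlonglongrightarrow> X t" if "continuous_on UNIV X" "h \<longlonglongrightarrow> t" for X h :: "_ \<Rightarrow> real"
    using that by (auto simp: continuous_on_eq_continuous_at intro: isCont_tendsto_compose)
  note W = tend[OF continuous_Wc[of \<omega>] f] tend[OF continuous_Wc[of \<omega>] g]
  note L = tend[OF continuous_Lc[of _ \<omega>] f] tend[OF continuous_Lc[of _ \<omega>] g]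
  note C = tend[OF continuous_clip f] tend[OF continuous_clip g]
  have "(\<lambda>n. drift_increment x y (f n) (g n) \<omega>) \<longlonglongrightarrow>
     - (complex_of_real \<mu>1 * x + complex_of_real \<mu>2 * y) * of_real (clip t - clip t)
     + (x + complex_of_real r1 * y) * of_real (Lc 1 t \<omega> - Lc 1 t \<omega>)
     + (complex_of_real r2 * x + y) * of_real (Lc 2 t \<omega> - Lc 2 t \<omega>)"
    unfolding drift_increment_def by (intro tendsto_intros L C)
  then have "(\<lambda>n. drift_increment x y (f n) (g n) \<omega>) \<longlonglongrightarrow> 0" by simp
  then have "(\<lambda>n. exp_quotient (drift_increment x y (f n) (g n) \<omega>)) \<longlonglongrightarrow> exp_quotient 0"
    by (rule isCont_tendsto_compose[OF isCont_exp_quotient])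
  moreover have "(\<lambda>n. iexp (Im (x - y) * (Wc (g n) \<omega> - Wc (f n) \<omega>))) \<longlonglongrightarrow> iexp (Im (x - y) * (Wc t \<omega> - Wc t \<omega>))"
    by (intro tendsto_intros W)
  ultimately have "(\<lambda>n. step_factor x y (f n) (g n) \<omega>) \<longlonglongrightarrow>
      exp_path x y (\<omega>, t) * iexp (Im (x - y) * (Wc t \<omega> - Wc t \<omega>)) * exp_quotient 0"
    unfolding step_factor_def by (intro tendsto_mult tendsto_exp_path f)
  then show ?thesis by (simp add: exp_quotient_def)
qed

text \<open>
  Summing \<open>expectation_step\<close> over the partition of \<open>[0, T]\<close> into \<open>n\<close> equal steps. The drift
  contributions are Riemann--Stieltjes sums against time and the two local times and converge to
  Doleans integrals. The compensation is \<open>n\<close> times \<open>1 - exp (- (T/n) \<theta>\<^sup>2 / 2)\<close>, which tends to \<open>T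
  \<theta>\<^sup>2 / 2\<close> with \<open>x - y = i \<theta>\<close>; this is the second-order term \<open>(x - y)\<^sup>2 / 2\<close> of the generator. The
  condition \<open>Re x = Re y\<close> is what makes \<open>x - y\<close> imaginary.
\<close>

lemma basic_adjoint_relation:
  assumes x: "Re x = - p" and y: "Re y = - p" and p: "0 \<le> p"
  shows "complex_of_real T * ((x - y)\<^sup>2 / 2 - complex_of_real \<mu>1 * x - complex_of_real \<mu>2 * y) * (LINT \<omega>|M. exp_state x y (G 0 \<omega>))
    + (x + complex_of_real r1 * y) * (LINT z|LT.doleans 1. exp_path x y z) + (complex_of_real r2 * x + y) * (LINT z|LT.doleans 2. exp_path x y z) = 0"
proof -
  define \<Phi> where "\<Phi> = (LINT \<omega>|M. exp_state x y (G 0 \<omega>))"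
  define \<theta> where "\<theta> = Im (x - y)"
  define u where "u n i = T * real i / real n" for n i :: nat
  define v where "v n i = T * (real i + 1) / real n" for n i :: nat
  have uv: "0 \<le> u n i" "u n i \<le> v n i" for n i
    using horizon by (auto simp: u_def v_def divide_right_mono)
  have vT: "v n i \<le> T" if "i < n" for n i
  proof -
    have "T * (real i + 1) \<le> T * real n" using horizon that by (intro mult_left_mono) auto
    then show ?thesis using that by (simp add: v_def divide_le_eq)
  qed
  have vu: "v n i - u n i = T / real n" for n i
    by (simp add: u_def v_def add_divide_distrib distrib_left)
  have xy: "Re x \<le> 0" "Re y \<le> 0" using x y p by auto
  define H where "H n i = step_factor x y (u n i) (v n i)" for n i
  have Hm [measurable]: "H n i \<in> borel_measurable M" for n i unfolding H_def by measurable
  have Hb: "cmod (H n i \<omega>) \<le> exp (p * T)" for n i \<omega>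
    unfolding H_def by (rule norm_step_factor_le[OF x y p uv(2)])
  have Hl: "(\<lambda>n. H n (i n) \<omega>) \<longlonglongrightarrow> exp_path x y (\<omega>, t)"
    if "(\<lambda>n. u n (i n)) \<longlonglongrightarrow> t" "(\<lambda>n. v n (i n)) \<longlonglongrightarrow> t" for i \<omega> t
    unfolding H_def using that by (rule tendsto_step_factor)
  have lim_L: "(\<lambda>n. LINT \<omega>|M. (\<Sum>i<n. (Lc j (v n i) \<omega> - Lc j (u n i) \<omega>) *\<^sub>R H n i \<omega>))
      \<longlonglongrightarrow> (LINT z|LT.doleans j. exp_path x y z)" for j
    unfolding u_def v_def
    by (rule LT.step_integral_tendsto[OF Hm Hb measurable_exp_path]) (rule Hl, simp_all add: u_def v_def)
  have lim_C: "(\<lambda>n. LINT \<omega>|M. (\<Sum>i<n. (clip (v n i) - clip (u n i)) *\<^sub>R H n i \<omega>))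
      \<longlonglongrightarrow> (LINT z|CT.doleans. exp_path x y z)"
    unfolding u_def v_def
    by (rule CT.step_integral_tendsto[OF Hm Hb measurable_exp_path]) (rule Hl, simp_all add: u_def v_def)
  \<comment> \<open>Fubini for the time integral, obtained from the same Riemann sums, whose expectations do not depend on n\<close>
  have occupation: "(LINT z|CT.doleans. exp_path x y z) = complex_of_real T * \<Phi>"
  proof -
    have "(\<lambda>n. LINT \<omega>|M. (\<Sum>i<n. (clip (v n i) - clip (u n i)) *\<^sub>R exp_path x y (\<omega>, u n i)))
      \<longlonglongrightarrow> (LINT z|CT.doleans. exp_path x y z)"
      unfolding u_def v_def
    proof (rule CT.step_integral_tendsto[where C=1])
      show "(\<lambda>\<omega>. exp_path x y (\<omega>, T * real i / real n)) \<in> borel_measurable M" for i n by measurable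
      show "cmod (exp_path x y (\<omega>, T * real i / real n)) \<le> 1" for i n \<omega> using xy by (rule norm_exp_path_le)
    qed (auto intro: tendsto_exp_path)
    moreover have "\<forall>\<^sub>F n in sequentially. (LINT \<omega>|M. (\<Sum>i<n. (clip (v n i) - clip (u n i)) *\<^sub>R exp_path x y (\<omega>, u n i))) = complex_of_real T * \<Phi>"
    proof (rule eventually_sequentiallyI[of 1])
      fix n :: nat assume n: "1 \<le> n"
      have "(LINT \<omega>|M. exp_path x y (\<omega>, u n i)) = \<Phi>" if "i < n" for i
      proof -
        have "AE \<omega> in M. exp_path x y (\<omega>, u n i) = exp_state x y (G (u n i) \<omega>)"
          using AE_clipped by eventually_elim
            (use uv vT[OF that] order_trans[OF uv(2) vT[OF that]] in \<open>simp add: exp_path_def exp_state_def\<close>)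
        then have "(LINT \<omega>|M. exp_path x y (\<omega>, u n i)) = (LINT \<omega>|M. exp_state x y (G (u n i) \<omega>))"
          using measurable_G[OF uv(1)] by (intro integral_cong_AE) simp_all
        also have "\<dots> = \<Phi>" unfolding \<Phi>_def by (rule integral_stationary[OF measurable_exp_state uv(1)])
        finally show ?thesis .
      qed
      moreover have "clip (v n i) - clip (u n i) = T / real n" if "i < n" for i
        using clip_id[of "v n i"] clip_id[of "u n i"] uv[of n i] vT[OF that] vu[of n i] by simp
      moreover have "integrable M (\<lambda>\<omega>. exp_path x y (\<omega>, u n i))" for i
        by (rule integrable_const_bound[where B=1]) (use xy norm_exp_path_le in auto)
      ultimately have "(LINT \<omega>|M. (\<Sum>i<n. (clip (v n i) - clip (u n i)) *\<^sub>R exp_path x y (\<omega>, u n i)))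
          = (\<Sum>i<n. (T / real n) *\<^sub>R \<Phi>)"
        by (subst Bochner_Integration.integral_sum) simp_all
      also have "\<dots> = complex_of_real T * \<Phi>" using n by (simp add: scaleR_conv_of_real)
      finally show "(LINT \<omega>|M. (\<Sum>i<n. (clip (v n i) - clip (u n i)) *\<^sub>R exp_path x y (\<omega>, u n i))) = complex_of_real T * \<Phi>" .
    qed
    ultimately have "(\<lambda>n. complex_of_real T * \<Phi>) \<longlonglongrightarrow> (LINT z|CT.doleans. exp_path x y z)"
      by (rule Lim_transform_eventually)
    then show ?thesis using LIMSEQ_unique tendsto_const by blast
  qed
  let ?IC = "\<lambda>n i. LINT \<omega>|M. (clip (v n i) - clip (u n i)) *\<^sub>R H n i \<omega>"
    and ?IL = "\<lambda>j n i. LINT \<omega>|M. (Lc j (v n i) \<omega> - Lc j (u n i) \<omega>) *\<^sub>R H n i \<omega>"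
  let ?SC = "\<lambda>n. LINT \<omega>|M. (\<Sum>i<n. (clip (v n i) - clip (u n i)) *\<^sub>R H n i \<omega>)"
    and ?SL = "\<lambda>j n. LINT \<omega>|M. (\<Sum>i<n. (Lc j (v n i) \<omega> - Lc j (u n i) \<omega>) *\<^sub>R H n i \<omega>)"
  let ?c0 = "- (complex_of_real \<mu>1 * x + complex_of_real \<mu>2 * y)" and ?c1 = "x + complex_of_real r1 * y" and ?c2 = "complex_of_real r2 * x + y"
  have total: "?c0 * ?SC n
      + ?c1 * ?SL 1 n
      + ?c2 * ?SL 2 n
      = \<Phi> * (of_nat n * (1 - complex_of_real (exp (- (T / real n) * \<theta>\<^sup>2 / 2))))" (is "_ = ?rhs n") for n
  proof -
    have iC: "integrable M (\<lambda>\<omega>. (clip (v n i) - clip (u n i)) *\<^sub>R H n i \<omega>)" for i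
      by (rule CT.integrable_increment[OF uv(2) Hm Hb])
    have iL: "integrable M (\<lambda>\<omega>. (Lc j (v n i) \<omega> - Lc j (u n i) \<omega>) *\<^sub>R H n i \<omega>)" for i j
      by (rule LT.integrable_increment[OF uv(2) Hm Hb])
    have "?c0 * ?SC n
      + ?c1 * ?SL 1 n
      + ?c2 * ?SL 2 n
      = (\<Sum>i<n. ?c0 * ?IC n i
        + ?c1 * ?IL 1 n i
        + ?c2 * ?IL 2 n i)"
      by (subst (1 2 3) Bochner_Integration.integral_sum)
         (simp_all only: iC iL sum.distrib sum_distrib_left)
    also have "\<dots> = (\<Sum>i<n. LINT \<omega>|M. drift_increment x y (u n i) (v n i) \<omega> * H n i \<omega>)"
    proof (rule sum.cong[OF refl])
      fix i
      have "(LINT \<omega>|M. drift_increment x y (u n i) (v n i) \<omega> * H n i \<omega>) =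
        (LINT \<omega>|M. ?c0 * ((clip (v n i) - clip (u n i)) *\<^sub>R H n i \<omega>)
          + ?c1 * ((Lc 1 (v n i) \<omega> - Lc 1 (u n i) \<omega>) *\<^sub>R H n i \<omega>)
          + ?c2 * ((Lc 2 (v n i) \<omega> - Lc 2 (u n i) \<omega>) *\<^sub>R H n i \<omega>))"
        unfolding drift_increment_def scaleR_conv_of_real
        by (simp only: distrib_right mult.assoc)
      also have "\<dots> = ?c0 * ?IC n i
        + ?c1 * ?IL 1 n i
        + ?c2 * ?IL 2 n i"
        by (subst Bochner_Integration.integral_add integral_mult_right,
            intro Bochner_Integration.integrable_add integrable_mult_right iC iL,
            intro integrable_mult_right iC iL)+
           (simp only: integral_mult_right_zero)
      finally show "?c0 * ?IC n i
        + ?c1 * ?IL 1 n i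
        + ?c2 * ?IL 2 n i
        = (LINT \<omega>|M. drift_increment x y (u n i) (v n i) \<omega> * H n i \<omega>)" ..
    qed
    also have "\<dots> = (\<Sum>i<n. \<Phi> * (1 - complex_of_real (exp (- (T / real n) * \<theta>\<^sup>2 / 2))))"
    proof (rule sum.cong[OF refl])
      fix i assume "i \<in> {..<n}"
      then have "v n i \<le> T" using vT by simp
      from expectation_step[OF x y p uv this]
      show "(LINT \<omega>|M. drift_increment x y (u n i) (v n i) \<omega> * H n i \<omega>) =
          \<Phi> * (1 - complex_of_real (exp (- (T / real n) * \<theta>\<^sup>2 / 2)))"
        unfolding vu H_def \<Phi>_def \<theta>_def .
    qed
    also have "\<dots> = ?rhs n" by (simp add: mult_ac)
    finally show ?thesis .
  qed
  have "(\<lambda>n. real n * (1 - exp (- (T / real n) * \<theta>\<^sup>2 / 2))) \<longlonglongrightarrow> T * \<theta>\<^sup>2 / 2"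
    by real_asymp
  then have "(\<lambda>n. \<Phi> * complex_of_real (real n * (1 - exp (- (T / real n) * \<theta>\<^sup>2 / 2)))) \<longlonglongrightarrow> \<Phi> * complex_of_real (T * \<theta>\<^sup>2 / 2)"
    by (intro tendsto_intros)
  then have rhs: "?rhs \<longlonglongrightarrow> \<Phi> * complex_of_real (T * \<theta>\<^sup>2 / 2)" by simp
  have lhs: "?rhs \<longlonglongrightarrow> ?c0 * (complex_of_real T * \<Phi>) + ?c1 * (LINT z|LT.doleans 1. exp_path x y z) + ?c2 * (LINT z|LT.doleans 2. exp_path x y z)"
    unfolding total[symmetric] occupation[symmetric] by (intro tendsto_intros lim_L lim_C)
  have "(x - y)\<^sup>2 = - complex_of_real (\<theta>\<^sup>2)"
  proof -
    have "x - y = \<i> * complex_of_real \<theta>" by (simp add: complex_eq_iff x y \<theta>_def)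
    then show ?thesis by (simp add: power_mult_distrib)
  qed
  then have "\<Phi> * complex_of_real (T * \<theta>\<^sup>2 / 2) = - (complex_of_real T * ((x - y)\<^sup>2 / 2) * \<Phi>)"
    by simp
  with LIMSEQ_unique[OF lhs rhs] have
    "?c0 * (complex_of_real T * \<Phi>) + ?c1 * (LINT z|LT.doleans 1. exp_path x y z) + ?c2 * (LINT z|LT.doleans 2. exp_path x y z)
      = - (complex_of_real T * ((x - y)\<^sup>2 / 2) * \<Phi>)" by (simp only:)
  then show ?thesis
    unfolding \<Phi>_def[symmetric]
    by (simp only: eq_neg_iff_add_eq_0) (simp only: left_diff_distrib right_diff_distrib distrib_left distrib_right mult_ac add_ac diff_conv_add_uminus minus_mult_left[symmetric] minus_mult_right[symmetric] minus_add_distrib)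
qed

end

section \<open>Boundary measures and their Laplace transforms\<close>

lemma continuous_on_integral_exp:
  fixes X :: "'a \<Rightarrow> real"
  assumes "finite_measure D" and [measurable]: "X \<in> borel_measurable D" and nonneg: "AE z in D. 0 \<le> X z"
  shows "continuous_on {y. Re y \<le> 0} (\<lambda>y. LINT z|D. exp (y * complex_of_real (X z)))"
proof -
  interpret finite_measure D by fact
  show ?thesis
    unfolding continuous_on_def tendsto_at_iff_sequentially
  proof (intro ballI allI impI)
    fix y u assume "y \<in> {y. Re y \<le> 0}" and u: "\<forall>i::nat. u i \<in> {y. Re y \<le> 0} - {y}" "u \<longlonglongrightarrow> y"
    have "(\<lambda>n. LINT z|D. exp (u n * complex_of_real (X z))) \<longlonglongrightarrow> (LINT z|D. exp (y * complex_of_real (X z)))"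
    proof (rule integral_dominated_convergence[where w="\<lambda>_. 1"])
      show "AE z in D. (\<lambda>n. exp (u n * complex_of_real (X z))) \<longlonglongrightarrow> exp (y * complex_of_real (X z))"
        using u(2) by (intro AE_I2 tendsto_intros)
      show "AE z in D. cmod (exp (u n * complex_of_real (X z))) \<le> 1" for n
        using nonneg
      proof eventually_elim
        case (elim z)
        with u(1)[rule_format, of n] show ?case by (simp add: mult_nonpos_nonneg)
      qed
    qed simp_all
    then show "((\<lambda>y. LINT z|D. exp (y * complex_of_real (X z))) \<circ> u) \<longlonglongrightarrow> (LINT z|D. exp (y * complex_of_real (X z)))"
      by (simp add: comp_def)
  qed
qed

text \<open>
  Differentiation under the integral sign. With \<open>d = - Re y / 2\<close>, the difference quotients are
  dominated by \<open>X exp (- d X) \<le> 1 / d\<close>, which is integrable because the measure is finite.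
\<close>

lemma holomorphic_integral_exp:
  fixes X :: "'a \<Rightarrow> real"
  assumes "finite_measure D" and [measurable]: "X \<in> borel_measurable D" and nonneg: "AE z in D. 0 \<le> X z"
  shows "(\<lambda>y. LINT z|D. exp (y * complex_of_real (X z))) holomorphic_on {y. Re y < 0}"
proof -
  interpret finite_measure D by fact
  define f where "f y = (LINT z|D. exp (y * complex_of_real (X z)))" for y
  have "(f has_field_derivative (LINT z|D. complex_of_real (X z) * exp (y * complex_of_real (X z)))) (at y)"
    if y: "Re y < 0" for y
    unfolding DERIV_def tendsto_at_iff_sequentially
  proof (intro allI impI)
    fix h assume h: "\<forall>i::nat. h i \<in> UNIV - {0::complex}" "h \<longlonglongrightarrow> 0"
    define d where "d = - Re y / 2"
    have d: "d > 0" using y by (simp add: d_def)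
    have "\<forall>\<^sub>F n in sequentially. cmod (h n) < d"
      using tendstoD[OF h(2) d] by (simp add: dist_norm)
    then obtain N where N: "cmod (h n) < d" if "N \<le> n" for n
      by (auto simp: eventually_sequentially)
    let ?q = "\<lambda>n z. complex_of_real (X z) * exp (y * complex_of_real (X z)) * exp_quotient (h n * complex_of_real (X z))"
    have bound: "AE z in D. cmod (?q (n + N) z) \<le> 1 / d" for n
      using nonneg
    proof eventually_elim
      case (elim z)
      have "Re (h (n + N)) \<le> d" using N[of "n + N"] complex_Re_le_cmod[of "h (n + N)"] by simp
      then have "cmod (exp_quotient (h (n + N) * complex_of_real (X z))) \<le> exp (d * X z)"
        using elim d by (intro norm_exp_quotient_le) (auto intro: mult_right_mono)
      then have "cmod (?q (n + N) z) \<le> X z * exp (Re y * X z) * exp (d * X z)"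
        using elim by (simp add: norm_mult mult_left_mono)
      also have "\<dots> = X z * exp (- (d * X z))"
        unfolding mult.assoc mult_exp_exp by (simp add: d_def algebra_simps)
      also have "\<dots> \<le> 1 / d"
      proof -
        have "d * X z \<le> exp (d * X z)" using exp_ge_add_one_self[of "d * X z"] by linarith
        then show ?thesis using d by (simp add: exp_minus divide_simps mult.commute)
      qed
      finally show ?case .
    qed
    have lim: "(\<lambda>n. LINT z|D. ?q (n + N) z) \<longlonglongrightarrow> (LINT z|D. complex_of_real (X z) * exp (y * complex_of_real (X z)))"
    proof (rule integral_dominated_convergence[where w="\<lambda>_. 1 / d"])
      show "AE z in D. (\<lambda>n. ?q (n + N) z) \<longlonglongrightarrow> complex_of_real (X z) * exp (y * complex_of_real (X z))"
      proof (rule AE_I2)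
        fix z
        have "(\<lambda>n. h (n + N) * complex_of_real (X z)) \<longlonglongrightarrow> 0"
          using tendsto_mult_right[OF LIMSEQ_ignore_initial_segment[OF h(2), of N], of "complex_of_real (X z)"] by simp
        then have "(\<lambda>n. exp_quotient (h (n + N) * complex_of_real (X z))) \<longlonglongrightarrow> exp_quotient 0"
          by (rule isCont_tendsto_compose[OF isCont_exp_quotient])
        from tendsto_mult_left[OF this]
        show "(\<lambda>n. ?q (n + N) z) \<longlonglongrightarrow> complex_of_real (X z) * exp (y * complex_of_real (X z))"
          by (simp add: exp_quotient_def)
      qed
    qed (use bound in simp_all)
    have quot: "(f (y + h n) - f y) / h n = (LINT z|D. ?q n z)" if "N \<le> n" for n
    proof -
      have hn: "h n \<noteq> 0" using h(1) by simp
      have int: "integrable D (\<lambda>z. exp (w * complex_of_real (X z)))" if "Re w \<le> 0" for w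
        by (rule integrable_const_bound[where B=1])
           (use nonneg that in \<open>auto elim!: eventually_mono simp: mult_nonpos_nonneg\<close>)
      have "Re (y + h n) \<le> 0" using N[OF \<open>N \<le> n\<close>] complex_Re_le_cmod[of "h n"] y by (simp add: d_def)
      then have "f (y + h n) - f y = (LINT z|D. exp ((y + h n) * complex_of_real (X z)) - exp (y * complex_of_real (X z)))"
        unfolding f_def using y by (intro Bochner_Integration.integral_diff[symmetric] int) auto
      then have "(f (y + h n) - f y) / h n = (LINT z|D. (exp ((y + h n) * complex_of_real (X z)) - exp (y * complex_of_real (X z))) / h n)"
        by simp
      also have "\<dots> = (LINT z|D. ?q n z)"
      proof (rule Bochner_Integration.integral_cong[OF refl])
        fix z
        have "exp ((y + h n) * complex_of_real (X z)) - exp (y * complex_of_real (X z)) =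
            exp (y * complex_of_real (X z)) * (exp (h n * complex_of_real (X z)) - 1)"
          by (simp add: distrib_right exp_add right_diff_distrib)
        then show "(exp ((y + h n) * complex_of_real (X z)) - exp (y * complex_of_real (X z))) / h n = ?q n z"
          using hn unfolding exp_minus_one_eq by simp
      qed
      finally show ?thesis .
    qed
    have "(\<lambda>n. (f (y + h (n + N)) - f y) / h (n + N)) \<longlonglongrightarrow> (LINT z|D. complex_of_real (X z) * exp (y * complex_of_real (X z)))"
      using lim by (simp add: quot)
    then show "((\<lambda>h. (f (y + h) - f y) / h) \<circ> h) \<longlonglongrightarrow> (LINT z|D. complex_of_real (X z) * exp (y * complex_of_real (X z)))"
      unfolding comp_def by (rule LIMSEQ_offset)
  qed
  then have "f holomorphic_on {y. Re y < 0}"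
    unfolding holomorphic_on_def field_differentiable_def
    by (blast intro: has_field_derivative_at_within)
  then show ?thesis unfolding f_def[abs_def] .
qed

lemma norm_integral_exp_le:
  fixes X :: "'a \<Rightarrow> real"
  assumes "finite_measure D" and [measurable]: "X \<in> borel_measurable D" and nonneg: "AE z in D. 0 \<le> X z"
    and y: "Re y \<le> 0"
  shows "cmod (LINT z|D. exp (y * complex_of_real (X z))) \<le> measure D (space D)"
proof -
  interpret finite_measure D by fact
  have "cmod (LINT z|D. exp (y * complex_of_real (X z))) \<le> (LINT z|D. norm (exp (y * complex_of_real (X z))))"
    by (rule integral_norm_bound)
  also have "\<dots> \<le> (LINT z|D. 1)"
  proof (rule integral_mono_AE)
    show ae: "AE z in D. norm (exp (y * complex_of_real (X z))) \<le> 1"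
      using nonneg by eventually_elim (use y in \<open>simp add: mult_nonpos_nonneg\<close>)
    show "integrable D (\<lambda>z. norm (exp (y * complex_of_real (X z))))"
      by (rule integrable_const_bound[where B=1]) (use ae in simp_all)
  qed simp
  finally show ?thesis by simp
qed

text \<open>
  Averages over the block \<open>n, \<dots>, 2 n - 1\<close>, rather than over \<open>0, \<dots>, n - 1\<close>: in the application all
  Fourier coefficients in the block are then of order \<open>1 / n\<close>, and so is their average.
\<close>

lemma tendsto_averaged_character:
  fixes z :: complex
  assumes z: "cmod z = 1"
  shows "(\<lambda>n. (\<Sum>k<n. z ^ (n + k)) / of_nat n) \<longlonglongrightarrow> (if z = 1 then 1 else 0)"
proof (cases "z = 1")
  case True
  then show ?thesis
    by (auto intro!: tendsto_eventually eventually_sequentiallyI[of 1])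
next
  case False
  have "(\<lambda>n. (\<Sum>k<n. z ^ (n + k)) / of_nat n) \<longlonglongrightarrow> 0"
  proof (rule Lim_null_comparison)
    show "\<forall>\<^sub>F n in sequentially. norm ((\<Sum>k<n. z ^ (n + k)) / of_nat n) \<le> (2 / cmod (z - 1)) / real n"
    proof (rule always_eventually, rule allI)
      fix n
      have "(\<Sum>k<n. z ^ (n + k)) = z ^ n * ((z ^ n - 1) / (z - 1))"
        using geometric_sum[OF False, of n] by (simp add: power_add flip: sum_distrib_left)
      then have "cmod (\<Sum>k<n. z ^ (n + k)) = cmod (z ^ n - 1) / cmod (z - 1)"
        by (simp add: norm_mult norm_divide norm_power z)
      also have "\<dots> \<le> 2 / cmod (z - 1)"
        using norm_triangle_ineq4[of "z ^ n" 1] by (intro divide_right_mono) (simp_all add: norm_power z)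
      finally have "cmod (\<Sum>k<n. z ^ (n + k)) / real n \<le> (2 / cmod (z - 1)) / real n"
        by (rule divide_right_mono) simp
      then show "norm ((\<Sum>k<n. z ^ (n + k)) / of_nat n) \<le> (2 / cmod (z - 1)) / real n"
        by (simp only: norm_divide norm_of_nat)
    qed
    show "(\<lambda>n. (2 / cmod (z - 1)) / real n) \<longlonglongrightarrow> 0" by (rule lim_const_over_n)
  qed
  with False show ?thesis by simp
qed

context stationary_reflected_bm
begin

lemma finite_measure_LT: "finite_measure (LT.doleans i)"
  by (rule LT.finite_measure_doleans)

lemma norm_integral_exp_path_le:
  assumes "Re x \<le> 0" "Re y \<le> 0"
  shows "cmod (LINT z|LT.doleans i. exp_path x y z) \<le> measure (LT.doleans i) (space (LT.doleans i))"
proof -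
  interpret D: finite_measure "LT.doleans i" by (rule finite_measure_LT)
  have "cmod (LINT z|LT.doleans i. exp_path x y z) \<le> (LINT z|LT.doleans i. norm (exp_path x y z))"
    by (rule integral_norm_bound)
  also have "\<dots> \<le> (LINT z|LT.doleans i. 1)"
  proof (rule integral_mono)
    show "norm (exp_path x y z) \<le> 1" for z by (rule norm_exp_path_le[OF assms])
    then show "integrable (LT.doleans i) (\<lambda>z. norm (exp_path x y z))"
      by (intro D.integrable_const_bound[where B=1]) simp_all
  qed simp
  finally show ?thesis by simp
qed

text \<open>
  At the exponent \<open>(i k, 0)\<close> the interior term of the adjoint relation is of order \<open>k\<^sup>2\<close> and the
  boundary terms are of order \<open>k\<close>, so the characteristic function of \<open>G\<^sub>1\<close> at the integers is \<open>O(1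
  / k)\<close>. Averaging it kills the atoms of \<open>G\<^sub>1\<close> in \<open>2 \<pi> \<int>\<close>; only the atom at \<open>0\<close> matters later.
\<close>

lemma AE_first_coordinate_off_lattice: "AE \<omega> in M. iexp (G 0 \<omega> $ 1) \<noteq> 1"
proof -
  note [measurable] = measurable_G[OF order_refl]
  define Z where "Z \<omega> = iexp (G 0 \<omega> $ 1)" for \<omega>
  have [measurable]: "Z \<in> borel_measurable M" unfolding Z_def[abs_def] by measurable
  have norm_Z [simp]: "cmod (Z \<omega>) = 1" for \<omega> unfolding Z_def by (rule norm_exp_i_times)
  define C where "C = 2 * (measure (LT.doleans 1) (space (LT.doleans 1)) + \<bar>r2\<bar> * measure (LT.doleans 2) (space (LT.doleans 2))) / T"
  define \<Phi> where "\<Phi> k = (LINT \<omega>|M. Z \<omega> ^ k)" for k :: nat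
  have decay: "cmod (\<Phi> k) \<le> C / real k" if k: "0 < k" for k
  proof -
    let ?x = "\<i> * of_nat k :: complex"
    let ?A = "LINT z|LT.doleans 1. exp_path ?x 0 z" and ?B = "LINT z|LT.doleans 2. exp_path ?x 0 z"
    have \<Phi>: "(LINT \<omega>|M. exp_state ?x 0 (G 0 \<omega>)) = \<Phi> k"
      unfolding \<Phi>_def exp_state_def Z_def by (simp add: exp_of_nat_mult[symmetric] mult_ac)
    have "?x * (complex_of_real T * (?x / 2 - complex_of_real \<mu>1) * \<Phi> k + (?A + complex_of_real r2 * ?B)) = 0"
      using basic_adjoint_relation[of ?x 0 0] unfolding \<Phi>
      by (simp add: algebra_simps power2_eq_square)
    then have "complex_of_real T * (?x / 2 - complex_of_real \<mu>1) * \<Phi> k = - (?A + complex_of_real r2 * ?B)"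
      using k by (simp only: eq_neg_iff_add_eq_0 mult_eq_0_iff) simp
    then have "cmod (complex_of_real T * (?x / 2 - complex_of_real \<mu>1) * \<Phi> k) = cmod (- (?A + complex_of_real r2 * ?B))"
      by (rule arg_cong)
    then have "T * cmod (?x / 2 - complex_of_real \<mu>1) * cmod (\<Phi> k) = cmod (?A + complex_of_real r2 * ?B)"
      using horizon by (simp only: norm_minus_cancel norm_mult norm_of_real abs_of_pos)
    also have "\<dots> \<le> cmod ?A + \<bar>r2\<bar> * cmod ?B"
      using norm_triangle_ineq[of ?A "complex_of_real r2 * ?B"] by (simp add: norm_mult)
    also have "\<dots> \<le> C * T / 2"
      using norm_integral_exp_path_le[of ?x 0 1] norm_integral_exp_path_le[of ?x 0 2] horizon
      by (simp add: C_def add_mono mult_left_mono)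
    finally have 1: "T * cmod (?x / 2 - complex_of_real \<mu>1) * cmod (\<Phi> k) \<le> C * T / 2" .
    have "real k / 2 \<le> cmod (?x / 2 - complex_of_real \<mu>1)"
      using abs_Im_le_cmod[of "?x / 2 - complex_of_real \<mu>1"] by simp
    then have "T * (real k / 2) * cmod (\<Phi> k) \<le> T * cmod (?x / 2 - complex_of_real \<mu>1) * cmod (\<Phi> k)"
      using horizon by (intro mult_right_mono mult_left_mono) auto
    with 1 have "T * (real k / 2) * cmod (\<Phi> k) \<le> C * T / 2" by linarith
    then have "cmod (\<Phi> k) * real k \<le> C" using horizon by (simp add: field_simps)
    then show ?thesis using k by (simp add: pos_le_divide_eq)
  qed
  have C: "0 \<le> C" using horizon by (simp add: C_def)
  have int: "integrable M (\<lambda>\<omega>. Z \<omega> ^ k)" for k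
    by (rule integrable_const_bound[where B=1]) (simp_all add: norm_power)
  have "(\<lambda>n. LINT \<omega>|M. (\<Sum>k<n. Z \<omega> ^ (n + k)) / of_nat n) \<longlonglongrightarrow>
      (LINT \<omega>|M. (if Z \<omega> = 1 then 1 else 0))"
  proof (rule integral_dominated_convergence[where w="\<lambda>_. 1"])
    show "AE \<omega> in M. (\<lambda>n. (\<Sum>k<n. Z \<omega> ^ (n + k)) / of_nat n) \<longlonglongrightarrow>
        (if Z \<omega> = 1 then 1 else 0)"
      by (intro AE_I2 tendsto_averaged_character) simp
    show "AE \<omega> in M. cmod ((\<Sum>k<n. Z \<omega> ^ (n + k)) / of_nat n) \<le> 1" for n
    proof (rule AE_I2)
      fix \<omega>
      have "cmod (\<Sum>k<n. Z \<omega> ^ (n + k)) \<le> (\<Sum>k<n. 1)"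
        by (rule sum_norm_le) (simp add: norm_power)
      then show "cmod ((\<Sum>k<n. Z \<omega> ^ (n + k)) / of_nat n) \<le> 1"
        by (cases "n = 0") (simp_all add: norm_divide)
    qed
  qed simp_all
  from LIMSEQ_unique[OF this] have unique:
    "(\<lambda>n. LINT \<omega>|M. (\<Sum>k<n. Z \<omega> ^ (n + k)) / of_nat n) \<longlonglongrightarrow> c \<Longrightarrow>
      (LINT \<omega>|M. (if Z \<omega> = 1 then 1 else 0)) = c" for c .
  have "(\<lambda>n. LINT \<omega>|M. (\<Sum>k<n. Z \<omega> ^ (n + k)) / of_nat n) \<longlonglongrightarrow> 0"
  proof (rule Lim_null_comparison)
    show "\<forall>\<^sub>F n in sequentially. norm (LINT \<omega>|M. (\<Sum>k<n. Z \<omega> ^ (n + k)) / of_nat n) \<le> C / real n"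
    proof (rule eventually_sequentiallyI[of 1])
      fix n :: nat assume n: "1 \<le> n"
      have "(LINT \<omega>|M. (\<Sum>k<n. Z \<omega> ^ (n + k)) / of_nat n) = (\<Sum>k<n. \<Phi> (n + k)) / of_nat n"
        unfolding \<Phi>_def using int by (simp add: Bochner_Integration.integral_sum)
      moreover have "cmod (\<Sum>k<n. \<Phi> (n + k)) \<le> (\<Sum>k<n. C / real n)"
      proof (rule sum_norm_le)
        fix k
        have "cmod (\<Phi> (n + k)) \<le> C / real (n + k)" using n by (intro decay) simp
        also have "\<dots> \<le> C / real n" using n C by (intro divide_left_mono) simp_all
        finally show "cmod (\<Phi> (n + k)) \<le> C / real n" .
      qed
      ultimately show "norm (LINT \<omega>|M. (\<Sum>k<n. Z \<omega> ^ (n + k)) / of_nat n) \<le> C / real n"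
        using n by (simp add: norm_divide divide_le_eq)
    qed
    show "(\<lambda>n. C / real n) \<longlonglongrightarrow> 0" by (rule lim_const_over_n)
  qed
  then have "(LINT \<omega>|M. (if Z \<omega> = 1 then 1 else 0) :: complex) = 0"
    by (rule unique)
  moreover have "(LINT \<omega>|M. (if Z \<omega> = 1 then 1 else 0) :: complex) =
      (LINT \<omega>|M. complex_of_real (if Z \<omega> = 1 then 1 else 0))"
    by (intro Bochner_Integration.integral_cong) auto
  ultimately have 0: "(LINT \<omega>|M. (if Z \<omega> = 1 then 1 else 0) :: real) = 0"
    by simp
  have "integrable M (\<lambda>\<omega>. (if Z \<omega> = 1 then 1 else 0) :: real)"
    by (rule integrable_const_bound[where B=1]) simp_all
  from integral_nonneg_eq_0_iff_AE[OF this] 0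
  have "AE \<omega> in M. (if Z \<omega> = 1 then 1 else 0 :: real) = 0" by simp
  then show ?thesis by eventually_elim (simp add: Z_def split: if_splits)
qed

text \<open>
  At the exponent \<open>(- p, - p)\<close> the factor \<open>p\<close> cancels from the adjoint relation, which then
  compares integrals of \<open>exp (- p (G\<^sub>1 + G\<^sub>2))\<close> with respect to time and to the local times. As \<open>p
  \<rightarrow> \<infinity>\<close> they converge to the time spent at the corner, which is zero, and to the weighted pushes at
  the corner. Both weights \<open>1 + r\<^sub>i\<close> are positive, so both pushes vanish.
\<close>

lemma AE_doleans_not_corner:
  "AE z in LT.doleans i. 0 < Gc 1 (snd z) (fst z) + Gc 2 (snd z) (fst z)"
proof -
  note [measurable] = measurable_G[OF order_refl]
  define X where "X z = Gc 1 (snd z) (fst z) + Gc 2 (snd z) (fst z)" for z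
  have X [measurable]: "X \<in> borel_measurable (M \<Otimes>\<^sub>M borel)" unfolding X_def[abs_def] by measurable
  have X0: "0 \<le> X z" for z using Gc_nonneg by (simp add: X_def)
  have ind_lim: "(\<lambda>n. exp (- real n * a)) \<longlonglongrightarrow> (if a = 0 then 1 else 0)" if "0 \<le> a" for a :: real
  proof (cases "a = 0")
    case False
    then have "a > 0" using that by simp
    then have "(\<lambda>n. exp (- real n * a)) \<longlonglongrightarrow> 0" by real_asymp
    with False show ?thesis by simp
  qed simp
  define I where "I i = (LINT z|LT.doleans i. (if X z = 0 then 1 else 0) :: real)" for i
  have lim_I: "(\<lambda>n. LINT z|LT.doleans i. exp (- real n * X z)) \<longlonglongrightarrow> I i" for i
    unfolding I_def
  proof (rule integral_dominated_convergence[where w="\<lambda>_. 1"])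
    interpret D: finite_measure "LT.doleans i" by (rule finite_measure_LT)
    show "integrable (LT.doleans i) (\<lambda>_. 1 :: real)" by simp
    show "AE z in LT.doleans i. (\<lambda>n. exp (- real n * X z)) \<longlonglongrightarrow> (if X z = 0 then 1 else 0)"
      by (intro AE_I2 ind_lim X0)
    show "AE z in LT.doleans i. norm (exp (- real n * X z)) \<le> 1" for n
      using X0 by (intro AE_I2) simp
  qed simp_all
  have lim_0: "(\<lambda>n. LINT \<omega>|M. exp (- real n * (G 0 \<omega> $ 1 + G 0 \<omega> $ 2))) \<longlonglongrightarrow> (LINT \<omega>|M. 0)"
  proof (rule integral_dominated_convergence[where w="\<lambda>_. 1"])
    show "AE \<omega> in M. (\<lambda>n. exp (- real n * (G 0 \<omega> $ 1 + G 0 \<omega> $ 2))) \<longlonglongrightarrow> 0"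
      using AE_first_coordinate_off_lattice AE_good
    proof eventually_elim
      case (elim \<omega>)
      have G: "0 \<le> G 0 \<omega> $ i" for i using regularD(6)[OF good_regular[OF elim(2)]] by simp
      have "G 0 \<omega> $ 1 \<noteq> 0" using elim(1) by auto
      with G[of 1] G[of 2] have "G 0 \<omega> $ 1 + G 0 \<omega> $ 2 > 0" by linarith
      then show ?case by real_asymp
    qed
    show "AE \<omega> in M. norm (exp (- real n * (G 0 \<omega> $ 1 + G 0 \<omega> $ 2))) \<le> 1" for n
      using AE_good
    proof eventually_elim
      case (elim \<omega>)
      have G: "0 \<le> G 0 \<omega> $ i" for i using regularD(6)[OF good_regular[OF elim]] by simp
      from G[of 1] G[of 2] show ?case by (simp add: mult_nonpos_nonneg)
    qed
  qed simp_all
  have balance: "T * (LINT \<omega>|M. exp (- real n * (G 0 \<omega> $ 1 + G 0 \<omega> $ 2))) =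
      (1 + r1) * (LINT z|LT.doleans 1. exp (- real n * X z)) + (1 + r2) * (LINT z|LT.doleans 2. exp (- real n * X z))"
    if n: "0 < n" for n
  proof -
    let ?p = "- complex_of_real (real n)"
    have e1: "exp_state ?p ?p v = complex_of_real (exp (- real n * (v $ 1 + v $ 2)))" for v
      by (simp add: exp_state_def exp_of_real[symmetric] algebra_simps)
    have e2: "exp_path ?p ?p z = complex_of_real (exp (- real n * X z))" for z
      by (simp add: exp_path_def X_def exp_of_real[symmetric] algebra_simps)
    let ?A = "LINT \<omega>|M. exp (- real n * (G 0 \<omega> $ 1 + G 0 \<omega> $ 2))"
      and ?B1 = "LINT z|LT.doleans 1. exp (- real n * X z)" and ?B2 = "LINT z|LT.doleans 2. exp (- real n * X z)"
    have "complex_of_real (T * (\<mu>1 * real n + \<mu>2 * real n) * ?A + (- real n - r1 * real n) * ?B1 + (- r2 * real n - real n) * ?B2) = 0"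
      using basic_adjoint_relation[of ?p "real n" ?p] unfolding e1 e2 integral_complex_of_real
      by simp
    then have "T * (\<mu>1 * real n + \<mu>2 * real n) * ?A + (- real n - r1 * real n) * ?B1 + (- r2 * real n - real n) * ?B2 = 0"
      unfolding of_real_eq_0_iff .
    moreover have "\<mu>1 * real n + \<mu>2 * real n = real n" using drift by (simp flip: distrib_right)
    ultimately have "real n * (T * ?A - ((1 + r1) * ?B1 + (1 + r2) * ?B2)) = 0"
      by (simp add: algebra_simps)
    then show ?thesis using n by simp
  qed
  have lim1: "(\<lambda>n. (1 + r1) * (LINT z|LT.doleans 1. exp (- real n * X z)) + (1 + r2) * (LINT z|LT.doleans 2. exp (- real n * X z)))
      \<longlonglongrightarrow> (1 + r1) * I 1 + (1 + r2) * I 2"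
    by (intro tendsto_intros lim_I)
  have lim2: "(\<lambda>n. (1 + r1) * (LINT z|LT.doleans 1. exp (- real n * X z)) + (1 + r2) * (LINT z|LT.doleans 2. exp (- real n * X z)))
      \<longlonglongrightarrow> T * 0"
  proof (rule Lim_transform_eventually)
    show "(\<lambda>n. T * (LINT \<omega>|M. exp (- real n * (G 0 \<omega> $ 1 + G 0 \<omega> $ 2)))) \<longlonglongrightarrow> T * 0"
      using lim_0 by (intro tendsto_intros) simp
    show "\<forall>\<^sub>F n in sequentially. T * (LINT \<omega>|M. exp (- real n * (G 0 \<omega> $ 1 + G 0 \<omega> $ 2))) =
      (1 + r1) * (LINT z|LT.doleans 1. exp (- real n * X z)) + (1 + r2) * (LINT z|LT.doleans 2. exp (- real n * X z))"
      by (rule eventually_sequentiallyI[of 1]) (rule balance, simp)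
  qed
  from LIMSEQ_unique[OF lim1 lim2] have "(1 + r1) * I 1 + (1 + r2) * I 2 = 0" by simp
  moreover have I_nonneg: "0 \<le> I i" for i unfolding I_def by (rule integral_nonneg_AE) simp
  moreover have "0 \<le> (1 + r1) * I 1" "0 \<le> (1 + r2) * I 2" using I_nonneg r1 r2 by simp_all
  ultimately have "(1 + r1) * I 1 = 0" "(1 + r2) * I 2 = 0" by linarith+
  then have "I 1 = 0" "I 2 = 0" using r1 r2 by simp_all
  then have "I i = 0" using exhaust_2[of i] by auto
  interpret D: finite_measure "LT.doleans i" by (rule finite_measure_LT)
  have "integrable (LT.doleans i) (\<lambda>z. (if X z = 0 then 1 else 0) :: real)"
    by (rule D.integrable_const_bound[where B=1]) simp_all
  from integral_nonneg_eq_0_iff_AE[OF this] \<open>I i = 0\<close>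
  have "AE z in LT.doleans i. (if X z = 0 then 1 else 0 :: real) = 0" by (simp add: I_def)
  then show ?thesis
  proof eventually_elim
    case (elim z)
    then have "X z \<noteq> 0" by (simp split: if_splits)
    with X0[of z] show ?case by (simp add: X_def)
  qed
qed

lemma Lc_constant_off_boundary:
  assumes pq: "p \<le> q" and off: "\<And>u. p \<le> u \<Longrightarrow> u \<le> q \<Longrightarrow> Gc i u \<omega> \<noteq> 0"
  shows "Lc i q \<omega> = Lc i p \<omega>"
proof (cases "good \<omega>")
  case True
  have "L (clip q) \<omega> $ i = L (clip p) \<omega> $ i"
  proof (rule regularD(9)[OF good_regular[OF True] clip_nonneg clip_mono[OF pq]])
    fix v assume v: "clip p \<le> v" "v \<le> clip q"
    have "\<exists>u. p \<le> u \<and> u \<le> q \<and> clip u = v"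
    proof (cases "p \<le> v \<and> v \<le> q")
      case True
      have "clip v = v" using v horizon by (auto simp: clip_def)
      with True show ?thesis by blast
    next
      case False
      then have "clip p = v \<or> clip q = v" using v horizon by (auto simp: clip_def split: if_splits)
      with pq show ?thesis by auto
    qed
    then show "G v \<omega> $ i \<noteq> 0" using off True by (auto simp: Gc_def)
  qed
  with True show ?thesis by (simp add: Lc_def)
qed (simp add: Lc_def)

text \<open>
  The open set of times off the edge \<open>G\<^sub>i = 0\<close> is a countable union of intervals with rational
  endpoints, on each of which \<open>L\<^sub>i\<close> is constant.
\<close>

lemma AE_doleans_on_boundary: "AE z in LT.doleans i. Gc i (snd z) (fst z) = 0"
proof -
  have path: "AE t in LT.stieltjes i \<omega>. Gc i t \<omega> = 0" for \<omega>
  proof -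
    define U where "U = {t. Gc i t \<omega> \<noteq> 0}"
    have "open U"
      unfolding U_def using continuous_Gc by (intro open_Collect_neq) auto
    let ?R = "{(p, q). p \<in> \<rat> \<and> q \<in> \<rat> \<and> p \<le> q \<and> {p..q} \<subseteq> U}"
    have "U \<subseteq> (\<Union>(p, q)\<in>?R. {p<..q})"
    proof
      fix t assume "t \<in> U"
      then obtain e where e: "e > 0" "ball t e \<subseteq> U" using \<open>open U\<close> open_contains_ball by blast
      obtain p where p: "p \<in> \<rat>" "t - e < p" "p < t" using Rats_dense_in_real[of "t - e" t] e by auto
      obtain q where q: "q \<in> \<rat>" "t < q" "q < t + e" using Rats_dense_in_real[of t "t + e"] e by auto
      have "{p..q} \<subseteq> U" using p q e(2) by (auto simp: subset_iff dist_real_def)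
      with p q show "t \<in> (\<Union>(p, q)\<in>?R. {p<..q})" by (intro UN_I[of "(p, q)"]) auto
    qed
    moreover have "(\<Union>(p, q)\<in>?R. {p<..q}) \<in> null_sets (LT.stieltjes i \<omega>)"
    proof (rule null_sets_UN')
      have "?R \<subseteq> \<rat> \<times> \<rat>" by auto
      then show "countable ?R" by (rule countable_subset) (intro countable_SIGMA countable_rat)
      fix r assume "r \<in> ?R"
      then obtain p q where r: "r = (p, q)" "p \<le> q" "{p..q} \<subseteq> U" by auto
      then have "Lc i q \<omega> = Lc i p \<omega>" by (intro Lc_constant_off_boundary) (auto simp: U_def)
      with r show "(case r of (p, q) \<Rightarrow> {p<..q}) \<in> null_sets (LT.stieltjes i \<omega>)"
        by (auto simp: null_sets_def LT.emeasure_stieltjes_Ioc)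
    qed
    ultimately show ?thesis by (intro AE_I') (auto simp: U_def)
  qed
  have "(\<integral>\<^sup>+z. indicator (- {0}) (Gc i (snd z) (fst z)) \<partial>LT.doleans i) =
      (\<integral>\<^sup>+\<omega>. \<integral>\<^sup>+t. indicator (- {0}) (Gc i t \<omega>) \<partial>LT.stieltjes i \<omega> \<partial>M)"
    by (subst LT.nn_integral_doleans) simp_all
  also have "\<dots> = (\<integral>\<^sup>+\<omega>. 0 \<partial>M)"
  proof (rule nn_integral_cong)
    fix \<omega>
    have "(\<integral>\<^sup>+t. indicator (- {0}) (Gc i t \<omega>) \<partial>LT.stieltjes i \<omega>) = (\<integral>\<^sup>+t. 0 \<partial>LT.stieltjes i \<omega>)"
      by (rule nn_integral_cong_AE) (use path[of \<omega>] in \<open>auto elim!: eventually_mono\<close>)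
    then show "(\<integral>\<^sup>+t. indicator (- {0}) (Gc i t \<omega>) \<partial>LT.stieltjes i \<omega>) = 0" by simp
  qed
  finally have "AE z in LT.doleans i. (indicator (- {0}) (Gc i (snd z) (fst z)) :: ennreal) = 0"
    by (subst nn_integral_0_iff_AE[symmetric]) simp_all
  then show ?thesis
    by eventually_elim (simp add: indicator_def split: if_splits)
qed

definition lateral1 :: "complex \<Rightarrow> complex" where
  "lateral1 y = (LINT z|LT.doleans 1. exp (y * complex_of_real (Gc 2 (snd z) (fst z))))"

definition lateral2 :: "complex \<Rightarrow> complex" where
  "lateral2 x = (LINT z|LT.doleans 2. exp (x * complex_of_real (Gc 1 (snd z) (fst z))))"

lemma integral_exp_path_lateral:
  "(LINT z|LT.doleans 1. exp_path x y z) = lateral1 y"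
  "(LINT z|LT.doleans 2. exp_path x y z) = lateral2 x"
proof -
  have "AE z in LT.doleans 1. exp_path x y z = exp (y * complex_of_real (Gc 2 (snd z) (fst z)))"
    using AE_doleans_on_boundary[of 1] by eventually_elim (simp add: exp_path_def)
  then show "(LINT z|LT.doleans 1. exp_path x y z) = lateral1 y"
    unfolding lateral1_def by (intro integral_cong_AE) simp_all
  have "AE z in LT.doleans 2. exp_path x y z = exp (x * complex_of_real (Gc 1 (snd z) (fst z)))"
    using AE_doleans_on_boundary[of 2] by eventually_elim (simp add: exp_path_def)
  then show "(LINT z|LT.doleans 2. exp_path x y z) = lateral2 x"
    unfolding lateral2_def by (intro integral_cong_AE) simp_all
qed

lemma measurable_Gc_doleans [measurable]:
  "(\<lambda>z. Gc j (snd z) (fst z)) \<in> borel_measurable (LT.doleans i)"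
  by measurable

lemma lateral_regular:
  shows "continuous_on {y. Re y \<le> 0} lateral1" "continuous_on {y. Re y \<le> 0} lateral2"
    and "lateral1 holomorphic_on {y. Re y < 0}" "lateral2 holomorphic_on {y. Re y < 0}"
    and "\<exists>B. \<forall>y. Re y \<le> 0 \<longrightarrow> cmod (lateral1 y) \<le> B" "\<exists>B. \<forall>y. Re y \<le> 0 \<longrightarrow> cmod (lateral2 y) \<le> B"
proof -
  have ae: "AE z in LT.doleans i. 0 \<le> Gc j (snd z) (fst z)" for i j using Gc_nonneg by simp
  note hyps = finite_measure_LT measurable_Gc_doleans ae
  show "continuous_on {y. Re y \<le> 0} lateral1" "continuous_on {y. Re y \<le> 0} lateral2"
    unfolding lateral1_def[abs_def] lateral2_def[abs_def] by (intro continuous_on_integral_exp hyps)+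
  show "lateral1 holomorphic_on {y. Re y < 0}" "lateral2 holomorphic_on {y. Re y < 0}"
    unfolding lateral1_def[abs_def] lateral2_def[abs_def] by (intro holomorphic_integral_exp hyps)+
  show "\<exists>B. \<forall>y. Re y \<le> 0 \<longrightarrow> cmod (lateral1 y) \<le> B" "\<exists>B. \<forall>y. Re y \<le> 0 \<longrightarrow> cmod (lateral2 y) \<le> B"
    unfolding lateral1_def lateral2_def using norm_integral_exp_le[OF hyps] by blast+
qed

lemma lateral1_real: "lateral1 (complex_of_real t) \<in> \<real>"
proof -
  have "lateral1 (complex_of_real t) = complex_of_real (LINT z|LT.doleans 1. exp (t * Gc 2 (snd z) (fst z)))"
    unfolding lateral1_def by (simp add: exp_of_real flip: of_real_mult integral_complex_of_real)
  then show ?thesis by simp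
qed

text \<open>
  For imaginary \<open>s\<close> the real parts of \<open>x(s)\<close> and \<open>y(s)\<close> both equal \<open>- 2 b\<^sup>2\<close>, and the interior
  coefficient of the adjoint relation vanishes. The common factor \<open>2 s\<close> of the boundary
  coefficients is divided out.
\<close>

lemma functional_equation:
  fixes s :: complex
  assumes b: "b \<noteq> 0" and s: "s = \<i> * complex_of_real b"
  shows "complex_of_real (1 + r1) * (s - complex_of_real (s1 r1 \<mu>1 \<mu>2)) * lateral1 (2 * s * (s - complex_of_real \<mu>1)) +
         complex_of_real (1 + r2) * (s - complex_of_real (s2 r2 \<mu>1 \<mu>2)) * lateral2 (2 * s * (s + complex_of_real \<mu>2)) = 0"
proof -
  define y where "y = 2 * s * (s - complex_of_real \<mu>1)"
  define x where "x = 2 * s * (s + complex_of_real \<mu>2)"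
  have \<mu>2: "\<mu>2 = 1 - \<mu>1" using drift by simp
  have Re: "Re x = - (2 * b\<^sup>2)" "Re y = - (2 * b\<^sup>2)" by (simp_all add: x_def y_def s power2_eq_square)
  have K: "(x - y)\<^sup>2 / 2 - complex_of_real \<mu>1 * x - complex_of_real \<mu>2 * y = 0"
    unfolding x_def y_def \<mu>2 by (simp add: field_simps power2_eq_square)
  have e1: "x + complex_of_real r1 * y = 2 * s * ((1 + complex_of_real r1) * (s - complex_of_real (s1 r1 \<mu>1 \<mu>2)))"
  proof -
    have "(1 + r1) * s1 r1 \<mu>1 \<mu>2 = r1 * \<mu>1 - \<mu>2" using r1 by (simp add: s1_def)
    then have "complex_of_real ((1 + r1) * s1 r1 \<mu>1 \<mu>2) = complex_of_real (r1 * \<mu>1 - \<mu>2)" by (rule arg_cong)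
    then have F: "(1 + complex_of_real r1) * (s - complex_of_real (s1 r1 \<mu>1 \<mu>2)) = (1 + complex_of_real r1) * s - (complex_of_real r1 * complex_of_real \<mu>1 - complex_of_real \<mu>2)"
      by (simp add: right_diff_distrib)
    show ?thesis unfolding F x_def y_def by (simp add: algebra_simps)
  qed
  have e2: "complex_of_real r2 * x + y = 2 * s * ((1 + complex_of_real r2) * (s - complex_of_real (s2 r2 \<mu>1 \<mu>2)))"
  proof -
    have "(1 + r2) * s2 r2 \<mu>1 \<mu>2 = \<mu>1 - r2 * \<mu>2" using r2 by (simp add: s2_def)
    then have "complex_of_real ((1 + r2) * s2 r2 \<mu>1 \<mu>2) = complex_of_real (\<mu>1 - r2 * \<mu>2)" by (rule arg_cong)
    then have F: "(1 + complex_of_real r2) * (s - complex_of_real (s2 r2 \<mu>1 \<mu>2)) = (1 + complex_of_real r2) * s - (complex_of_real \<mu>1 - complex_of_real r2 * complex_of_real \<mu>2)"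
      by (simp add: right_diff_distrib)
    show ?thesis unfolding F x_def y_def by (simp add: algebra_simps)
  qed
  have "2 * s * ((1 + complex_of_real r1) * (s - complex_of_real (s1 r1 \<mu>1 \<mu>2)) * lateral1 y +
      (1 + complex_of_real r2) * (s - complex_of_real (s2 r2 \<mu>1 \<mu>2)) * lateral2 x) = 0"
    using basic_adjoint_relation[OF Re] unfolding K integral_exp_path_lateral e1 e2
    by (simp add: algebra_simps)
  then show ?thesis using b s by (simp add: x_def y_def)
qed

text \<open>
  The set function that defines \<open>nu1\<close> is the image of the Doleans measure of \<open>L\<^sub>1\<close>, restricted to
  \<open>G\<^sub>2 > 0\<close>, under \<open>G\<^sub>2\<close>. In particular it is a measure, and the restriction loses no mass since
  the corner is not charged.
\<close>

lemma phi1_eq_lateral1: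
  assumes T: "T = 2"
  shows "phi1 M G L y = lateral1 y"
proof -
  let ?P = "LT.doleans 1" and ?B = "restrict_space borel {0 :: real<..}"
  define Y where "Y z = Gc 2 (snd z) (fst z)" for z
  have Y [measurable]: "Y \<in> borel_measurable ?P" unfolding Y_def[abs_def] by measurable
  define S where "S = {z \<in> space ?P. 0 < Y z}"
  have S [measurable]: "S \<in> sets ?P" unfolding S_def by measurable
  define N where "N = distr (restrict_space ?P S) ?B Y"
  have YB: "Y \<in> measurable (restrict_space ?P S) ?B"
    by (rule measurable_restrict_space2) (auto simp: S_def space_restrict_space intro: measurable_restrict_space1[OF Y])
  have sets_N: "sets N = sets ?B" and space_N: "space N = {0<..}"
    by (simp_all add: N_def space_restrict_space)
  have em: "emeasure N A = (\<integral>\<^sup>+\<omega>. (\<integral>\<^sup>+t\<in>{0..2}. indicator A (G t \<omega> $ 2) \<partial>path_measure (\<lambda>t. L t \<omega> $ 1)) \<partial>M)"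
    if A: "A \<in> sets ?B" for A
  proof -
    from A have AB [measurable]: "A \<in> sets borel" and A0: "A \<subseteq> {0<..}"
      by (auto simp: sets_restrict_space_iff)
    have "emeasure N A = emeasure (restrict_space ?P S) (Y -` A \<inter> space (restrict_space ?P S))"
      unfolding N_def by (rule emeasure_distr[OF YB A])
    also have "Y -` A \<inter> space (restrict_space ?P S) = Y -` A \<inter> space ?P"
      using A0 by (auto simp: S_def space_restrict_space)
    also have "emeasure (restrict_space ?P S) (Y -` A \<inter> space ?P) = emeasure ?P (Y -` A \<inter> space ?P)"
      using A0 S by (intro emeasure_restrict_space) (auto simp: S_def)
    also have "\<dots> = (\<integral>\<^sup>+z. indicator A (Y z) \<partial>?P)"
      using measurable_sets[OF Y AB]
      by (subst nn_integral_indicator[symmetric], simp, intro nn_integral_cong) (simp add: indicator_def)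
    also have "\<dots> = (\<integral>\<^sup>+\<omega>. \<integral>\<^sup>+t. indicator A (Gc 2 t \<omega>) \<partial>LT.stieltjes 1 \<omega> \<partial>M)"
      unfolding Y_def by (subst LT.nn_integral_doleans) simp_all
    also have "\<dots> = (\<integral>\<^sup>+\<omega>. (\<integral>\<^sup>+t\<in>{0..2}. indicator A (G t \<omega> $ 2) \<partial>path_measure (\<lambda>t. L t \<omega> $ 1)) \<partial>M)"
    proof (rule nn_integral_cong_AE, use AE_good in eventually_elim)
      case (elim \<omega>)
      have reg: "regular \<omega>" using elim by (rule good_regular)
      have [measurable]: "(\<lambda>t. Gc 2 t \<omega>) \<in> borel_measurable borel"
        using continuous_Gc by (rule borel_measurable_continuous_onI)
      have "LT.stieltjes 1 \<omega> = interval_measure (\<lambda>t. L (max 0 (min T t)) \<omega> $ 1)"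
        unfolding LT.stieltjes_def using elim by (simp add: Lc_def clip_def)
      then have "(\<integral>\<^sup>+t. indicator A (Gc 2 t \<omega>) \<partial>LT.stieltjes 1 \<omega>) =
          (\<integral>\<^sup>+t\<in>{0..T}. indicator A (Gc 2 t \<omega>) \<partial>path_measure (\<lambda>t. L t \<omega> $ 1))"
        using horizon regularD(2,8)[OF reg]
        by (subst nn_integral_path_measure_upto) (auto intro!: continuous_intros)
      also have "\<dots> = (\<integral>\<^sup>+t\<in>{0..2}. indicator A (G t \<omega> $ 2) \<partial>path_measure (\<lambda>t. L t \<omega> $ 1))"
      proof -
        have eq: "{0..2 :: real} = {0..T}" using T by simp
        show ?thesis
          unfolding eq using elim clip_id by (intro nn_integral_cong) (simp add: indicator_def Gc_def)
      qed
      finally show ?case .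
    qed
    finally show ?thesis .
  qed
  have "nu1 M G L = measure_of {0<..} (sets ?B) (emeasure N)"
    unfolding nu1_def
  proof (rule measure_of_eq)
    show "sets ?B \<subseteq> Pow {0<..}" by (auto simp: sets_restrict_space)
    fix A assume "A \<in> sigma_sets {0<..} (sets ?B)"
    then have "A \<in> sets ?B"
      using sets.sigma_sets_eq[of ?B] by (simp add: space_restrict_space)
    from em[OF this] show "(\<integral>\<^sup>+\<omega>. (\<integral>\<^sup>+t\<in>{0..2}. indicator A (G t \<omega> $ 2) \<partial>path_measure (\<lambda>t. L t \<omega> $ 1)) \<partial>M) = emeasure N A" ..
  qed
  also have "\<dots> = N" using measure_of_of_measure[of N] by (simp add: sets_N space_N)
  finally have nu: "nu1 M G L = N" .
  have "phi1 M G L y = (LINT v|N. exp (y * complex_of_real v))" by (simp add: phi1_def nu)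
  also have "\<dots> = (LINT z|restrict_space ?P S. exp (y * complex_of_real (Y z)))"
    unfolding N_def by (rule integral_distr[OF YB]) (rule measurable_restrict_space1, simp)
  also have "\<dots> = (LINT z|?P. indicator S z *\<^sub>R exp (y * complex_of_real (Y z)))"
    by (rule integral_restrict_space) (use S in simp)
  also have "\<dots> = lateral1 y"
    unfolding lateral1_def
  proof (rule integral_cong_AE)
    show "AE z in ?P. indicator S z *\<^sub>R exp (y * complex_of_real (Y z)) = exp (y * complex_of_real (Gc 2 (snd z) (fst z)))"
      using AE_doleans_on_boundary[of 1] AE_doleans_not_corner[of 1] AE_space[of ?P]
    proof eventually_elim
      case (elim z)
      then have "z \<in> S" by (simp add: S_def Y_def)
      then show ?case by (simp add: Y_def)
    qed
  qed simp_all
  finally show ?thesis .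
qed

end

section \<open>Auxiliary facts on entire functions\<close>

lemma entire_factor_zeros:
  fixes A :: "complex \<Rightarrow> complex"
  assumes "finite Z" and "A holomorphic_on UNIV" and "\<And>z. z \<in> Z \<Longrightarrow> A z = 0"
  shows "\<exists>B. B holomorphic_on UNIV \<and> (\<forall>s. A s = B s * (\<Prod>z\<in>Z. s - z))"
  using assms
proof (induction Z arbitrary: A rule: finite_induct)
  case empty
  then show ?case by (intro exI[of _ A]) simp
next
  case (insert a Z)
  define A' where "A' = (\<lambda>s. if s = a then deriv A a else (A s - A a) / (s - a))"
  have "A' holomorphic_on UNIV"
    unfolding A'_def using insert.prems(1) by (rule pole_lemma) simp
  moreover have A: "A s = A' s * (s - a)" for s
    using insert.prems(2)[of a] by (simp add: A'_def)
  moreover have "A' z = 0" if "z \<in> Z" for z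
    using A[of z] insert.prems(2)[of z] that insert.hyps(2) by auto
  ultimately obtain B where B: "B holomorphic_on UNIV" "\<And>s. A' s = B s * (\<Prod>z\<in>Z. s - z)"
    using insert.IH[of A'] by blast
  show ?case
  proof (intro exI[of _ B] conjI allI)
    show "A s = B s * (\<Prod>z\<in>insert a Z. s - z)" for s
      unfolding A B(2) prod.insert[OF insert.hyps] by (simp only: mult_ac)
  qed (rule B(1))
qed

text \<open>
  Liouville's theorem for the punctured plane: \<open>w h(w)\<close> extends to an entire function that grows at most
  quadratically, hence is a quadratic polynomial; the two limits leave only its linear term.
\<close>

lemma punctured_plane_constant:
  assumes holo: "h holomorphic_on - {0}"
    and zero: "((\<lambda>w. w * h w) \<longlongrightarrow> 0) (at 0)"
    and infinity: "((\<lambda>w. h w / w) \<longlongrightarrow> 0) at_infinity"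
  shows "\<exists>C. \<forall>w. w \<noteq> 0 \<longrightarrow> h w = C"
proof -
  define k where "k w = (if w = 0 then 0 else w * h w)" for w
  have "k holomorphic_on - {0}"
  proof (rule holomorphic_transform)
    show "(\<lambda>w. w * h w) holomorphic_on - {0}" by (intro holomorphic_intros holo)
  qed (simp add: k_def)
  then have holo_k: "k holomorphic_on UNIV - {0}" by (simp only: Compl_eq_Diff_UNIV)
  have lim: "(k \<longlongrightarrow> k 0) (at 0)"
  proof (rule Lim_transform_eventually)
    show "((\<lambda>w. w * h w) \<longlongrightarrow> k 0) (at 0)" using zero by (simp add: k_def)
    show "\<forall>\<^sub>F w in at 0. w * h w = k w" by (simp add: eventually_at_filter k_def)
  qed
  have k: "k holomorphic_on UNIV"
  proof (rule no_isolated_singularity'[OF _ holo_k])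
    show "(k \<longlongrightarrow> k z) (at z within UNIV)" if "z \<in> {0}" for z using that lim by simp
  qed simp_all
  have "\<forall>\<^sub>F w in at_infinity. dist (h w / w) 0 < 1" using infinity by (rule tendstoD) simp
  then obtain R where R': "\<And>w. R \<le> cmod w \<Longrightarrow> dist (h w / w) 0 < 1"
    unfolding eventually_at_infinity by blast
  have R: "cmod (h w / w) \<le> 1" if "R \<le> cmod w" for w
    using R'[OF that] by (simp only: dist_norm diff_zero less_imp_le)
  have liouville: "k \<xi> = (\<Sum>j\<le>2. (deriv ^^ j) k 0 / fact j * \<xi> ^ j)" for \<xi>
  proof (rule Liouville_polynomial[OF k])
    fix w :: complex assume "max R 1 \<le> cmod w"
    then have w: "R \<le> cmod w" "w \<noteq> 0" by auto
    have "k w = w\<^sup>2 * (h w / w)" using w by (simp add: k_def power2_eq_square)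
    then have "cmod (k w) = (cmod w)\<^sup>2 * cmod (h w / w)" by (simp add: norm_mult norm_power norm_divide)
    also have "\<dots> \<le> (cmod w)\<^sup>2 * 1" using R[OF w(1)] by (intro mult_left_mono) auto
    finally show "cmod (k w) \<le> 1 * cmod w ^ 2" by simp
  qed
  define c where "c j = (deriv ^^ j) k 0 / fact j" for j
  have poly: "k w = c 0 + c 1 * w + c 2 * w\<^sup>2" for w
    using liouville[of w] by (simp only: c_def[symmetric]) (simp add: numeral_2_eq_2)
  have "c 0 = 0" using poly[of 0] by (simp add: k_def)
  have h: "h w = c 1 + c 2 * w" if "w \<noteq> 0" for w
  proof -
    have "w * h w = w * (c 1 + c 2 * w)"
      using poly[of w] that \<open>c 0 = 0\<close> by (simp add: k_def power2_eq_square algebra_simps)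
    then show ?thesis using that by simp
  qed
  have inf: "((\<lambda>w. c 1 / w + c 2) \<longlongrightarrow> 0 + c 2) at_infinity"
    by (intro tendsto_intros tendsto_divide_0[OF tendsto_const] filterlim_ident)
  have "((\<lambda>w. h w / w) \<longlongrightarrow> 0 + c 2) at_infinity"
  proof (rule Lim_transform_eventually[OF inf])
    show "\<forall>\<^sub>F w in at_infinity. c 1 / w + c 2 = h w / w"
      unfolding eventually_at_infinity
    proof (intro exI allI impI)
      fix w :: complex assume "1 \<le> cmod w"
      then have "w \<noteq> 0" by auto
      then show "c 1 / w + c 2 = h w / w" by (simp add: h field_simps)
    qed
  qed
  then have "c 2 = 0"
    using tendsto_unique[OF _ infinity] by (simp add: trivial_limit_at_infinity)
  then show ?thesis using h by (intro exI[of _ "c 1"]) simp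
qed

lemma cos_csqrt_square: "cos (c * csqrt (u\<^sup>2)) = cos (c * u)"
proof -
  have "csqrt (u\<^sup>2) = u \<or> csqrt (u\<^sup>2) = - u"
    using power2_csqrt[of "u\<^sup>2"] by (simp only: power2_eq_iff)
  then show ?thesis by auto
qed

text \<open>
  Cosine is even, so the branch of the square root does not matter: away from \<open>0\<close> there is always a
  holomorphic branch, and \<open>0\<close> is a removable singularity by continuity.
\<close>

lemma holomorphic_cos_csqrt: "(\<lambda>w. cos (c * csqrt w)) holomorphic_on UNIV"
proof -
  let ?f = "\<lambda>w. cos (c * csqrt w)"
  have diff: "?f field_differentiable at w" if "w \<noteq> 0" for w
  proof (cases "w \<in> \<real>\<^sub>\<le>\<^sub>0")
    case False
    have "?f holomorphic_on - \<real>\<^sub>\<le>\<^sub>0" by (intro holomorphic_intros) auto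
    then show ?thesis
      by (rule holomorphic_on_imp_differentiable_at) (use False in \<open>auto intro: open_Compl closed_nonpos_Reals_complex\<close>)
  next
    case True
    (* off the positive axis the other square root i * csqrt (- w) is holomorphic *)
    have "(\<lambda>w. cos (c * (\<i> * csqrt (- w)))) holomorphic_on - \<real>\<^sub>\<ge>\<^sub>0"
      by (intro holomorphic_intros) (auto simp: complex_nonpos_Reals_iff complex_nonneg_Reals_iff)
    moreover have "cos (c * (\<i> * csqrt (- w))) = ?f w" for w
    proof -
      have "(\<i> * csqrt (- w))\<^sup>2 = w" by (simp only: power_mult_distrib power2_csqrt i_squared) simp
      with cos_csqrt_square[of c "\<i> * csqrt (- w)"] show ?thesis by (simp only:)
    qed
    ultimately have "?f holomorphic_on - \<real>\<^sub>\<ge>\<^sub>0" by (simp only:)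
    moreover have "w \<in> - \<real>\<^sub>\<ge>\<^sub>0"
    proof -
      have "Re w \<le> 0" "Im w = 0" using True by (simp_all add: complex_nonpos_Reals_iff)
      with that have "Re w < 0" by (auto simp: complex_eq_iff)
      then show ?thesis by (simp add: complex_nonneg_Reals_iff)
    qed
    ultimately show ?thesis
      using open_Compl[OF closed_nonneg_Reals_complex] by (intro holomorphic_on_imp_differentiable_at)
  qed
  have "?f holomorphic_on UNIV - {0}"
    by (rule holomorphic_onI, rule field_differentiable_at_within, rule diff) simp
  have lim: "(?f \<longlongrightarrow> ?f 0) (at 0)"
  proof -
    have "((\<lambda>w :: complex. csqrt w) \<longlongrightarrow> 0) (at 0)"
    proof (rule tendsto_norm_zero_cancel)
      have "((\<lambda>w :: complex. sqrt (cmod w)) \<longlongrightarrow> sqrt (cmod 0)) (at 0)" by (intro tendsto_intros)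
      then show "((\<lambda>w. cmod (csqrt w)) \<longlongrightarrow> 0) (at 0)" by simp
    qed
    then have "(?f \<longlongrightarrow> cos (c * 0)) (at 0)" by (intro tendsto_intros)
    then show ?thesis by simp
  qed
  show ?thesis
  proof (rule no_isolated_singularity'[where K="{0}"])
    show "?f holomorphic_on UNIV - {0}" by fact
    show "(?f \<longlongrightarrow> ?f z) (at z within UNIV)" if "z \<in> {0}" for z using that lim by simp
  qed simp_all
qed

lemma norm_cos_le_exp: "cmod (cos z) \<le> exp \<bar>Im z\<bar>"
proof -
  have "cmod (cos z) \<le> (cmod (exp (\<i> * z)) + cmod (exp (- \<i> * z))) / 2"
    using norm_triangle_ineq[of "exp (\<i> * z)" "exp (- \<i> * z)"] by (simp add: cos_exp_eq norm_divide)
  also have "\<dots> \<le> (exp \<bar>Im z\<bar> + exp \<bar>Im z\<bar>) / 2"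
    by (intro divide_right_mono add_mono) auto
  finally show ?thesis by simp
qed

section \<open>The functional equation in a strip\<close>

lemma continuous_zero_extend:
  fixes u :: "complex \<Rightarrow> complex"
  assumes cont: "continuous_on {s. Re s = c} u" and zero: "\<And>s. Re s = c \<Longrightarrow> Im s \<noteq> 0 \<Longrightarrow> u s = 0"
    and s: "Re s = c"
  shows "u s = 0"
proof (cases "Im s = 0")
  case True
  define v where "v n = s + \<i> * complex_of_real (1 / real (Suc n))" for n
  have "v \<longlonglongrightarrow> s + \<i> * complex_of_real 0"
    unfolding v_def by (intro tendsto_intros LIMSEQ_Suc lim_1_over_n)
  then have "v \<longlonglongrightarrow> s" by simp
  moreover have "Re (v n) = c" "Im (v n) \<noteq> 0" for n using s True by (simp_all add: v_def)
  ultimately have "(\<lambda>n. u (v n)) \<longlonglongrightarrow> u s"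
    using s by (intro continuous_on_tendsto_compose[OF cont]) auto
  moreover have "u (v n) = 0" for n using zero \<open>Re (v n) = c\<close> \<open>Im (v n) \<noteq> 0\<close> by blast
  ultimately have "(\<lambda>n. 0) \<longlonglongrightarrow> u s" by simp
  then show ?thesis using LIMSEQ_unique[OF tendsto_const] by metis
qed (use zero s in blast)

text \<open>
  The analytic data of the problem: \<open>f\<close> and \<open>g\<close> stand for the two Laplace transforms, \<open>k1\<close> and
  \<open>k2\<close> for \<open>1 + r\<^sub>1\<close> and \<open>1 + r\<^sub>2\<close>, and \<open>a\<close> for \<open>s\<^sub>1\<close>. The integer \<open>n\<close> replaces the difference
  \<open>s\<^sub>2 - s\<^sub>1\<close>.
\<close>

locale strip_problem =
  fixes k1 k2 \<mu>1 \<mu>2 a :: real and n :: nat and f g :: "complex \<Rightarrow> complex" and B :: real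
  assumes k1: "k1 > 0" and \<mu>1: "\<mu>1 > 0" and \<mu>2: "\<mu>2 > 0" and \<mu>: "\<mu>1 + \<mu>2 = 1" and n: "n \<ge> 1"
    and cont_f: "continuous_on {y. Re y \<le> 0} f" and cont_g: "continuous_on {y. Re y \<le> 0} g"
    and holo_f: "f holomorphic_on {y. Re y < 0}" and holo_g: "g holomorphic_on {y. Re y < 0}"
    and bound_f: "\<And>y. Re y \<le> 0 \<Longrightarrow> cmod (f y) \<le> B" and bound_g: "\<And>y. Re y \<le> 0 \<Longrightarrow> cmod (g y) \<le> B"
    and equation: "\<And>b s. b \<noteq> 0 \<Longrightarrow> s = \<i> * complex_of_real b \<Longrightarrow>
      complex_of_real k1 * (s - complex_of_real a) * f (2 * s * (s - complex_of_real \<mu>1)) +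
      complex_of_real k2 * (s - complex_of_real a - of_nat n) * g (2 * s * (s + complex_of_real \<mu>2)) = 0"
begin

abbreviation "\<alpha> \<equiv> complex_of_real a"
abbreviation "m1 \<equiv> complex_of_real \<mu>1"
abbreviation "m2 \<equiv> complex_of_real \<mu>2"

definition ys :: "complex \<Rightarrow> complex" where "ys s = 2 * s * (s - m1)"
definition xs :: "complex \<Rightarrow> complex" where "xs s = 2 * s * (s + m2)"
definition D :: "complex \<Rightarrow> complex" where
  "D s = cos (complex_of_real pi * (2 * s - m1)) - cos (complex_of_real (pi * (\<mu>1 - 2 * a)))"
definition P :: "complex \<Rightarrow> complex" where
  "P s = (\<Prod>k=1..n. 2 * (s - \<alpha> - of_nat k) * (s + \<alpha> + of_nat k - m1))"

lemma \<mu>2_eq: "\<mu>2 = 1 - \<mu>1"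
  using \<mu> by simp

text \<open>
  The product form shows the zeros of \<open>D\<close>: the two lattices \<open>a + \<int>\<close> and \<open>\<mu>1 - a + \<int>\<close>. They are
  counted separately, since the lattices may coincide and the zeros are then double.
\<close>

lemma D_product: "D s = - 2 * sin (complex_of_real pi * (s - \<alpha>)) * sin (complex_of_real pi * (s + \<alpha> - m1))"
proof -
  have "cos (complex_of_real pi * (2 * s - m1)) - cos (complex_of_real pi * (m1 - 2 * \<alpha>)) =
     2 * sin ((complex_of_real pi * (2 * s - m1) + complex_of_real pi * (m1 - 2 * \<alpha>)) / 2)
       * sin ((complex_of_real pi * (m1 - 2 * \<alpha>) - complex_of_real pi * (2 * s - m1)) / 2)"
    by (rule cos_diff_cos)
  also have "(complex_of_real pi * (2 * s - m1) + complex_of_real pi * (m1 - 2 * \<alpha>)) / 2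
      = complex_of_real pi * (s - \<alpha>)" by (simp add: field_simps)
  also have "(complex_of_real pi * (m1 - 2 * \<alpha>) - complex_of_real pi * (2 * s - m1)) / 2
      = - (complex_of_real pi * (s + \<alpha> - m1))" by (simp add: field_simps)
  finally show ?thesis by (simp add: D_def cos_of_real)
qed

lemma D_periodic: "D (s + 1) = D s"
proof -
  have "complex_of_real pi * (2 * (s + 1) - m1) = complex_of_real pi * (2 * s - m1) + 2 * complex_of_real pi"
    by (simp add: algebra_simps)
  then show ?thesis unfolding D_def by (simp only: cos_add) (simp add: cos_of_real sin_of_real cos_double)
qed

lemma sin_pi_of_int: "sin (complex_of_real pi * of_int j) = 0"
proof -
  have "complex_of_real pi * of_int j = complex_of_real (of_int j * pi)" by simp
  moreover have "sin (of_int j * pi) = 0" by (simp add: sin_times_pi_eq_0)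
  ultimately show ?thesis by (simp only: sin_of_real of_real_0)
qed

text \<open>
  The \<open>n + 1\<close> zeros of \<open>(s - a) P(s)\<close> in the first lattice and the \<open>n\<close> zeros in the second are
  divided out of one sine each.
\<close>

lemma exists_quotient: "\<exists>E. E holomorphic_on UNIV \<and> (\<forall>s. D s = E s * ((s - \<alpha>) * P s))"
proof -
  let ?A1 = "\<lambda>s. sin (complex_of_real pi * (s - \<alpha>))" and ?A2 = "\<lambda>s. sin (complex_of_real pi * (s + \<alpha> - m1))"
  let ?z1 = "\<lambda>k::nat. \<alpha> + of_nat k" and ?z2 = "\<lambda>k::nat. m1 - \<alpha> - of_nat k"
  have A1: "?A1 holomorphic_on UNIV" and A2: "?A2 holomorphic_on UNIV" by (intro holomorphic_intros)+
  have zeros1: "?A1 z = 0" if "z \<in> ?z1 ` {0..n}" for z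
    using that sin_pi_of_int[of "int k" for k] by auto
  obtain B1 where B1: "B1 holomorphic_on UNIV" "\<And>s. ?A1 s = B1 s * (\<Prod>z\<in>?z1 ` {0..n}. s - z)"
    using entire_factor_zeros[OF finite_imageI[OF finite_atLeastAtMost] A1 zeros1] by blast
  have zeros2: "?A2 z = 0" if "z \<in> ?z2 ` {1..n}" for z
  proof -
    from that obtain k where "z = ?z2 k" by auto
    then have "?A2 z = sin (complex_of_real pi * of_int (- int k))" by simp
    then show ?thesis by (simp only: sin_pi_of_int)
  qed
  obtain B2 where B2: "B2 holomorphic_on UNIV" "\<And>s. ?A2 s = B2 s * (\<Prod>z\<in>?z2 ` {1..n}. s - z)"
    using entire_factor_zeros[OF finite_imageI[OF finite_atLeastAtMost] A2 zeros2] by blast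
  have p1: "(\<Prod>z\<in>?z1 ` {0..n}. s - z) = (s - \<alpha>) * (\<Prod>k=1..n. s - \<alpha> - of_nat k)" for s
  proof -
    have "(\<Prod>z\<in>?z1 ` {0..n}. s - z) = (\<Prod>k=0..n. s - ?z1 k)"
      by (subst prod.reindex) (auto simp: inj_on_def)
    also have "\<dots> = (s - \<alpha>) * (\<Prod>k=1..n. s - \<alpha> - of_nat k)"
      by (simp add: prod.atLeast_Suc_atMost diff_diff_add)
    finally show ?thesis .
  qed
  have p2: "(\<Prod>z\<in>?z2 ` {1..n}. s - z) = (\<Prod>k=1..n. s + \<alpha> + of_nat k - m1)" for s
    by (subst prod.reindex) (auto simp: inj_on_def algebra_simps)
  have p3: "P s = 2 ^ n * (\<Prod>k=1..n. s - \<alpha> - of_nat k) * (\<Prod>k=1..n. s + \<alpha> + of_nat k - m1)" for s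
    unfolding P_def prod.distrib by simp
  show ?thesis
  proof (intro exI[of _ "\<lambda>s. - 2 / 2 ^ n * (B1 s * B2 s)"] conjI allI)
    show "(\<lambda>s. - 2 / 2 ^ n * (B1 s * B2 s)) holomorphic_on UNIV"
      by (intro holomorphic_intros B1(1) B2(1)) auto
    show "D s = - 2 / 2 ^ n * (B1 s * B2 s) * ((s - \<alpha>) * P s)" for s
      unfolding D_product B1(2) B2(2) p1 p2 p3 by simp
  qed
qed

definition E :: "complex \<Rightarrow> complex" where
  "E = (SOME E. E holomorphic_on UNIV \<and> (\<forall>s. D s = E s * ((s - \<alpha>) * P s)))"

lemma E: "E holomorphic_on UNIV" "D s = E s * ((s - \<alpha>) * P s)"
  using someI_ex[OF exists_quotient] unfolding E_def[symmetric] by (rule conjunct1, elim conjE allE)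

text \<open>
  The continuation of \<open>k1 (s - a) f(y(s))\<close> from \<open>0 \<le> Re s \<le> \<mu>1\<close> to \<open>- \<mu>2 \<le> Re s \<le> \<mu>1\<close> by means of
  the functional equation. The factor \<open>s - a\<close> is kept because \<open>a\<close> may lie in the left half of the
  strip.
\<close>

definition glued :: "complex \<Rightarrow> complex" where
  "glued s = (if 0 \<le> Re s then complex_of_real k1 * (s - \<alpha>) * f (ys s)
     else - (complex_of_real k2 * (s - \<alpha> - of_nat n) * g (xs s)))"

lemma Re_ys_le: "0 \<le> Re s \<Longrightarrow> Re s \<le> \<mu>1 \<Longrightarrow> Re (ys s) \<le> 0"
  and Re_ys_less: "0 < Re s \<Longrightarrow> Re s < \<mu>1 \<Longrightarrow> Re (ys s) < 0"
  and Re_xs_le: "- \<mu>2 \<le> Re s \<Longrightarrow> Re s \<le> 0 \<Longrightarrow> Re (xs s) \<le> 0"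
  and Re_xs_less: "- \<mu>2 < Re s \<Longrightarrow> Re s < 0 \<Longrightarrow> Re (xs s) < 0"
proof -
  have y: "Re (ys s) = 2 * (Re s * (Re s - \<mu>1)) - 2 * (Im s)\<^sup>2" and x: "Re (xs s) = 2 * (Re s * (Re s + \<mu>2)) - 2 * (Im s)\<^sup>2"
    by (simp_all add: ys_def xs_def power2_eq_square algebra_simps)
  have sq: "0 \<le> (Im s)\<^sup>2" by simp
  show "Re (ys s) \<le> 0" if "0 \<le> Re s" "Re s \<le> \<mu>1"
    using mult_nonneg_nonpos[of "Re s" "Re s - \<mu>1"] that sq unfolding y by linarith
  show "Re (ys s) < 0" if "0 < Re s" "Re s < \<mu>1"
    using mult_pos_neg[of "Re s" "Re s - \<mu>1"] that sq unfolding y by linarith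
  show "Re (xs s) \<le> 0" if "- \<mu>2 \<le> Re s" "Re s \<le> 0"
    using mult_nonpos_nonneg[of "Re s" "Re s + \<mu>2"] that sq unfolding x by linarith
  show "Re (xs s) < 0" if "- \<mu>2 < Re s" "Re s < 0"
    using mult_neg_pos[of "Re s" "Re s + \<mu>2"] that sq unfolding x by linarith
qed

lemma continuous_ys: "continuous_on S ys" and continuous_xs: "continuous_on S xs"
  unfolding ys_def[abs_def] xs_def[abs_def] by (intro continuous_intros)+

lemma cont_right: "continuous_on {s. 0 \<le> Re s \<and> Re s \<le> \<mu>1} (\<lambda>s. complex_of_real k1 * (s - \<alpha>) * f (ys s))"
  by (intro continuous_intros continuous_on_compose2[OF cont_f continuous_ys]) (auto simp: Re_ys_le)

lemma cont_left: "continuous_on {s. - \<mu>2 \<le> Re s \<and> Re s \<le> 0} (\<lambda>s. - (complex_of_real k2 * (s - \<alpha> - of_nat n) * g (xs s)))"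
  by (intro continuous_intros continuous_on_compose2[OF cont_g continuous_xs]) (auto simp: Re_xs_le)

text \<open>
  The equation is given off the real axis only; continuity supplies the point \<open>s = 0\<close>.
\<close>

lemma matching:
  assumes "Re s = 0"
  shows "complex_of_real k1 * (s - \<alpha>) * f (ys s) = - (complex_of_real k2 * (s - \<alpha> - of_nat n) * g (xs s))"
proof -
  let ?u = "\<lambda>s. complex_of_real k1 * (s - \<alpha>) * f (ys s) - (- (complex_of_real k2 * (s - \<alpha> - of_nat n) * g (xs s)))"
  have "?u s = 0"
  proof (rule continuous_zero_extend[where c=0, OF _ _ assms])
    show "continuous_on {s. Re s = 0} ?u"
      using \<mu>1 \<mu>2 by (intro continuous_on_diff continuous_on_subset[OF cont_right] continuous_on_subset[OF cont_left]) auto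
    fix t assume "Re t = 0" "Im t \<noteq> 0"
    then have "t = \<i> * complex_of_real (Im t)" by (simp add: complex_eq_iff)
    from equation[OF \<open>Im t \<noteq> 0\<close> this] show "?u t = 0" by (simp add: ys_def xs_def)
  qed
  then show ?thesis by (simp only: right_minus_eq)
qed

lemma continuous_glued: "continuous_on {s. - \<mu>2 \<le> Re s \<and> Re s \<le> \<mu>1} glued"
proof -
  have "continuous_on ({s. 0 \<le> Re s \<and> Re s \<le> \<mu>1} \<union> {s. - \<mu>2 \<le> Re s \<and> Re s \<le> 0}) glued"
    unfolding glued_def[abs_def]
    by (intro continuous_on_cases cont_right cont_left closed_Collect_conj closed_Collect_le continuous_intros) (auto simp: matching)
  moreover have "{s. - \<mu>2 \<le> Re s \<and> Re s \<le> \<mu>1} = {s. 0 \<le> Re s \<and> Re s \<le> \<mu>1} \<union> {s. - \<mu>2 \<le> Re s \<and> Re s \<le> 0}"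
    using \<mu>1 \<mu>2 by auto
  ultimately show ?thesis by simp
qed

lemma holomorphic_glued: "glued holomorphic_on {s. - \<mu>2 < Re s \<and> Re s < \<mu>1}"
proof (rule holomorphic_on_paste_across_line[of _ 1 _ 0])
  let ?S = "{s. - \<mu>2 < Re s \<and> Re s < \<mu>1}"
  show "open ?S" by (intro open_Collect_conj open_Collect_less continuous_intros)
  show "glued holomorphic_on (?S \<inter> {z. 1 \<bullet> z < 0})"
  proof (rule holomorphic_transform)
    have "xs holomorphic_on ?S \<inter> {z. 1 \<bullet> z < 0}" unfolding xs_def[abs_def] by (intro holomorphic_intros)
    then have "(g \<circ> xs) holomorphic_on ?S \<inter> {z. 1 \<bullet> z < 0}"
      using holo_g by (rule holomorphic_on_compose_gen) (auto intro: Re_xs_less)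
    then show "(\<lambda>s. - (complex_of_real k2 * (s - \<alpha> - of_nat n) * (g \<circ> xs) s)) holomorphic_on ?S \<inter> {z. 1 \<bullet> z < 0}"
      by (intro holomorphic_intros)
  qed (auto simp: glued_def)
  show "glued holomorphic_on (?S \<inter> {z. 0 < 1 \<bullet> z})"
  proof (rule holomorphic_transform)
    have "ys holomorphic_on ?S \<inter> {z. 0 < 1 \<bullet> z}" unfolding ys_def[abs_def] by (intro holomorphic_intros)
    then have "(f \<circ> ys) holomorphic_on ?S \<inter> {z. 0 < 1 \<bullet> z}"
      using holo_f by (rule holomorphic_on_compose_gen) (auto intro: Re_ys_less)
    then show "(\<lambda>s. complex_of_real k1 * (s - \<alpha>) * (f \<circ> ys) s) holomorphic_on ?S \<inter> {z. 0 < 1 \<bullet> z}"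
      by (intro holomorphic_intros)
  qed (auto simp: glued_def)
  show "continuous_on ?S glued" by (rule continuous_on_subset[OF continuous_glued]) auto
qed simp

definition H :: "complex \<Rightarrow> complex" where "H s = glued s * E s"

lemma continuous_H: "continuous_on {s. - \<mu>2 \<le> Re s \<and> Re s \<le> \<mu>1} H"
  unfolding H_def[abs_def]
  by (intro continuous_on_mult continuous_glued continuous_on_subset[OF holomorphic_on_imp_continuous_on[OF E(1)]]) auto

lemma holomorphic_H: "H holomorphic_on {s. - \<mu>2 < Re s \<and> Re s < \<mu>1}"
  unfolding H_def[abs_def]
  by (intro holomorphic_on_mult holomorphic_glued holomorphic_on_subset[OF E(1)]) auto

text \<open>
  The telescoping identity: \<open>P\<close> satisfies the difference equation that the two reflections impose
  on \<open>f(y(s))\<close>.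
\<close>

lemma P_shift:
  "P (s + 1) * (s + m2 + \<alpha>) * (s - \<alpha> - of_nat n) =
   P s * (s + m2 + \<alpha> + of_nat n) * (s - \<alpha>)"
proof -
  have m2: "m2 = 1 - m1" using \<mu>2_eq by simp
  define Q where "Q j s = (\<Prod>k=1..j. 2 * (s - \<alpha> - of_nat k) * (s + \<alpha> + of_nat k - m1))" for j :: nat and s
  have "Q j (s + 1) * (s + 1 - m1 + \<alpha>) * (s - \<alpha> - of_nat j) =
     Q j s * (s + 1 - m1 + \<alpha> + of_nat j) * (s - \<alpha>)" for j
  proof (induction j)
    case 0
    then show ?case by (simp add: Q_def)
  next
    case (Suc j)
    let ?c = "2 * (s - \<alpha> - of_nat j) * (s + 1 + \<alpha> + of_nat (Suc j) - m1)"
    have 1: "Q (Suc j) (s + 1) = Q j (s + 1) * ?c" by (simp add: Q_def algebra_simps)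
    have 2: "Q (Suc j) s = Q j s * (2 * (s - \<alpha> - of_nat (Suc j)) * (s + \<alpha> + of_nat (Suc j) - m1))"
      by (simp add: Q_def)
    have "Q (Suc j) (s + 1) * (s + 1 - m1 + \<alpha>) * (s - \<alpha> - of_nat (Suc j)) =
       (Q j (s + 1) * (s + 1 - m1 + \<alpha>) * (s - \<alpha> - of_nat j)) *
         (2 * (s + 1 + \<alpha> + of_nat (Suc j) - m1) * (s - \<alpha> - of_nat (Suc j)))"
      unfolding 1 by (simp only: mult_ac)
    also have "\<dots> = (Q j s * (s + 1 - m1 + \<alpha> + of_nat j) * (s - \<alpha>)) *
         (2 * (s + 1 + \<alpha> + of_nat (Suc j) - m1) * (s - \<alpha> - of_nat (Suc j)))"
      unfolding Suc.IH ..
    also have "s + 1 - m1 + \<alpha> + of_nat j = s + \<alpha> + of_nat (Suc j) - m1"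
      by simp
    also have "s + 1 + \<alpha> + of_nat (Suc j) - m1 = s + 1 - m1 + \<alpha> + of_nat (Suc j)"
      by simp
    finally show ?case unfolding 2 by (simp only: mult_ac)
  qed
  moreover have "P s = Q n s" for s by (simp only: P_def Q_def)
  moreover have "s + m2 + \<alpha> = s + 1 - m1 + \<alpha>"
    by (simp add: m2)
  ultimately show ?thesis by (simp only:)
qed

lemma P_nonzero: "Im s \<noteq> 0 \<Longrightarrow> P s \<noteq> 0"
proof -
  assume im: "Im s \<noteq> 0"
  have "s - \<alpha> - of_nat k \<noteq> 0" "s + \<alpha> + of_nat k - m1 \<noteq> 0" for k
    using im by (auto simp: complex_eq_iff)
  then show ?thesis
    by (simp only: P_def prod_zero_iff[OF finite_atLeastAtMost] mult_eq_0_iff) simp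
qed

text \<open>
  With \<open>t = - \<mu>2 - s\<close> on the imaginary axis, \<open>y(s + 1) = y(t)\<close> and \<open>x(s) = x(t)\<close>, so the
  functional equation at \<open>t\<close> links the values of \<open>f\<close> and \<open>g\<close> on the two boundary lines of the
  strip, and \<open>P_shift\<close> absorbs the coefficients.
\<close>

lemma H_periodic:
  assumes "Re s = - \<mu>2"
  shows "H (s + 1) = H s"
proof -
  have "H (s + 1) - H s = 0"
  proof (rule continuous_zero_extend[where c="- \<mu>2" and u="\<lambda>s. H (s + 1) - H s", OF _ _ assms])
    show "continuous_on {s. Re s = - \<mu>2} (\<lambda>s. H (s + 1) - H s)"
      using \<mu>1 \<mu>2 \<mu>
      by (intro continuous_on_diff continuous_on_compose2[OF continuous_H] continuous_on_subset[OF continuous_H] continuous_intros) auto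
    fix s assume re: "Re s = - \<mu>2" and im: "Im s \<noteq> 0"
    let ?k1 = "complex_of_real k1" and ?k2 = "complex_of_real k2"
    define t where "t = - m2 - s"
    have t: "Re t = 0" using re by (simp add: t_def)
    have t_eq: "t = m1 - s - 1" by (simp add: t_def \<mu>2_eq)
    have ys: "ys (s + 1) = ys t" unfolding ys_def t_eq by (simp add: algebra_simps)
    have xs: "xs s = xs t" by (simp add: xs_def t_def algebra_simps)
    have nz: "s - \<alpha> \<noteq> 0" "t - \<alpha> \<noteq> 0" "P s \<noteq> 0" "P (s + 1) \<noteq> 0" "s + 1 - \<alpha> \<noteq> 0"
      using im P_nonzero[of s] P_nonzero[of "s + 1"] by (auto simp: t_def complex_eq_iff)
    have Es: "E s = D s / ((s - \<alpha>) * P s)" using E(2)[of s] nz by simp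
    have Es1: "E (s + 1) = D s / ((s + 1 - \<alpha>) * P (s + 1))" using E(2)[of "s + 1"] nz by (simp add: D_periodic)
    have "H (s + 1) = ?k1 * (s + 1 - \<alpha>) * f (ys t) * E (s + 1)"
      using re \<mu>1 \<mu> by (simp add: H_def glued_def ys)
    also have "\<dots> = D s * (?k1 * f (ys t)) / P (s + 1)"
    proof -
      have "k * u * x * (d / (u * p)) = d * (k * x) / p" if "u \<noteq> 0" "p \<noteq> 0" for k u x d p :: complex
        using that by (simp add: field_simps)
      from this[OF nz(5,4)] show ?thesis unfolding Es1 .
    qed
    also have "?k1 * f (ys t) = - (?k2 * (t - \<alpha> - of_nat n) * g (xs s)) / (t - \<alpha>)"
      using matching[OF t] nz unfolding xs by (simp add: field_simps)
    finally have 1: "H (s + 1) = D s * (- (?k2 * (t - \<alpha> - of_nat n) * g (xs s)) / (t - \<alpha>)) / P (s + 1)" .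
    have 2: "H s = - (?k2 * (s - \<alpha> - of_nat n) * g (xs s)) * (D s / ((s - \<alpha>) * P s))"
      using re \<mu>2 by (simp add: H_def glued_def Es)
    have "P (s + 1) * (t - \<alpha>) * (s - \<alpha> - of_nat n) = P s * (t - \<alpha> - of_nat n) * (s - \<alpha>)"
    proof -
      have e: "s + m2 + \<alpha> = - (t - \<alpha>)" "- (t - \<alpha>) + of_nat n = - (t - \<alpha> - of_nat n)"
        by (simp_all add: t_def)
      from P_shift[of s] show ?thesis
        unfolding e by (simp only: mult_minus_left mult_minus_right neg_equal_iff_equal)
    qed
    then have "(t - \<alpha> - of_nat n) / ((t - \<alpha>) * P (s + 1)) = (s - \<alpha> - of_nat n) / ((s - \<alpha>) * P s)"
      using nz by (simp add: divide_simps mult_ac)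
    then have "D s * ?k2 * g (xs s) * ((t - \<alpha> - of_nat n) / ((t - \<alpha>) * P (s + 1))) = D s * ?k2 * g (xs s) * ((s - \<alpha> - of_nat n) / ((s - \<alpha>) * P s))"
      by simp
    then show "H (s + 1) - H s = 0" unfolding 1 2 by (simp add: mult_ac)
  qed
  then show ?thesis by simp
qed

section \<open>Periodicity and growth\<close>

text \<open>
  One period of \<open>H\<close> glued to the next; width \<open>2\<close> suffices for two overlapping branches of the logarithm.
\<close>

definition K :: "complex \<Rightarrow> complex" where
  "K s = (if Re s \<le> \<mu>1 then H s else H (s - 1))"

lemma holomorphic_K: "K holomorphic_on {s. - \<mu>2 < Re s \<and> Re s < 1 + \<mu>1}"
proof (rule holomorphic_on_paste_across_line[of _ 1 _ \<mu>1])
  let ?S = "{s. - \<mu>2 < Re s \<and> Re s < 1 + \<mu>1}"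
  show "open ?S" by (intro open_Collect_conj open_Collect_less continuous_intros)
  show "K holomorphic_on (?S \<inter> {z. 1 \<bullet> z < \<mu>1})"
  proof (rule holomorphic_transform)
    show "H holomorphic_on ?S \<inter> {z. 1 \<bullet> z < \<mu>1}" by (rule holomorphic_on_subset[OF holomorphic_H]) auto
  qed (auto simp: K_def)
  show "K holomorphic_on (?S \<inter> {z. \<mu>1 < 1 \<bullet> z})"
  proof (rule holomorphic_transform)
    have "(\<lambda>s. s - 1) holomorphic_on ?S \<inter> {z. \<mu>1 < 1 \<bullet> z}" by (intro holomorphic_intros)
    then show "(H \<circ> (\<lambda>s. s - 1)) holomorphic_on ?S \<inter> {z. \<mu>1 < 1 \<bullet> z}"
      using holomorphic_H by (rule holomorphic_on_compose_gen) (use \<mu> in auto)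
  qed (auto simp: K_def)
  have "continuous_on ({s. - \<mu>2 \<le> Re s \<and> Re s \<le> \<mu>1} \<union> {s. \<mu>1 \<le> Re s \<and> Re s \<le> 1 + \<mu>1}) K"
    unfolding K_def[abs_def]
  proof (intro continuous_on_cases continuous_H)
    show "closed {s. - \<mu>2 \<le> Re s \<and> Re s \<le> \<mu>1}" "closed {s. \<mu>1 \<le> Re s \<and> Re s \<le> 1 + \<mu>1}"
      by (intro closed_Collect_conj closed_Collect_le continuous_intros)+
    show "continuous_on {s. \<mu>1 \<le> Re s \<and> Re s \<le> 1 + \<mu>1} (\<lambda>s. H (s - 1))"
      by (intro continuous_on_compose2[OF continuous_H] continuous_intros) (use \<mu> in auto)
    show "\<forall>s. s \<in> {s. - \<mu>2 \<le> Re s \<and> Re s \<le> \<mu>1} \<and> \<not> Re s \<le> \<mu>1 \<or>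
        s \<in> {s. \<mu>1 \<le> Re s \<and> Re s \<le> 1 + \<mu>1} \<and> Re s \<le> \<mu>1 \<longrightarrow> H s = H (s - 1)"
    proof (intro allI impI)
      fix s assume "s \<in> {s. - \<mu>2 \<le> Re s \<and> Re s \<le> \<mu>1} \<and> \<not> Re s \<le> \<mu>1 \<or>
        s \<in> {s. \<mu>1 \<le> Re s \<and> Re s \<le> 1 + \<mu>1} \<and> Re s \<le> \<mu>1"
      then have "Re (s - 1) = - \<mu>2" using \<mu> by auto
      from H_periodic[OF this] show "H s = H (s - 1)" by simp
    qed
  qed
  then show "continuous_on ?S K" by (rule continuous_on_subset) auto
qed simp

lemma norm_P_ge:
  assumes "1 \<le> \<bar>Im s\<bar>"
  shows "(Im s)\<^sup>2 \<le> cmod (P s)"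
proof -
  let ?b = "\<bar>Im s\<bar>"
  have fac: "?b\<^sup>2 \<le> cmod (2 * (s - \<alpha> - of_nat k) * (s + \<alpha> + of_nat k - m1))" for k
  proof -
    define A1 where "A1 = s - \<alpha> - of_nat k"
    define A2 where "A2 = s + \<alpha> + of_nat k - m1"
    have "?b \<le> cmod A1" "?b \<le> cmod A2"
      using abs_Im_le_cmod[of A1] abs_Im_le_cmod[of A2] by (simp_all add: A1_def A2_def)
    then have "?b * ?b \<le> cmod A1 * cmod A2" by (intro mult_mono) auto
    moreover have "0 \<le> cmod A1 * cmod A2" by simp
    moreover have "cmod (2 * A1 * A2) = 2 * (cmod A1 * cmod A2)" by (simp add: norm_mult)
    ultimately show ?thesis unfolding A1_def[symmetric] A2_def[symmetric] power2_eq_square by linarith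
  qed
  have "1 \<le> ?b\<^sup>2" using power_mono[OF assms, of 2] by simp
  then have "?b\<^sup>2 \<le> (?b\<^sup>2) ^ n" using n by (simp add: self_le_power)
  also have "\<dots> = (\<Prod>k=1..n. ?b\<^sup>2)" by simp
  also have "\<dots> \<le> (\<Prod>k=1..n. cmod (2 * (s - \<alpha> - of_nat k) * (s + \<alpha> + of_nat k - m1)))"
    using fac by (intro prod_mono) auto
  also have "\<dots> = cmod (P s)" by (simp only: P_def prod_norm)
  finally show ?thesis by simp
qed

lemma norm_D_le: "cmod (D s) \<le> 2 * exp (2 * pi * \<bar>Im s\<bar>)"
proof -
  have "cmod (D s) \<le> cmod (cos (complex_of_real pi * (2 * s - m1))) + cmod (cos (complex_of_real (pi * (\<mu>1 - 2 * a))))"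
    unfolding D_def by (rule norm_triangle_ineq4)
  also have "\<dots> \<le> exp (2 * pi * \<bar>Im s\<bar>) + exp 0"
    using norm_cos_le_exp[of "complex_of_real pi * (2 * s - m1)"] norm_cos_le_exp[of "complex_of_real (pi * (\<mu>1 - 2 * a))"]
    by (intro add_mono) (auto simp: abs_mult mult_ac)
  also have "\<dots> \<le> 2 * exp (2 * pi * \<bar>Im s\<bar>)" by simp
  finally show ?thesis .
qed

lemma B_nonneg: "0 \<le> B"
  using bound_f[of 0] order_trans[OF norm_ge_zero] by simp

text \<open>
  The factors \<open>s - a\<close> and \<open>s - a - n\<close> are comparable away from the real axis, \<open>D\<close> contributes \<open>exp
  (2 \<pi> |Im s|)\<close>, and \<open>P\<close> divides by at least \<open>(Im s)\<^sup>2\<close>. The last factor is what excludes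
  nonconstant periodic solutions; it comes from \<open>n \<ge> 1\<close>.
\<close>

lemma H_growth:
  "\<exists>C\<ge>0. \<forall>s. - \<mu>2 \<le> Re s \<longrightarrow> Re s \<le> \<mu>1 \<longrightarrow> 1 \<le> \<bar>Im s\<bar> \<longrightarrow>
      cmod (H s) \<le> C * exp (2 * pi * \<bar>Im s\<bar>) / (Im s)\<^sup>2"
proof -
  define A where "A = (\<bar>k1\<bar> + \<bar>k2\<bar> * (1 + real n)) * B"
  have A: "0 \<le> A" using B_nonneg by (simp add: A_def)
  have "cmod (H s) \<le> 2 * A * exp (2 * pi * \<bar>Im s\<bar>) / (Im s)\<^sup>2"
    if re: "- \<mu>2 \<le> Re s" "Re s \<le> \<mu>1" and im: "1 \<le> \<bar>Im s\<bar>" for s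
  proof -
    let ?d = "s - \<alpha>"
    have im0: "Im s \<noteq> 0" using im by auto
    have d: "1 \<le> cmod ?d" using abs_Im_le_cmod[of ?d] im by simp
    then have d0: "?d \<noteq> 0" by auto
    have F: "cmod (glued s) \<le> A * cmod ?d"
    proof (cases "0 \<le> Re s")
      case True
      have "cmod (glued s) = \<bar>k1\<bar> * cmod ?d * cmod (f (ys s))" using True by (simp add: glued_def norm_mult)
      also have "\<dots> \<le> \<bar>k1\<bar> * cmod ?d * B"
        using Re_ys_le[OF True re(2)] by (intro mult_left_mono bound_f) auto
      also have "\<dots> \<le> A * cmod ?d"
      proof -
        have "0 \<le> \<bar>k2\<bar> * (1 + real n) * B * cmod ?d" using B_nonneg by simp
        then show ?thesis by (simp add: A_def algebra_simps)
      qed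
      finally show ?thesis .
    next
      case False
      have "cmod (glued s) = \<bar>k2\<bar> * cmod (?d - of_nat n) * cmod (g (xs s))" using False by (simp add: glued_def norm_mult)
      also have "\<dots> \<le> \<bar>k2\<bar> * ((1 + real n) * cmod ?d) * B"
      proof (intro mult_mono mult_left_mono bound_g)
        have "cmod (?d - of_nat n) \<le> cmod ?d + real n" using norm_triangle_ineq4[of ?d "of_nat n"] by simp
        also have "\<dots> \<le> cmod ?d + real n * cmod ?d" using d mult_left_mono[OF d, of "real n"] by simp
        finally show "cmod (?d - of_nat n) \<le> (1 + real n) * cmod ?d" by (simp add: algebra_simps)
      qed (use False re Re_xs_le[of s] in auto)
      also have "\<dots> \<le> A * cmod ?d"
      proof -
        have "0 \<le> \<bar>k1\<bar> * B * cmod ?d" using B_nonneg by simp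
        then show ?thesis by (simp add: A_def algebra_simps)
      qed
      finally show ?thesis .
    qed
    have P0: "P s \<noteq> 0" by (rule P_nonzero[OF im0])
    then have "E s = D s / (?d * P s)" using E(2)[of s] d0 by simp
    then have "cmod (H s) = cmod (glued s) * (cmod (D s) / (cmod ?d * cmod (P s)))"
      by (simp add: H_def norm_mult norm_divide)
    also have "\<dots> \<le> (A * cmod ?d) * (cmod (D s) / (cmod ?d * cmod (P s)))"
      by (intro mult_right_mono F) auto
    also have "\<dots> = A * (cmod (D s) / cmod (P s))" using d0 by simp
    also have "\<dots> \<le> A * (2 * exp (2 * pi * \<bar>Im s\<bar>) / (Im s)\<^sup>2)"
      using A norm_P_ge[OF im] norm_D_le[of s] im0 by (intro mult_left_mono frac_le) auto
    finally show ?thesis by (simp add: mult_ac)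
  qed
  then show ?thesis using A by (intro exI[of _ "2 * A"]) auto
qed

text \<open>
  In the variable \<open>w = exp (2 \<pi> i (s - m))\<close>, with \<open>m\<close> the midpoint of the strip, \<open>K\<close> becomes a
  function \<open>h\<close> on the punctured plane, because the strip has width \<open>1\<close>. By \<open>H_growth\<close>, \<open>h(w)\<close> is
  \<open>o(1 / |w|)\<close> at \<open>0\<close> and \<open>o(|w|)\<close> at infinity.
\<close>

lemma K_constant: "\<exists>C. \<forall>s. - \<mu>2 < Re s \<longrightarrow> Re s \<le> \<mu>1 \<longrightarrow> K s = C"
proof -
  define m where "m = complex_of_real ((\<mu>1 - \<mu>2) / 2)"
  define \<tau> where "\<tau> = 2 * complex_of_real pi * \<i>"
  have \<tau>: "\<tau> \<noteq> 0" by (simp add: \<tau>_def)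
  define \<sigma> where "\<sigma> w = m + Ln w / \<tau>" for w
  define h where "h w = K (\<sigma> w)" for w
  have Re_div: "Re (z / \<tau>) = Im z / (2 * pi)" and Im_div: "Im (z / \<tau>) = - Re z / (2 * pi)" for z
    by (simp_all add: \<tau>_def Re_divide Im_divide power2_eq_square field_simps)
  have Re_m: "Re m = (\<mu>1 - \<mu>2) / 2" "Im m = 0" by (simp_all add: m_def)
  have half: "(\<mu>1 - \<mu>2) / 2 - 1 / 2 = - \<mu>2" "(\<mu>1 - \<mu>2) / 2 + 1 / 2 = \<mu>1" using \<mu> by (simp_all add: field_simps)
  have strip: "- \<mu>2 < Re (\<sigma> w)" "Re (\<sigma> w) \<le> \<mu>1" "Im (\<sigma> w) = - ln (cmod w) / (2 * pi)" if "w \<noteq> 0" for w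
  proof -
    have "- 1 / 2 < Im (Ln w) / (2 * pi)" "Im (Ln w) / (2 * pi) \<le> 1 / 2"
      using mpi_less_Im_Ln[OF that] Im_Ln_le_pi[OF that] by (simp_all add: field_simps)
    moreover have "Re (\<sigma> w) = (\<mu>1 - \<mu>2) / 2 + Im (Ln w) / (2 * pi)" by (simp add: \<sigma>_def Re_div Re_m)
    ultimately show "- \<mu>2 < Re (\<sigma> w)" "Re (\<sigma> w) \<le> \<mu>1" using half by linarith+
    show "Im (\<sigma> w) = - ln (cmod w) / (2 * pi)" using that by (simp add: \<sigma>_def Im_div Re_m)
  qed
  let ?S = "{s. - \<mu>2 < Re s \<and> Re s < 1 + \<mu>1}"
  have K_shift: "K (s + 1) = K s" if "- \<mu>2 < Re s" "Re s \<le> \<mu>1" for s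
  proof (cases "Re (s + 1) \<le> \<mu>1")
    case True
    then have False using that \<mu> by simp
    then show ?thesis ..
  next
    case False
    then show ?thesis using that by (simp add: K_def)
  qed
  have "h field_differentiable at w" if w: "w \<noteq> 0" for w
  proof (cases "w \<in> \<real>\<^sub>\<le>\<^sub>0")
    case False
    have "\<sigma> holomorphic_on - \<real>\<^sub>\<le>\<^sub>0" unfolding \<sigma>_def[abs_def] using \<tau> by (intro holomorphic_intros) auto
    then have "(K \<circ> \<sigma>) holomorphic_on - \<real>\<^sub>\<le>\<^sub>0"
    proof (rule holomorphic_on_compose_gen[OF _ holomorphic_K])
      show "\<sigma> ` (- \<real>\<^sub>\<le>\<^sub>0) \<subseteq> ?S"
      proof (rule image_subsetI)
        fix z :: complex assume "z \<in> - \<real>\<^sub>\<le>\<^sub>0"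
        then have "z \<noteq> 0" by auto
        from strip[OF this] show "\<sigma> z \<in> ?S" by simp
      qed
    qed
    then have "h holomorphic_on - \<real>\<^sub>\<le>\<^sub>0" by (simp only: h_def[abs_def] comp_def)
    then show ?thesis
      by (rule holomorphic_on_imp_differentiable_at) (use False in \<open>auto intro: open_Compl closed_nonpos_Reals_complex\<close>)
  next
    case True
    (* on the cut, a branch of the logarithm that maps to both sides of the line Re s = mu1, where K is holomorphic *)
    define \<sigma>' where "\<sigma>' w = m + 1 / 2 + Ln (- w) / \<tau>" for w
    let ?N = "{w :: complex. Re w < 0}"
    have "\<sigma>' holomorphic_on ?N"
      unfolding \<sigma>'_def[abs_def] using \<tau> by (intro holomorphic_intros) (auto simp: complex_nonpos_Reals_iff)
    then have "(K \<circ> \<sigma>') holomorphic_on ?N"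
    proof (rule holomorphic_on_compose_gen[OF _ holomorphic_K])
      show "\<sigma>' ` ?N \<subseteq> ?S"
      proof (rule image_subsetI)
        fix z :: complex assume "z \<in> ?N"
        then have z: "- z \<noteq> 0" by auto
        have "- 1 / 2 < Im (Ln (- z)) / (2 * pi)" "Im (Ln (- z)) / (2 * pi) \<le> 1 / 2"
          using mpi_less_Im_Ln[OF z] Im_Ln_le_pi[OF z] by (simp_all add: field_simps)
        then have "\<mu>1 - 1 / 2 < Re (\<sigma>' z)" "Re (\<sigma>' z) \<le> \<mu>1 + 1 / 2"
          using half by (auto simp: \<sigma>'_def Re_div Re_m)
        then show "\<sigma>' z \<in> ?S" using half \<mu>1 \<mu>2 \<mu> by simp
      qed
    qed
    moreover have "(K \<circ> \<sigma>') z = h z" if "z \<in> ?N" for z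
    proof -
      have z: "z \<noteq> 0" using that by auto
      have half_turn: "\<i> * complex_of_real pi / \<tau> = 1 / 2" by (simp add: \<tau>_def field_simps)
      show ?thesis
      proof (cases "Im z < 0")
        case True
        then have "Ln (- z) = Ln z + \<i> * complex_of_real pi" using Ln_minus[OF z] that by auto
        then have "\<sigma>' z = \<sigma> z + 1" by (simp add: \<sigma>'_def \<sigma>_def add_divide_distrib half_turn)
        then show ?thesis using K_shift[OF strip(1,2)[OF z]] by (simp add: h_def)
      next
        case False
        then have "Ln (- z) = Ln z - \<i> * complex_of_real pi" using Ln_minus[OF z] that by auto
        then have "\<sigma>' z = \<sigma> z" by (simp add: \<sigma>'_def \<sigma>_def diff_divide_distrib half_turn)
        then show ?thesis by (simp add: h_def)
      qed
    qed
    ultimately have "h holomorphic_on ?N" by (rule holomorphic_transform)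
    moreover have "open ?N" by (intro open_Collect_less continuous_intros)
    moreover have "w \<in> ?N" using True w by (auto simp: complex_nonpos_Reals_iff complex_eq_iff)
    ultimately show ?thesis by (rule holomorphic_on_imp_differentiable_at)
  qed
  then have holo: "h holomorphic_on - {0}"
    unfolding holomorphic_on_def by (blast intro: field_differentiable_at_within)
  obtain C where C: "0 \<le> C" and growth: "\<And>s. - \<mu>2 \<le> Re s \<Longrightarrow> Re s \<le> \<mu>1 \<Longrightarrow> 1 \<le> \<bar>Im s\<bar> \<Longrightarrow>
      cmod (H s) \<le> C * exp (2 * pi * \<bar>Im s\<bar>) / (Im s)\<^sup>2"
    using H_growth by blast
  have h_bound: "cmod (h w) \<le> C * exp \<bar>ln (cmod w)\<bar> / (ln (cmod w) / (2 * pi))\<^sup>2"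
    if w: "w \<noteq> 0" "2 * pi \<le> \<bar>ln (cmod w)\<bar>" for w
  proof -
    have "\<bar>Im (\<sigma> w)\<bar> = \<bar>ln (cmod w)\<bar> / (2 * pi)" using strip(3)[OF w(1)] by (simp add: abs_divide)
    moreover from this have "1 \<le> \<bar>Im (\<sigma> w)\<bar>" using w(2) by simp
    ultimately have "cmod (H (\<sigma> w)) \<le> C * exp \<bar>ln (cmod w)\<bar> / (Im (\<sigma> w))\<^sup>2"
      using growth[of "\<sigma> w"] strip(1,2)[OF w(1)] by simp
    then show ?thesis using strip[OF w(1)] by (simp add: h_def K_def)
  qed
  have "((\<lambda>w. w * h w) \<longlongrightarrow> 0) (at 0)"
  proof (rule Lim_null_comparison)
    show "\<forall>\<^sub>F w in at 0. norm (w * h w) \<le> C / (ln (cmod w) / (2 * pi))\<^sup>2"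
      unfolding eventually_at
    proof (intro exI[of _ "exp (- (2 * pi))"] conjI ballI impI)
      fix w :: complex assume "w \<noteq> 0 \<and> dist w 0 < exp (- (2 * pi))"
      then have w: "w \<noteq> 0" "cmod w < exp (- (2 * pi))" "0 < cmod w" by auto
      then have "ln (cmod w) < - (2 * pi)" by (metis ln_exp ln_less_cancel_iff exp_gt_zero)
      then have abs: "\<bar>ln (cmod w)\<bar> = - ln (cmod w)" "2 * pi \<le> \<bar>ln (cmod w)\<bar>" using pi_gt_zero by linarith+
      have "norm (w * h w) \<le> cmod w * (C * exp \<bar>ln (cmod w)\<bar> / (ln (cmod w) / (2 * pi))\<^sup>2)"
        unfolding norm_mult by (intro mult_left_mono h_bound w abs) auto
      also have "\<dots> = C / (ln (cmod w) / (2 * pi))\<^sup>2"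
        unfolding abs(1) using w by (simp add: exp_minus)
      finally show "norm (w * h w) \<le> C / (ln (cmod w) / (2 * pi))\<^sup>2" .
    qed simp
    have "((\<lambda>x. C / (ln x / (2 * pi))\<^sup>2) \<longlongrightarrow> 0) (at_right (0::real))" by real_asymp
    moreover have "filterlim cmod (at_right 0) (at (0::complex))"
      unfolding filterlim_at by (auto intro!: tendsto_norm_zero tendsto_ident_at simp: eventually_at_filter)
    ultimately show "((\<lambda>w. C / (ln (cmod w) / (2 * pi))\<^sup>2) \<longlongrightarrow> 0) (at 0)"
      by (rule filterlim_compose)
  qed
  moreover have "((\<lambda>w. h w / w) \<longlongrightarrow> 0) at_infinity"
  proof (rule Lim_null_comparison)
    show "\<forall>\<^sub>F w in at_infinity. norm (h w / w) \<le> C / (ln (cmod w) / (2 * pi))\<^sup>2"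
      unfolding eventually_at_infinity
    proof (intro exI[of _ "exp (2 * pi)"] allI impI)
      fix w :: complex assume le: "exp (2 * pi) \<le> cmod w"
      then have w: "0 < cmod w" "w \<noteq> 0" using exp_gt_zero[of "2 * pi"] by (linarith, auto)
      then have "2 * pi \<le> ln (cmod w)" using le by (simp add: ln_ge_iff)
      then have abs: "\<bar>ln (cmod w)\<bar> = ln (cmod w)" "2 * pi \<le> \<bar>ln (cmod w)\<bar>" using pi_gt_zero by linarith+
      have "norm (h w / w) \<le> (C * exp \<bar>ln (cmod w)\<bar> / (ln (cmod w) / (2 * pi))\<^sup>2) / cmod w"
        unfolding norm_divide by (intro divide_right_mono h_bound w abs) auto
      also have "\<dots> = C / (ln (cmod w) / (2 * pi))\<^sup>2"
        unfolding abs(1) using w by simp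
      finally show "norm (h w / w) \<le> C / (ln (cmod w) / (2 * pi))\<^sup>2" .
    qed
    have "((\<lambda>x. C / (ln x / (2 * pi))\<^sup>2) \<longlongrightarrow> 0) (at_top :: real filter)" by real_asymp
    then show "((\<lambda>w :: complex. C / (ln (cmod w) / (2 * pi))\<^sup>2) \<longlongrightarrow> 0) at_infinity"
      using filterlim_norm_at_top by (rule filterlim_compose)
  qed
  ultimately obtain c where c: "\<And>w. w \<noteq> 0 \<Longrightarrow> h w = c"
    using punctured_plane_constant[OF holo] by blast
  have "K s = c" if s: "- \<mu>2 < Re s" "Re s \<le> \<mu>1" for s
  proof -
    let ?z = "\<tau> * (s - m)"
    have Im: "Im ?z = 2 * pi * (Re s - (\<mu>1 - \<mu>2) / 2)" by (simp add: \<tau>_def Re_m)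
    have "- 1 / 2 < Re s - (\<mu>1 - \<mu>2) / 2" "Re s - (\<mu>1 - \<mu>2) / 2 \<le> 1 / 2" using s half by linarith+
    then have "2 * pi * (- 1 / 2) < Im ?z" "Im ?z \<le> 2 * pi * (1 / 2)"
      unfolding Im by (intro mult_strict_left_mono mult_left_mono; simp)+
    then have "Ln (exp ?z) = ?z" by (intro Ln_exp) auto
    then have "\<sigma> (exp ?z) = s" using \<tau> by (simp add: \<sigma>_def)
    then show ?thesis using c[of "exp ?z"] by (simp add: h_def)
  qed
  then show ?thesis by blast
qed

lemma strip_solution:
  "\<exists>C. \<forall>s. 0 \<le> Re s \<longrightarrow> Re s \<le> \<mu>1 \<longrightarrow> f (ys s) * D s = C * P s"
proof -
  obtain C where C: "\<And>s. - \<mu>2 < Re s \<Longrightarrow> Re s \<le> \<mu>1 \<Longrightarrow> K s = C" using K_constant by blast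
  have "f (ys s) * D s = C / complex_of_real k1 * P s" if s: "0 \<le> Re s" "Re s \<le> \<mu>1" for s
  proof -
    have "C = complex_of_real k1 * (s - \<alpha>) * f (ys s) * E s"
      using C[of s] s \<mu>2 by (simp add: K_def H_def glued_def)
    then have "C * P s = complex_of_real k1 * (f (ys s) * (E s * ((s - \<alpha>) * P s)))" by (simp add: mult_ac)
    also have "\<dots> = complex_of_real k1 * (f (ys s) * D s)" by (simp only: E(2))
    finally show ?thesis using k1 by simp
  qed
  then show ?thesis by blast
qed

end

section \<open>The denominator and its removable singularities\<close>

text \<open>
  The denominator as a function of \<open>y\<close>, with \<open>\<gamma>\<close> in place of the expression for \<open>\<gamma>\<^sub>1\<close>.
\<close>

definition dispersion :: "real \<Rightarrow> real \<Rightarrow> complex \<Rightarrow> complex" where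
  "dispersion \<mu> \<gamma> y = cos (of_real pi * csqrt (2 * y + of_real (\<mu>\<^sup>2))) - of_real (cos (pi * \<gamma>))"

lemma holomorphic_dispersion: "dispersion \<mu> \<gamma> holomorphic_on UNIV"
proof -
  have "(\<lambda>y. 2 * y + complex_of_real (\<mu>\<^sup>2)) holomorphic_on UNIV" by (intro holomorphic_intros)
  then have "((\<lambda>w. cos (of_real pi * csqrt w)) \<circ> (\<lambda>y. 2 * y + complex_of_real (\<mu>\<^sup>2))) holomorphic_on UNIV"
    using holomorphic_cos_csqrt by (rule holomorphic_on_compose_gen) simp
  then show ?thesis
    unfolding dispersion_def[abs_def] comp_def by (intro holomorphic_on_diff holomorphic_on_const)
qed

lemma dispersion_square: "dispersion \<mu> \<gamma> ((u\<^sup>2 - of_real (\<mu>\<^sup>2)) / 2) = cos (of_real pi * u) - of_real (cos (pi * \<gamma>))"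
proof -
  have "2 * ((u\<^sup>2 - of_real (\<mu>\<^sup>2)) / 2) + of_real (\<mu>\<^sup>2) = u\<^sup>2" by (simp add: field_simps)
  then show ?thesis by (simp only: dispersion_def cos_csqrt_square)
qed

lemma eventually_dispersion_nonzero: "\<forall>\<^sub>F z in at y. dispersion \<mu> \<gamma> z \<noteq> 0"
proof (cases "dispersion \<mu> \<gamma> y = 0")
  case True
  have "\<exists>\<beta>. dispersion \<mu> \<gamma> \<beta> \<noteq> 0"
  proof (rule ccontr)
    assume "\<not> ?thesis"
    then have zero: "dispersion \<mu> \<gamma> \<beta> = 0" for \<beta> by blast
    have "cos (complex_of_real pi * u) = of_real (cos (pi * \<gamma>))" for u
      using zero[of "(u\<^sup>2 - of_real (\<mu>\<^sup>2)) / 2"] by (simp only: dispersion_square right_minus_eq)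
    from this[of 0] this[of 1] have "cos (complex_of_real pi * 0) = cos (complex_of_real pi * 1)" by (simp only:)
    then show False by (simp add: cos_of_real)
  qed
  then obtain \<beta> where \<beta>: "dispersion \<mu> \<gamma> \<beta> \<noteq> 0" ..
  obtain r where r: "0 < r" "ball y r \<subseteq> UNIV" "\<And>z. z \<in> ball y r - {y} \<Longrightarrow> dispersion \<mu> \<gamma> z \<noteq> 0"
    by (rule isolated_zeros[OF holomorphic_dispersion open_UNIV connected_UNIV UNIV_I True UNIV_I \<beta>],
        rule that, assumption, assumption, blast)
  show ?thesis
    unfolding eventually_at
  proof (intro exI[of _ r] conjI ballI impI r)
    fix z assume "z \<noteq> y \<and> dist z y < r"
    then show "z \<in> ball y r - {y}" by (simp add: dist_commute)
  qed
next
  case False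
  have "isCont (dispersion \<mu> \<gamma>) y"
    using holomorphic_on_imp_continuous_on[OF holomorphic_dispersion] by (simp add: continuous_on_eq_continuous_at)
  then have "(dispersion \<mu> \<gamma> \<longlongrightarrow> dispersion \<mu> \<gamma> y) (at y)" by (simp only: isCont_def)
  then show ?thesis using False by (rule tendsto_imp_eventually_ne)
qed

text \<open>
  At a zero, the square root in the cosine is real, hence \<open>y\<close> is real.
\<close>

lemma dispersion_zero_on_axis:
  assumes "dispersion \<mu> \<gamma> y = 0" and "Re y = 0"
  shows "y = 0"
proof -
  define u where "u = csqrt (2 * y + of_real (\<mu>\<^sup>2))"
  have "cos (complex_of_real pi * u) = cos (complex_of_real (pi * \<gamma>))"
    using assms(1) by (simp only: dispersion_def u_def cos_of_real right_minus_eq)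
  then obtain j :: real where
    "complex_of_real pi * u = complex_of_real (pi * \<gamma>) + of_real (2 * j * pi) \<or>
     complex_of_real pi * u = - complex_of_real (pi * \<gamma>) + of_real (2 * j * pi)"
    unfolding complex_cos_eq by blast
  then have "Im (complex_of_real pi * u) = 0" by (elim disjE) (simp_all only:, simp_all)
  then have "Im (u\<^sup>2) = 0" by (simp add: power2_eq_square)
  then have "Im (2 * y + of_real (\<mu>\<^sup>2)) = 0" by (simp only: u_def power2_csqrt)
  then have "Im y = 0" by simp
  with assms(2) show ?thesis by (simp add: complex_eq_iff)
qed

lemma dispersion_derivative_zero:
  assumes "0 < \<mu>" "\<mu> < 1"
  shows "\<exists>d. d \<noteq> 0 \<and> (dispersion \<mu> \<gamma> has_field_derivative d) (at 0)"
proof -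
  have c: "csqrt (2 * 0 + complex_of_real (\<mu>\<^sup>2)) = complex_of_real \<mu>"
    using assms csqrt_square[of "complex_of_real \<mu>"] by simp
  have nn: "2 * 0 + complex_of_real (\<mu>\<^sup>2) \<notin> \<real>\<^sub>\<le>\<^sub>0"
    using assms by (simp add: complex_nonpos_Reals_iff not_le)
  have "(dispersion \<mu> \<gamma> has_field_derivative
      - sin (of_real pi * of_real \<mu>) * (of_real pi * (2 / (2 * complex_of_real \<mu>)))) (at 0)"
    unfolding dispersion_def[abs_def]
    by (rule derivative_eq_intros refl nn | simp only: c)+ (simp add: field_simps)
  moreover have "sin (complex_of_real pi * of_real \<mu>) = of_real (sin (pi * \<mu>))" by (simp flip: sin_of_real)
  moreover have "sin (pi * \<mu>) > 0" using assms by (intro sin_gt_zero) auto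
  ultimately show ?thesis using assms by (intro exI conjI) auto
qed

text \<open>
  At a zero with \<open>Re y < 0\<close> the quotient equals \<open>\<phi>\<close> in a punctured neighbourhood. The only zero on
  the boundary of the half plane is \<open>0\<close>. A punctured neighbourhood of it meets the right half
  plane, where \<open>\<phi>\<close> gives no information; but the zero is simple and the numerator vanishes there
  too, so the quotient has a limit, which continuity of \<open>\<phi>\<close> on the left identifies.
\<close>

lemma removable_quotient:
  fixes \<phi> p :: "complex \<Rightarrow> complex"
  assumes \<mu>: "0 < \<mu>" "\<mu> < 1"
    and cont: "continuous_on {y. Re y \<le> 0} \<phi>"
    and p: "p field_differentiable at 0"
    and eq: "\<And>y. Re y \<le> 0 \<Longrightarrow> \<phi> y * dispersion \<mu> \<gamma> y = p y"
    and y: "Re y \<le> 0"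
  shows "dispersion \<mu> \<gamma> y \<noteq> 0 \<Longrightarrow> \<phi> y = p y / dispersion \<mu> \<gamma> y"
    and "dispersion \<mu> \<gamma> y = 0 \<Longrightarrow> ((\<lambda>z. p z / dispersion \<mu> \<gamma> z) \<longlongrightarrow> \<phi> y) (at y)"
proof -
  let ?D = "dispersion \<mu> \<gamma>"
  show quot: "\<phi> y = p y / ?D y" if "?D y \<noteq> 0" using eq[OF y] that by (simp add: field_simps)
  assume zero: "?D y = 0"
  have ev: "\<forall>\<^sub>F z in at y. ?D z \<noteq> 0" by (rule eventually_dispersion_nonzero)
  show "((\<lambda>z. p z / ?D z) \<longlongrightarrow> \<phi> y) (at y)"
  proof (cases "Re y < 0")
    case True
    have op: "open {y. Re y < 0}" by (intro open_Collect_less continuous_intros)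
    have "continuous_on {y. Re y < 0} \<phi>" using cont by (rule continuous_on_subset) auto
    then have "(\<phi> \<longlongrightarrow> \<phi> y) (at y)"
      using op True by (simp add: continuous_on_eq_continuous_at isCont_def)
    moreover have "\<forall>\<^sub>F z in at y. \<phi> z = p z / ?D z"
    proof -
      have "\<forall>\<^sub>F z in at y. z \<in> {y. Re y < 0}"
        using op True by (intro eventually_at_in_open') auto
      with ev show ?thesis
      proof eventually_elim
        case (elim z)
        then show ?case using eq[of z] by (simp add: field_simps)
      qed
    qed
    ultimately show ?thesis by (rule Lim_transform_eventually)
  next
    case False
    with y dispersion_zero_on_axis[OF zero] have y0: "y = 0" by simp
    obtain d where d: "d \<noteq> 0" "(?D has_field_derivative d) (at 0)"
      using dispersion_derivative_zero[OF \<mu>] by blast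
    obtain e where e: "(p has_field_derivative e) (at 0)" using p by (auto simp: field_differentiable_def)
    have D0: "?D 0 = 0" using zero y0 by simp
    have p0: "p 0 = 0" using eq[of 0] D0 by simp
    have "((\<lambda>z. (p z / z) / (?D z / z)) \<longlongrightarrow> e / d) (at 0)"
      using DERIV_D[OF e] DERIV_D[OF d(2)] d(1) D0 p0 by (intro tendsto_divide) simp_all
    moreover have "\<forall>\<^sub>F z in at 0. (p z / z) / (?D z / z) = p z / ?D z"
      by (simp add: eventually_at_filter)
    ultimately have lim: "((\<lambda>z. p z / ?D z) \<longlongrightarrow> e / d) (at 0)" by (rule Lim_transform_eventually)
    (* the limit is identified from inside the half plane, along z = -1/(n+1) *)
    define w where "w n = complex_of_real (- (1 / real (Suc n)))" for n
    have "w \<longlonglongrightarrow> complex_of_real (- 0)"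
      unfolding w_def by (intro tendsto_intros LIMSEQ_Suc lim_1_over_n)
    then have w0: "w \<longlonglongrightarrow> 0" by simp
    have wne: "w n \<noteq> 0" "Re (w n) \<le> 0" for n unfolding w_def by (simp_all del: of_nat_Suc)
    have fw: "filterlim w (at 0) sequentially"
      unfolding filterlim_at using w0 wne by simp
    have "(\<lambda>n. p (w n) / ?D (w n)) \<longlonglongrightarrow> e / d"
      by (rule filterlim_compose[OF lim fw])
    moreover have "\<forall>\<^sub>F n in sequentially. p (w n) / ?D (w n) = \<phi> (w n)"
    proof -
      have "\<forall>\<^sub>F n in sequentially. ?D (w n) \<noteq> 0"
        using eventually_compose_filterlim[OF ev[unfolded y0] fw] .
      then show ?thesis
      proof eventually_elim
        case (elim n)
        then show ?case using eq[OF wne(2)[of n]] by (simp add: field_simps)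
      qed
    qed
    ultimately have l1: "(\<lambda>n. \<phi> (w n)) \<longlonglongrightarrow> e / d" by (rule Lim_transform_eventually)
    have "(\<lambda>n. \<phi> (w n)) \<longlonglongrightarrow> \<phi> 0"
      using w0 wne by (intro continuous_on_tendsto_compose[OF cont]) auto
    from LIMSEQ_unique[OF l1 this] lim show ?thesis by (simp add: y0)
  qed
qed

context strip_problem
begin

definition root_poly :: "complex \<Rightarrow> complex" where
  "root_poly y = (\<Prod>k=1..n. y - of_real (2 * (a + real k) * (a + real k - \<mu>1)))"

lemma root_poly_ys: "root_poly (ys s) = P s"
  unfolding root_poly_def P_def
  by (intro prod.cong refl) (simp add: ys_def algebra_simps)

lemma dispersion_ys: "dispersion \<mu>1 (\<mu>1 - 2 * a) (ys s) = D s"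
proof -
  have "ys s = ((2 * s - m1)\<^sup>2 - of_real (\<mu>1\<^sup>2)) / 2"
    by (simp add: ys_def power2_eq_square field_simps)
  then show ?thesis by (simp only: dispersion_square D_def cos_of_real)
qed

text \<open>
  The map \<open>s \<mapsto> y(s)\<close> takes the strip only onto the inside of a parabola in the half plane. Analytic
  continuation from a real segment in it and continuity up to the imaginary axis give the rest.
\<close>

lemma half_plane_solution:
  "\<exists>C. \<forall>y. Re y \<le> 0 \<longrightarrow> f y * dispersion \<mu>1 (\<mu>1 - 2 * a) y = C * root_poly y"
proof -
  obtain C where C: "\<And>s. 0 \<le> Re s \<Longrightarrow> Re s \<le> \<mu>1 \<Longrightarrow> f (ys s) * D s = C * P s"
    using strip_solution by blast
  define \<Phi> where "\<Phi> y = f y * dispersion \<mu>1 (\<mu>1 - 2 * a) y - C * root_poly y" for y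
  let ?N = "{y. Re y < 0}"
  define U where "U = complex_of_real ` {- \<mu>1\<^sup>2 / 2<..<0}"
  have root_holo: "root_poly holomorphic_on S" for S
    unfolding root_poly_def[abs_def] by (intro holomorphic_intros)
  have disp_holo: "dispersion \<mu>1 (\<mu>1 - 2 * a) holomorphic_on S" for S
    using holomorphic_dispersion by (rule holomorphic_on_subset) simp
  have holo: "\<Phi> holomorphic_on ?N"
    unfolding \<Phi>_def[abs_def] by (intro holomorphic_intros holo_f disp_holo root_holo)
  have op: "open ?N" by (intro open_Collect_less continuous_intros)
  have conn: "connected ?N"
    by (intro convex_connected convex_halfspace_Re_lt)
  have sub: "U \<subseteq> ?N" by (auto simp: U_def)
  have mem: "complex_of_real (- \<mu>1\<^sup>2 / 4) \<in> ?N" using \<mu>1 by simp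
  have lim: "complex_of_real (- \<mu>1\<^sup>2 / 4) islimpt U"
  proof -
    have "(- \<mu>1\<^sup>2 / 4) islimpt {- \<mu>1\<^sup>2 / 2<..<0}"
      using \<mu>1 by (simp add: islimpt_greaterThanLessThan1 interior_limit_point)
    then show ?thesis unfolding U_def
      by (intro islimpt_isCont_image) (simp_all only: eventually_at_filter of_real_eq_iff, simp_all)
  qed
  have zU: "\<Phi> y = 0" if "y \<in> U" for y
  proof -
    from that obtain t where t: "y = complex_of_real t" "- \<mu>1\<^sup>2 / 2 < t" "t < 0" by (auto simp: U_def)
    (* the larger real solution of 2 s (s - mu1) = t lies in the strip *)
    define q where "q = sqrt (2 * t + \<mu>1\<^sup>2)"
    have q: "0 \<le> q" "q\<^sup>2 = 2 * t + \<mu>1\<^sup>2" using t by (auto simp: q_def)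
    have "q \<le> \<mu>1" using t \<mu>1 unfolding q_def by (intro real_le_lsqrt) auto
    define s where "s = (\<mu>1 + q) / 2"
    have "2 * s * (s - \<mu>1) = (q\<^sup>2 - \<mu>1\<^sup>2) / 2" by (simp add: s_def field_simps power2_eq_square)
    then have "2 * s * (s - \<mu>1) = t" using q(2) by simp
    then have "complex_of_real (2 * s * (s - \<mu>1)) = y" using t(1) by simp
    then have y: "ys (complex_of_real s) = y" by (simp add: ys_def)
    have "0 \<le> s" "s \<le> \<mu>1" using q \<open>q \<le> \<mu>1\<close> \<mu>1 by (auto simp: s_def)
    then show ?thesis
      using C[of "complex_of_real s"] unfolding \<Phi>_def y[symmetric] dispersion_ys root_poly_ys by simp
  qed
  have zero: "\<Phi> y = 0" if "y \<in> ?N" for y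
    by (rule analytic_continuation[OF holo op conn sub mem lim zU that])
  have closure: "closure ?N = {y. Re y \<le> 0}"
    using closure_halfspace_lt[of "1 :: complex" 0] by simp
  have "\<Phi> y = 0" if "Re y \<le> 0" for y
  proof (rule continuous_constant_on_closure[of ?N \<Phi> 0, OF _ zero])
    show "continuous_on (closure ?N) \<Phi>"
      unfolding closure \<Phi>_def[abs_def]
      by (intro continuous_intros cont_f holomorphic_on_imp_continuous_on disp_holo root_holo)
    show "y \<in> closure ?N" using that by (simp add: closure)
  qed
  then show ?thesis unfolding \<Phi>_def by (intro exI[of _ C]) simp
qed

lemma half_plane_solution_real:
  assumes "\<And>t. t < 0 \<Longrightarrow> f (complex_of_real t) \<in> \<real>"
  shows "\<exists>c::real. \<forall>y. Re y \<le> 0 \<longrightarrow> f y * dispersion \<mu>1 (\<mu>1 - 2 * a) y = of_real c * root_poly y"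
proof -
  obtain C where C: "\<And>y. Re y \<le> 0 \<Longrightarrow> f y * dispersion \<mu>1 (\<mu>1 - 2 * a) y = C * root_poly y"
    using half_plane_solution by blast
  \<comment> \<open>a real point where the constant is a quotient of real numbers\<close>
  have "\<exists>t\<in>{- \<mu>1\<^sup>2 / 2<..<0} - (\<lambda>k. 2 * (a + real k) * (a + real k - \<mu>1)) ` {1..n}. True"
  proof -
    have "infinite ({- \<mu>1\<^sup>2 / 2<..<0} - (\<lambda>k. 2 * (a + real k) * (a + real k - \<mu>1)) ` {1..n})"
      using \<mu>1 by (intro Diff_infinite_finite) auto
    then have "{- \<mu>1\<^sup>2 / 2<..<0} - (\<lambda>k. 2 * (a + real k) * (a + real k - \<mu>1)) ` {1..n} \<noteq> {}"
      using infinite_imp_nonempty by blast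
    then show ?thesis by blast
  qed
  then obtain t where t: "- \<mu>1\<^sup>2 / 2 < t" "t < 0" "t \<notin> (\<lambda>k. 2 * (a + real k) * (a + real k - \<mu>1)) ` {1..n}"
    by auto
  define R where "R = (\<Prod>k=1..n. t - 2 * (a + real k) * (a + real k - \<mu>1))"
  have root: "root_poly (complex_of_real t) = of_real R" by (simp add: root_poly_def R_def)
  have "R \<noteq> 0" using t(3) by (auto simp: R_def)
  have "csqrt (2 * complex_of_real t + of_real (\<mu>1\<^sup>2)) = of_real (sqrt (2 * t + \<mu>1\<^sup>2))"
    using t(1) csqrt_of_real_nonneg[of "complex_of_real (2 * t + \<mu>1\<^sup>2)"] by simp
  then have "dispersion \<mu>1 (\<mu>1 - 2 * a) (complex_of_real t) = of_real (cos (pi * sqrt (2 * t + \<mu>1\<^sup>2)) - cos (pi * (\<mu>1 - 2 * a)))"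
    by (simp add: dispersion_def flip: of_real_mult cos_of_real)
  moreover obtain r where "f (complex_of_real t) = of_real r" using assms[OF t(2)] by (auto elim: Reals_cases)
  ultimately have "C * of_real R = of_real (r * (cos (pi * sqrt (2 * t + \<mu>1\<^sup>2)) - cos (pi * (\<mu>1 - 2 * a))))"
    using C[of "complex_of_real t"] t(2) root by simp
  then have "C = of_real (r * (cos (pi * sqrt (2 * t + \<mu>1\<^sup>2)) - cos (pi * (\<mu>1 - 2 * a)))) / of_real R"
    using \<open>R \<noteq> 0\<close> by (simp add: eq_divide_eq)
  then have "C = of_real (r * (cos (pi * sqrt (2 * t + \<mu>1\<^sup>2)) - cos (pi * (\<mu>1 - 2 * a))) / R)" by simp
  then show ?thesis using C by blast
qed

end

section \<open>The Laplace transform of the lateral measure\<close>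

lemma map_poly_of_real_mult:
  fixes p q :: "real poly"
  shows "map_poly of_real (p * q) = (map_poly of_real p * map_poly of_real q :: complex poly)"
  by (intro poly_eqI) (simp add: coeff_map_poly coeff_mult)

lemma map_poly_of_real_prod:
  fixes p :: "'i \<Rightarrow> real poly"
  shows "map_poly of_real (\<Prod>i\<in>A. p i) = (\<Prod>i\<in>A. map_poly of_real (p i) :: complex poly)"
  by (induction A rule: infinite_finite_induct) (simp_all add: map_poly_of_real_mult)

text \<open>
  From \<open>(1 + r1) (1 + r2) \<gamma> = 1 - r1 r2\<close>: if \<open>1 + r1\<close> and \<open>1 + r2\<close> were both negative, \<open>r1 r2 > 1\<close>
  would make the right-hand side negative.
\<close>

lemma reflection_bounds:
  fixes r1 r2 \<mu>1 \<mu>2 :: real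
  assumes \<mu>: "\<mu>1 + \<mu>2 = 1" and r1: "r1 \<noteq> -1" and r2: "r2 \<noteq> -1"
    and wedge: "1 - r1 * r2 > 0 \<or> (r1 > 0 \<and> r2 > 0)" and gam: "gam r1 r2 \<mu>1 \<mu>2 > 0"
  shows "1 + r1 > 0" "1 + r2 > 0"
proof -
  have nz: "1 + r1 \<noteq> 0" "1 + r2 \<noteq> 0" using r1 r2 by auto
  have s: "(1 + r1) * s1 r1 \<mu>1 \<mu>2 = r1 * \<mu>1 - \<mu>2" "(1 + r2) * s2 r2 \<mu>1 \<mu>2 = \<mu>1 - r2 * \<mu>2"
    using nz by (simp_all add: s1_def s2_def)
  have "(1 + r1) * (1 + r2) * gam r1 r2 \<mu>1 \<mu>2 =
      (1 + r1) * ((1 + r2) * s2 r2 \<mu>1 \<mu>2) - (1 + r2) * ((1 + r1) * s1 r1 \<mu>1 \<mu>2)"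
    by (simp add: gam_def algebra_simps)
  also have "\<dots> = (1 - r1 * r2) * (\<mu>1 + \<mu>2)" unfolding s by (simp add: algebra_simps)
  finally have prod: "(1 + r1) * (1 + r2) * gam r1 r2 \<mu>1 \<mu>2 = 1 - r1 * r2" by (simp add: \<mu>)
  have "1 + r1 > 0 \<and> 1 + r2 > 0"
  proof (cases "r1 > 0 \<and> r2 > 0")
    case False
    with wedge have pos: "1 - r1 * r2 > 0" by simp
    with prod gam have "(1 + r1) * (1 + r2) > 0" by (metis zero_less_mult_pos2)
    then consider "1 + r1 > 0" "1 + r2 > 0" | "1 + r1 < 0" "1 + r2 < 0" by (auto simp: zero_less_mult_iff)
    then show ?thesis
    proof cases
      case 2
      then have "1 * 1 \<le> (- r1) * (- r2)" by (intro mult_mono) auto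
      with pos show ?thesis by simp
    qed simp
  qed simp
  then show "1 + r1 > 0" "1 + r2 > 0" by simp_all
qed

theorem theorem47:
  fixes r\<^sub>1 r\<^sub>2 \<mu>\<^sub>1 \<mu>\<^sub>2 :: real and n :: nat
    and M :: "'a measure" and F :: "real \<Rightarrow> 'a measure"
    and G W L :: "real \<Rightarrow> 'a \<Rightarrow> real^2" and \<pi> :: "(real^2) measure"
  assumes "\<mu>\<^sub>1 > 0" and "\<mu>\<^sub>2 > 0" and "\<mu>\<^sub>1 + \<mu>\<^sub>2 = 1"
    and "1 - r\<^sub>1 * r\<^sub>2 > 0 \<or> (r\<^sub>1 > 0 \<and> r\<^sub>2 > 0)"
    and "\<mu>\<^sub>1 - r\<^sub>2 * \<mu>\<^sub>2 > 0" and "\<mu>\<^sub>2 - r\<^sub>1 * \<mu>\<^sub>1 > 0"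
    and "r\<^sub>1 \<noteq> -1" and "r\<^sub>2 \<noteq> -1"
    and "degenerate_reflected_bm M F r\<^sub>1 r\<^sub>2 \<mu>\<^sub>1 \<mu>\<^sub>2 G W L"
    and "invariant_law M G \<pi>"
    and "n \<ge> 1" and "gam r\<^sub>1 r\<^sub>2 \<mu>\<^sub>1 \<mu>\<^sub>2 = real n"
  shows "\<exists>(P :: real poly) (c :: real).
           degree P = n \<and>
           P = (\<Prod>k=1..n. [:- y_fun \<mu>\<^sub>1 (s1 r\<^sub>1 \<mu>\<^sub>1 \<mu>\<^sub>2 + real k), 1:]) \<and>
           (\<forall>y. Re y \<le> 0 \<longrightarrow>
              (let Q = (\<lambda>z. of_real c * poly (map_poly of_real P) z / denom r\<^sub>1 \<mu>\<^sub>1 \<mu>\<^sub>2 z) in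
                 (denom r\<^sub>1 \<mu>\<^sub>1 \<mu>\<^sub>2 y \<noteq> 0 \<longrightarrow> phi1 M G L y = Q y) \<and>
                 (denom r\<^sub>1 \<mu>\<^sub>1 \<mu>\<^sub>2 y = 0 \<longrightarrow> (Q \<longlongrightarrow> phi1 M G L y) (at y))))"
proof -
  let ?s1 = "s1 r\<^sub>1 \<mu>\<^sub>1 \<mu>\<^sub>2"
  define P where "P = (\<Prod>k=1..n. [:- y_fun \<mu>\<^sub>1 (?s1 + real k), 1:])"
  have "gam r\<^sub>1 r\<^sub>2 \<mu>\<^sub>1 \<mu>\<^sub>2 > 0" using assms(11,12) by simp
  note pos = reflection_bounds[OF assms(3,7,8,4) this]
  interpret S: stationary_reflected_bm M F r\<^sub>1 r\<^sub>2 \<mu>\<^sub>1 \<mu>\<^sub>2 G W L \<pi> 2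
    by unfold_locales (use assms(9,10) pos assms(3) in simp_all)
  obtain B1 where B1: "\<And>y. Re y \<le> 0 \<Longrightarrow> cmod (S.lateral1 y) \<le> B1" using S.lateral_regular(5) by blast
  obtain B2 where B2: "\<And>y. Re y \<le> 0 \<Longrightarrow> cmod (S.lateral2 y) \<le> B2" using S.lateral_regular(6) by blast
  have s2: "complex_of_real (s2 r\<^sub>2 \<mu>\<^sub>1 \<mu>\<^sub>2) = complex_of_real ?s1 + of_nat n"
  proof -
    have "s2 r\<^sub>2 \<mu>\<^sub>1 \<mu>\<^sub>2 = ?s1 + real n" using assms(12) by (simp add: gam_def)
    then show ?thesis by simp
  qed
  interpret Z: strip_problem "1 + r\<^sub>1" "1 + r\<^sub>2" \<mu>\<^sub>1 \<mu>\<^sub>2 ?s1 n S.lateral1 S.lateral2 "max B1 B2"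
  proof
    show "cmod (S.lateral1 y) \<le> max B1 B2" "cmod (S.lateral2 y) \<le> max B1 B2" if "Re y \<le> 0" for y
      using B1[OF that] B2[OF that] by auto
    fix b :: real and s :: complex
    assume "b \<noteq> 0" "s = \<i> * complex_of_real b"
    from S.functional_equation[OF this]
    show "complex_of_real (1 + r\<^sub>1) * (s - complex_of_real ?s1) * S.lateral1 (2 * s * (s - complex_of_real \<mu>\<^sub>1)) +
      complex_of_real (1 + r\<^sub>2) * (s - complex_of_real ?s1 - of_nat n) * S.lateral2 (2 * s * (s + complex_of_real \<mu>\<^sub>2)) = 0"
      unfolding s2 diff_diff_add .
  qed (use pos assms(1,2,3,11) S.lateral_regular in simp_all)
  obtain c :: real where c: "\<And>y. Re y \<le> 0 \<Longrightarrow>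
      S.lateral1 y * dispersion \<mu>\<^sub>1 (\<mu>\<^sub>1 - 2 * ?s1) y = of_real c * Z.root_poly y"
    using Z.half_plane_solution_real[OF S.lateral1_real] by blast
  have denom: "denom r\<^sub>1 \<mu>\<^sub>1 \<mu>\<^sub>2 = dispersion \<mu>\<^sub>1 (\<mu>\<^sub>1 - 2 * ?s1)"
    by (rule ext) (simp only: denom_def dispersion_def gam1_def)
  have poly_P: "poly (map_poly of_real P) z = Z.root_poly z" for z
  proof -
    have "poly (map_poly of_real P) z = (\<Prod>k=1..n. z - complex_of_real (y_fun \<mu>\<^sub>1 (?s1 + real k)))"
      unfolding P_def map_poly_of_real_prod poly_prod by (simp add: map_poly_pCons)
    then show ?thesis by (simp only: Z.root_poly_def y_fun_def)
  qed
  have "(\<lambda>z. complex_of_real c * Z.root_poly z) field_differentiable at 0"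
    unfolding Z.root_poly_def
    by (rule holomorphic_on_imp_differentiable_at[where s=UNIV]) (auto intro!: holomorphic_intros)
  note quotient = removable_quotient[OF _ _ S.lateral_regular(1) this c]
  have phi: "phi1 M G L y = S.lateral1 y" for y by (rule S.phi1_eq_lateral1) simp
  have "\<mu>\<^sub>1 < 1" using assms(2,3) by simp
  show ?thesis
  proof (intro exI[of _ P] exI[of _ c] conjI allI impI)
    show "degree P = n"
      unfolding P_def by (subst degree_prod_eq_sum_degree) simp_all
    show "P = (\<Prod>k=1..n. [:- y_fun \<mu>\<^sub>1 (?s1 + real k), 1:])" by (rule P_def)
    show "let Q = (\<lambda>z. of_real c * poly (map_poly of_real P) z / denom r\<^sub>1 \<mu>\<^sub>1 \<mu>\<^sub>2 z) in
        (denom r\<^sub>1 \<mu>\<^sub>1 \<mu>\<^sub>2 y \<noteq> 0 \<longrightarrow> phi1 M G L y = Q y) \<and>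
        (denom r\<^sub>1 \<mu>\<^sub>1 \<mu>\<^sub>2 y = 0 \<longrightarrow> (Q \<longlongrightarrow> phi1 M G L y) (at y))" if "Re y \<le> 0" for y
      unfolding Let_def poly_P denom phi
      using quotient[OF assms(1) \<open>\<mu>\<^sub>1 < 1\<close> _ that] by blast
  qed
qed

end
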